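(* The symmetric 3-sat problem (given a symmetric 3-sat formula, decide whether it is satisfiable) is NP-hard (and thus NP-complete).
   Context: Formulas are in propositional variables $x_0,x_1,\dots$. A literal is $x_j$ or $\neg x_j$. A 3-clause is a disjunction of three literals (repetitions of variables allowed); a 3-sat formula is a conjunction of finitely many 3-clauses. The mirror of a 3-clause is the 3-clause obtained by replacing each literal by its negation. A 3-sat formula is symmetric if, for every clause in it, the mirror clause also appears in the formula, the same number of times. *)

theory Defs
  imports Main "HOL-Computational_Algebra.Polynomial"
begin

section \<open>Symmetric 3-sat\<close>

datatype literal = Pos nat | Neg nat

type_synonym clause3 = "literal \<times> literal \<times> literal"

text \<open>Formulas are lists, so the number of times a clause appears is meaningful.
  Clauses are written disjunctions, i.e. ordered triples: neither the order of the literals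
  in a clause nor the order of the clauses is abstracted from.\<close>

type_synonym formula = "clause3 list"

fun lit_sat :: "(nat \<Rightarrow> bool) \<Rightarrow> literal \<Rightarrow> bool" where
  "lit_sat v (Pos j) = v j"
| "lit_sat v (Neg j) = (\<not> v j)"

fun clause_sat :: "(nat \<Rightarrow> bool) \<Rightarrow> clause3 \<Rightarrow> bool" where
  "clause_sat v (a, b, c) = (lit_sat v a \<or> lit_sat v b \<or> lit_sat v c)"

definition satisfiable :: "formula \<Rightarrow> bool" where
  "satisfiable \<phi> \<longleftrightarrow> (\<exists>v. \<forall>C\<in>set \<phi>. clause_sat v C)"

fun negate :: "literal \<Rightarrow> literal" where
  "negate (Pos j) = Neg j"
| "negate (Neg j) = Pos j"

fun mirror :: "clause3 \<Rightarrow> clause3" where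
  "mirror (a, b, c) = (negate a, negate b, negate c)"

definition symmetric :: "formula \<Rightarrow> bool" where
  "symmetric \<phi> \<longleftrightarrow>
     (\<forall>C\<in>set \<phi>. mirror C \<in> set \<phi> \<and> count_list \<phi> (mirror C) = count_list \<phi> C)"

text \<open>Binary representation without leading zeros, least significant bit first.\<close>

fun binary :: "nat \<Rightarrow> bool list" where
  "binary n = (if n = 0 then [] else odd n # binary (n div 2))"

declare binary.simps [simp del]

text \<open>A formula is written as a word over the four characters positive sign, negative sign,
  digit 0, digit 1, each coded by two bits: \<open>11\<close>, \<open>10\<close>, \<open>00\<close>, \<open>01\<close>. Every literal begins with
  a sign and every clause has three literals, so no separators are needed.\<close>

definition encode_index :: "nat \<Rightarrow> bool list" where
  "encode_index j = concat (map (\<lambda>b. [False, b]) (binary j))"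

fun encode_literal :: "literal \<Rightarrow> bool list" where
  "encode_literal (Pos j) = [True, True] @ encode_index j"
| "encode_literal (Neg j) = [True, False] @ encode_index j"

fun encode_clause :: "clause3 \<Rightarrow> bool list" where
  "encode_clause (a, b, c) = encode_literal a @ encode_literal b @ encode_literal c"

definition encode :: "formula \<Rightarrow> bool list" where
  "encode \<phi> = concat (map encode_clause \<phi>)"

definition symmetric_3SAT :: "bool list set" where
  "symmetric_3SAT = {encode \<phi> | \<phi>. symmetric \<phi> \<and> satisfiable \<phi>}"

lemma binary_inj: "binary m = binary n \<Longrightarrow> m = n"
proof (induction m arbitrary: n rule: binary.induct)
  case (1 m)
  show ?case
  proof (cases "m = 0 \<or> n = 0")
    case True
    then show ?thesis using 1(2) by (auto simp: binary.simps[of m] binary.simps[of n] split: if_splits)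
  next
    case False
    then have "odd m = odd n" "binary (m div 2) = binary (n div 2)"
      using 1(2) by (auto simp: binary.simps[of m] binary.simps[of n])
    then have "m div 2 = n div 2" "m mod 2 = n mod 2"
      using 1(1) False by (auto simp: odd_iff_mod_2_eq_one)
    then show ?thesis by (metis div_mult_mod_eq)
  qed
qed

lemma encode_digits_append_inj:
  assumes "concat (map (\<lambda>b. [False, b]) xs) @ r = concat (map (\<lambda>b. [False, b]) ys) @ s"
    and "r = [] \<or> hd r" and "s = [] \<or> hd s"
  shows "xs = ys \<and> r = s"
  using assms
proof (induction xs arbitrary: ys)
  case Nil
  then show ?case by (cases ys) auto
next
  case (Cons x xs)
  then show ?case by (cases ys) auto
qed

lemma encode_literal_append_inj:
  assumes "encode_literal a @ r = encode_literal b @ s"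
    and "r = [] \<or> hd r" and "s = [] \<or> hd s"
  shows "a = b \<and> r = s"
  using assms
  by (cases a; cases b)
    (auto simp: encode_index_def dest!: encode_digits_append_inj[OF _ assms(2,3)]
      dest: binary_inj)

lemma hd_encode_literal_append [simp]: "hd (encode_literal a @ r)"
  by (cases a) auto

lemma hd_encode: "encode \<phi> = [] \<or> hd (encode \<phi>)"
  by (cases \<phi>) (auto simp: encode_def)

lemma encode_inj: "inj encode"
proof (rule injI)
  show "\<phi> = \<psi>" if "encode \<phi> = encode \<psi>" for \<phi> \<psi>
    using that
  proof (induction \<phi> arbitrary: \<psi>)
    case Nil
    have "encode_literal a \<noteq> []" for a by (cases a) auto
    with Nil show ?case by (cases \<psi>) (auto simp: encode_def)
  next
    case (Cons C \<phi>)
    obtain a b c where C: "C = (a, b, c)" by (cases C)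
    have ne: "encode_literal l \<noteq> []" for l by (cases l) auto
    from Cons.prems C ne obtain D \<psi>' where \<psi>: "\<psi> = D # \<psi>'"
      by (cases \<psi>) (auto simp: encode_def)
    obtain a' b' c' where D: "D = (a', b', c')" by (cases D)
    have "encode_literal a @ encode_literal b @ encode_literal c @ encode \<phi>
        = encode_literal a' @ encode_literal b' @ encode_literal c' @ encode \<psi>'"
      using Cons.prems by (simp add: C D \<psi> encode_def)
    then have "a = a'" "b = b'" "c = c'" "encode \<phi> = encode \<psi>'"
      using hd_encode[of \<phi>] hd_encode[of \<psi>']
      by (metis encode_literal_append_inj hd_encode_literal_append)+
    with Cons.IH show ?case by (simp add: C D \<psi>)
  qed
qed


section \<open>Deterministic multi-tape Turing machines\<close>

text \<open>States are \<open>{..<states M}\<close>, tape symbols \<open>{..<symbols M}\<close>; symbol 0 is the blank, 1 and 2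
  are the input bits 0 and 1. Tapes are infinite in both directions. The input stands on the
  first tape, the output on the last one.\<close>

datatype move = Lft | Stay | Rgt

record tm =
  tapes :: nat
  states :: nat
  symbols :: nat
  start :: nat
  halt :: nat
  trans :: "nat \<Rightarrow> nat list \<Rightarrow> nat \<times> (nat \<times> move) list"

definition tm_wf :: "tm \<Rightarrow> bool" where
  "tm_wf M \<longleftrightarrow>
     tapes M \<ge> 1 \<and> symbols M \<ge> 3 \<and> start M < states M \<and> halt M < states M \<and>
     (\<forall>q rs q' acts. q < states M \<and> length rs = tapes M \<and> set rs \<subseteq> {..<symbols M} \<and>
        trans M q rs = (q', acts) \<longrightarrow>
        q' < states M \<and> length acts = tapes M \<and> fst ` set acts \<subseteq> {..<symbols M})"

type_synonym tape = "(int \<Rightarrow> nat) \<times> int" \<comment> \<open>contents and head position\<close>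
type_synonym config = "nat \<times> tape list"

fun shift :: "move \<Rightarrow> int" where
  "shift Lft = -1"
| "shift Stay = 0"
| "shift Rgt = 1"

fun act :: "nat \<times> move \<Rightarrow> tape \<Rightarrow> tape" where
  "act (a, d) (t, h) = (t(h := a), h + shift d)"

fun step :: "tm \<Rightarrow> config \<Rightarrow> config" where
  "step M (q, ts) =
     (if q = halt M then (q, ts)
      else let (q', acts) = trans M q (map (\<lambda>(t, h). t h) ts) in (q', map2 act acts ts))"

definition written :: "bool list \<Rightarrow> int \<Rightarrow> nat" where
  "written x i =
     (if 0 \<le> i \<and> i < int (length x) then (if x ! nat i then 2 else 1) else 0)"

definition init :: "tm \<Rightarrow> bool list \<Rightarrow> config" where
  "init M x = (start M, (written x, 0) # replicate (tapes M - 1) (\<lambda>_. 0, 0))"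

definition outputs_within :: "tm \<Rightarrow> bool list \<Rightarrow> bool list \<Rightarrow> nat \<Rightarrow> bool" where
  "outputs_within M x y T \<longleftrightarrow>
     (\<exists>n\<le>T. \<exists>ts. (step M ^^ n) (init M x) = (halt M, ts) \<and> fst (last ts) = written y)"


section \<open>Polynomial time, NP and NP-completeness\<close>

definition polytime :: "(bool list \<Rightarrow> bool list) \<Rightarrow> bool" where
  "polytime f \<longleftrightarrow>
     (\<exists>M (p :: nat poly). tm_wf M \<and> (\<forall>x. outputs_within M x (f x) (poly p (length x))))"

definition in_P :: "bool list set \<Rightarrow> bool" where
  "in_P A \<longleftrightarrow> polytime (\<lambda>x. [x \<in> A])"

text \<open>The pair of two words: the bits of the first are doubled, then \<open>01\<close>, then the second.\<close>

definition pair :: "bool list \<Rightarrow> bool list \<Rightarrow> bool list" where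
  "pair x u = concat (map (\<lambda>b. [b, b]) x) @ [False, True] @ u"

lemma pair_inj: "pair x u = pair y w \<Longrightarrow> x = y \<and> u = w"
proof (induction x arbitrary: y)
  case Nil
  then show ?case by (cases y) (auto simp: pair_def)
next
  case (Cons b x)
  then show ?case by (cases y) (auto simp: pair_def)
qed

definition in_NP :: "bool list set \<Rightarrow> bool" where
  "in_NP A \<longleftrightarrow>
     (\<exists>V (p :: nat poly). in_P V \<and>
        (\<forall>x. x \<in> A \<longleftrightarrow> (\<exists>u. length u \<le> poly p (length x) \<and> pair x u \<in> V)))"

definition poly_reducible :: "bool list set \<Rightarrow> bool list set \<Rightarrow> bool" where
  "poly_reducible A B \<longleftrightarrow> (\<exists>f. polytime f \<and> (\<forall>x. x \<in> A \<longleftrightarrow> f x \<in> B))"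

definition NP_hard :: "bool list set \<Rightarrow> bool" where
  "NP_hard B \<longleftrightarrow> (\<forall>A. in_NP A \<longrightarrow> poly_reducible A B)"

definition NP_complete :: "bool list set \<Rightarrow> bool" where
  "NP_complete B \<longleftrightarrow> in_NP B \<and> NP_hard B"

end

theory Submission
  imports Defs "HOL-Library.Nat_Bijection"
begin

text \<open>Programs manipulate stacks and may loop only over stacks that the loop does not modify. Such
  programs run in polynomial time by construction, and a multi-tape machine executes them with one
  stack per tape and the list of pending commands as its finite control.

  For hardness, the run of a verifier on a guessed certificate is described by clauses that are
  Horn except for the guess: they only propagate positive facts, so that every satisfying assignment
  contains the facts that are true of the run, and no uniqueness conditions are needed; one last
  kind of clause forbids the output 0. A clause together with its mirror says that its literals are
  not all equal, and \<open>a \<or> b \<or> c\<close> is expressed by two such constraints with the help of a fresh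
  variable and a variable shared by all clauses.

  For membership, the certificate is the list of truth values of all occurrences of literals.\<close>

section \<open>Stack programs on multi-tape machines\<close>

text \<open>The reduction has to be computed by a machine in the sense of \<open>polytime\<close>,
  and this shapes the clauses. Cells are addressed relative to the heads, so one finite list of
  clause patterns, depending only on the verifier, serves all times and all cells; the program
  repeats it in nested loops while registers hold the current time, cell and position in unary.
  Indices of variables are not calculated: they are the words that these registers spell. The price
  of relative addresses is that the output has no fixed address. The mark at the origin of each tape
  makes up for this: the forbidden output is a single code, and it is forbidden at every address of
  the window. Only the certificate is ever read off a satisfying assignment; everything else is
  compared with the run on that certificate. Conversely, an accepting run yields the assignment that
  consists of its own facts.\<close>

datatype sym = Bit bool | Sgn bool

text \<open>The bits have the codes that \<open>written\<close> uses, so the input tape as it stands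
  is already the stack \<open>map Bit x\<close>.\<close>

fun enc :: "sym \<Rightarrow> nat" where
  "enc (Bit b) = (if b then 2 else 1)"
| "enc (Sgn b) = (if b then 4 else 3)"

text \<open>A blank under the head, read as \<open>None\<close>, is the test for an empty
  stack.\<close>

definition dec :: "nat \<Rightarrow> sym option" where
  "dec a = (if a = 1 then Some (Bit False) else if a = 2 then Some (Bit True)
     else if a = 3 then Some (Sgn False) else if a = 4 then Some (Sgn True) else None)"

lemma dec_enc [simp]: "dec (enc a) = Some a"
  by (cases a) (auto simp: dec_def)

lemma dec_0 [simp]: "dec 0 = None"
  by (simp add: dec_def)

lemma enc_less: "enc a < 5"
  by (cases a) auto

lemma finite_sym: "finite (UNIV :: sym set)"
proof -
  have "a \<in> range Bit \<union> range Sgn" for a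
    by (cases a) auto
  then have "(UNIV :: sym set) \<subseteq> range Bit \<union> range Sgn"
    by blast
  then show ?thesis
    by (rule finite_subset) simp
qed

text \<open>Every register is a stack of symbols on a tape of its own, with the head on the top symbol;
  the last tape is write-only. \<open>CPut\<close> is the second half of \<open>CPush\<close>, which first moves the head
  to the cell that is to be filled.\<close>

datatype com =
    CSkip
  | CPush "sym option \<Rightarrow> sym option \<Rightarrow> sym" nat nat nat
  | CPut sym nat
  | CPop nat
  | CEmit bool
  | CSeq com com
  | CIf "sym option \<Rightarrow> sym option \<Rightarrow> bool" nat nat com com
  | CWhile nat com

definition keep :: "nat list \<Rightarrow> (nat \<times> move) list" where
  "keep rs = map (\<lambda>a. (a, Stay)) rs"

text \<open>The control state is the list of commands still to be executed.\<close>

fun ctl :: "nat \<Rightarrow> com list \<Rightarrow> nat list \<Rightarrow> com list \<times> (nat \<times> move) list" where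
  "ctl n [] rs = ([], keep rs)"
| "ctl n (CSkip # k) rs = (k, keep rs)"
| "ctl n (CPush g r1 r2 r # k) rs =
     (CPut (g (dec (rs ! r1)) (dec (rs ! r2))) r # k, (keep rs)[r := (rs ! r, Lft)])"
| "ctl n (CPut a r # k) rs = (k, (keep rs)[r := (enc a, Stay)])"
| "ctl n (CPop r # k) rs = (k, (keep rs)[r := (0, Rgt)])"
| "ctl n (CEmit b # k) rs = (k, (keep rs)[n := (if b then 2 else 1, Rgt)])"
| "ctl n (CSeq c d # k) rs = (c # d # k, keep rs)"
| "ctl n (CIf P r1 r2 c d # k) rs =
     ((if P (dec (rs ! r1)) (dec (rs ! r2)) then c else d) # k, keep rs)"
| "ctl n (CWhile r c # k) rs =
     (if dec (rs ! r) \<noteq> None then c # CWhile r c # k else k, keep rs)"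

primrec reach :: "com \<Rightarrow> com list \<Rightarrow> com list set" where
  "reach CSkip k = {CSkip # k}"
| "reach (CPush g r1 r2 r) k = insert (CPush g r1 r2 r # k) (range (\<lambda>a. CPut a r # k))"
| "reach (CPut a r) k = {CPut a r # k}"
| "reach (CPop r) k = {CPop r # k}"
| "reach (CEmit b) k = {CEmit b # k}"
| "reach (CSeq c d) k = insert (CSeq c d # k) (reach c (d # k) \<union> reach d k)"
| "reach (CIf P r1 r2 c d) k = insert (CIf P r1 r2 c d # k) (reach c k \<union> reach d k)"
| "reach (CWhile r c) k = insert (CWhile r c # k) (reach c (CWhile r c # k))"

lemma reach_self: "c # k \<in> reach c k"
  by (cases c) auto

lemma finite_reach: "finite (reach c k)"
  using finite_sym by (induction c arbitrary: k) auto

lemma reach_closed: "l \<in> reach c k \<Longrightarrow> fst (ctl n l rs) \<in> insert k (reach c k)"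
proof (induction c arbitrary: k l)
  case (CSeq c d)
  consider "l = CSeq c d # k" | "l \<in> reach c (d # k)" | "l \<in> reach d k"
    using CSeq.prems by auto
  then show ?case
    using CSeq.IH(1)[of l "d # k"] CSeq.IH(2)[of l k]
    by cases (auto simp: reach_self)
next
  case (CIf P r1 r2 c d)
  consider "l = CIf P r1 r2 c d # k" | "l \<in> reach c k" | "l \<in> reach d k"
    using CIf.prems by auto
  then show ?case
    using CIf.IH(1)[of l k] CIf.IH(2)[of l k]
    by cases (auto simp: reach_self)
next
  case (CWhile r c)
  consider "l = CWhile r c # k" | "l \<in> reach c (CWhile r c # k)"
    using CWhile.prems by auto
  then show ?case
    using CWhile.IH[of l "CWhile r c # k"]
    by cases (auto simp: reach_self)
qed auto

definition cstep :: "nat \<Rightarrow> com list \<times> tape list \<Rightarrow> com list \<times> tape list" where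
  "cstep n = (\<lambda>(l, ts). let (l', acts) = ctl n l (map (\<lambda>(t, h). t h) ts) in (l', map2 act acts ts))"

lemma length_ctl: "length (snd (ctl n l rs)) = length rs"
  by (induction n l rs rule: ctl.induct) (auto simp: keep_def)

lemma ctl_symbols:
  assumes "set rs \<subseteq> {..<5}"
  shows "fst ` set (snd (ctl n l rs)) \<subseteq> {..<5}"
proof -
  have keep: "fst ` set (keep rs) \<subseteq> {..<5}"
    using assms by (auto simp: keep_def)
  have upd: "fst ` set ((keep rs)[i := (a, d)]) \<subseteq> {..<5}" if "i < length rs \<longrightarrow> a < 5" for i a d
  proof (cases "i < length rs")
    case True
    then show ?thesis
      using keep that set_update_subset_insert[of "keep rs" i "(a, d)"] by fastforce
  qed (use keep in \<open>simp add: keep_def list_update_beyond\<close>)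
  have rs: "i < length rs \<longrightarrow> rs ! i < 5" for i
    using assms by (auto dest: nth_mem)
  show ?thesis
    using keep rs by (cases "(n, l, rs)" rule: ctl.cases) (auto intro!: upd simp: enc_less)
qed

lemma keep_act: "map2 act (keep (map (\<lambda>(t, h). t h) ts)) ts = ts"
  by (rule nth_equalityI) (auto simp: keep_def split: prod.splits)

text \<open>Only finitely many command lists can occur, so numbering them turns \<open>cstep\<close>
  into a machine. The empty list becomes the halting state; \<open>ctl\<close> changes nothing
  there, in agreement with \<open>step\<close>.\<close>

lemma machine_exists:
  fixes c :: com
  obtains M f where "tm_wf M" "tapes M = Suc n" "start M = f [c]" "halt M = f []"
    "\<And>t ts l' ts'. length ts = Suc n \<Longrightarrow> (cstep n ^^ t) ([c], ts) = (l', ts') \<Longrightarrow>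
       (step M ^^ t) (f [c], ts) = (f l', ts')"
proof -
  define Q where "Q = insert [] (reach c [])"
  have "finite Q"
    by (simp add: Q_def finite_reach)
  then obtain f where f: "bij_betw f Q {..<card Q}"
    using ex_bij_betw_finite_nat[of Q] by (auto simp: atLeast0LessThan)
  have inj: "inj_on f Q" and fQ: "l \<in> Q \<Longrightarrow> f l < card Q" for l
    using f by (auto simp: bij_betw_def)
  have inv: "the_inv_into Q f q \<in> Q" if "q < card Q" for q
    using f that by (auto simp: bij_betw_def intro!: the_inv_into_into)
  have closed: "fst (ctl n l rs) \<in> Q" if "l \<in> Q" for l rs
    using that reach_closed[of l c "[]" n rs] by (auto simp: Q_def)
  define M where "M = \<lparr>tapes = Suc n, states = card Q, symbols = 5, start = f [c], halt = f [],
    trans = \<lambda>q rs. let (l', acts) = ctl n (the_inv_into Q f q) rs in (f l', acts)\<rparr>"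
  have c: "[c] \<in> Q" and e: "[] \<in> Q"
    by (auto simp: Q_def reach_self)
  have "tm_wf M"
    unfolding tm_wf_def
  proof (intro conjI allI impI)
    fix q rs q' acts
    assume *: "q < states M \<and> length rs = tapes M \<and> set rs \<subseteq> {..<symbols M} \<and>
      trans M q rs = (q', acts)"
    obtain l' where l': "ctl n (the_inv_into Q f q) rs = (l', acts)" "q' = f l'"
      using * by (auto simp: M_def split: prod.splits)
    have "l' \<in> Q"
      using closed[OF inv, of q rs] * l' by (simp add: M_def)
    then show "q' < states M"
      using fQ l' by (simp add: M_def)
    show "length acts = tapes M"
      using length_ctl[of n "the_inv_into Q f q" rs] * l' by (simp add: M_def)
    show "fst ` set acts \<subseteq> {..<symbols M}"
      using ctl_symbols[of rs n "the_inv_into Q f q"] * l' by (simp add: M_def)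
  qed (use c e fQ in \<open>auto simp: M_def\<close>)
  moreover have "(step M ^^ t) (f [c], ts) = (f l', ts')" 
    if "(cstep n ^^ t) ([c], ts) = (l', ts')" for t ts l' ts'
  proof -
    have "(step M ^^ t) (f [c], ts) = (f l', ts') \<and> l' \<in> Q"
      using that
    proof (induction t arbitrary: l' ts')
      case 0
      then show ?case using c by auto
    next
      case (Suc t)
      obtain l1 ts1 where 1: "(cstep n ^^ t) ([c], ts) = (l1, ts1)"
        by fastforce
      have IH: "(step M ^^ t) (f [c], ts) = (f l1, ts1)" "l1 \<in> Q"
        using Suc.IH[OF 1] by auto
      have step: "cstep n (l1, ts1) = (l', ts')"
        using Suc.prems 1 by simp
      have "l' \<in> Q"
        using step closed[OF IH(2), of "map (\<lambda>(t, h). t h) ts1"]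
        by (auto simp: cstep_def split: prod.splits)
      moreover have "step M (f l1, ts1) = (f l', ts')"
      proof (cases "l1 = []")
        case True
        then show ?thesis
          using step by (simp add: cstep_def keep_act M_def)
      next
        case False
        then have "f l1 \<noteq> f []"
          using inj IH(2) e by (auto dest: inj_onD)
        then show ?thesis
          using step by (simp add: M_def cstep_def the_inv_into_f_f[OF inj IH(2)] split: prod.splits)
      qed
      ultimately show ?case using IH(1) by simp
    qed
    then show ?thesis by simp
  qed
  ultimately show ?thesis
    using that[of M f] by (auto simp: M_def)
qed

section \<open>Stacks on tapes and the exact behaviour of single commands\<close>

type_synonym store = "nat \<Rightarrow> sym list"

definition stack :: "tape \<Rightarrow> sym list \<Rightarrow> bool" where
  "stack T xs \<longleftrightarrow> (\<forall>i. fst T i =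
     (if snd T \<le> i \<and> i < snd T + int (length xs) then enc (xs ! nat (i - snd T)) else 0))"

fun top_of :: "sym list \<Rightarrow> sym option" where
  "top_of [] = None"
| "top_of (x # xs) = Some x"

definition rel :: "nat \<Rightarrow> store \<Rightarrow> bool list \<Rightarrow> tape list \<Rightarrow> bool" where
  "rel n s out ts \<longleftrightarrow> length ts = Suc n \<and> (\<forall>r<n. stack (ts ! r) (s r)) \<and>
     ts ! n = (written out, int (length out))"

text \<open>Quantifying over all continuations \<open>k\<close> is what makes these facts
  composable; \<open>t\<close> is the exact number of steps.\<close>

definition runs :: "nat \<Rightarrow> com \<Rightarrow> store \<Rightarrow> bool list \<Rightarrow> store \<Rightarrow> bool list \<Rightarrow> nat \<Rightarrow> bool" where
  "runs n c s out s' out' t \<longleftrightarrow>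
     (\<forall>k ts. rel n s out ts \<longrightarrow>
        (\<exists>ts'. (cstep n ^^ t) (c # k, ts) = (k, ts') \<and> rel n s' out' ts'))"

lemma stack_top: "stack T xs \<Longrightarrow> dec (fst T (snd T)) = top_of xs"
  by (cases xs) (auto simp: stack_def)

lemma rel_reads:
  assumes "rel n s out ts" "r < n"
  shows "dec (map (\<lambda>(t, h). t h) ts ! r) = top_of (s r)"
  using assms stack_top[of "ts ! r" "s r"] by (auto simp: rel_def split: prod.splits)

lemma stack_push:
  "stack T xs \<Longrightarrow> stack (act (enc a, Stay) (act (fst T (snd T), Lft) T)) (a # xs)"
proof -
  have "nat (i - (b - 1)) - Suc 0 = nat (i - b)" for i b :: int
    by linarith
  then show "stack T xs \<Longrightarrow> stack (act (enc a, Stay) (act (fst T (snd T), Lft) T)) (a # xs)"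
    by (cases T) (auto simp: stack_def nth_Cons')
qed

lemma stack_pop: "stack T xs \<Longrightarrow> stack (act (0, Rgt) T) (tl xs)"
proof -
  have "nat (i - b) - Suc 0 = nat (i - (b + 1))" for i b :: int
    by linarith
  then show "stack T xs \<Longrightarrow> stack (act (0, Rgt) T) (tl xs)"
    by (cases T; cases xs) (auto simp: stack_def nth_Cons')
qed

lemma map2_act_update:
  assumes "length ts = Suc n" "r \<le> n"
  shows "map2 act ((keep (map (\<lambda>(t, h). t h) ts))[r := x]) ts = ts[r := act x (ts ! r)]"
  using assms by (intro nth_equalityI) (auto simp: keep_def nth_list_update split: prod.splits)

lemma runs_skip: "runs n CSkip s out s out 1"
  by (auto simp: runs_def cstep_def keep_act)

lemma runs_push:
  assumes "r1 < n" "r2 < n" "r < n"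
  shows "runs n (CPush g r1 r2 r) s out (s(r := g (top_of (s r1)) (top_of (s r2)) # s r)) out 2"
  unfolding runs_def
proof (intro allI impI)
  fix k ts
  assume rel: "rel n s out ts"
  let ?a = "g (top_of (s r1)) (top_of (s r2))"
  let ?T = "ts ! r"
  let ?ts1 = "ts[r := act (fst ?T (snd ?T), Lft) ?T]"
  let ?ts2 = "ts[r := act (enc ?a, Stay) (act (fst ?T (snd ?T), Lft) ?T)]"
  have len: "length ts = Suc n"
    using rel by (simp add: rel_def)
  have read: "map (\<lambda>(t, h). t h) ts ! r = fst ?T (snd ?T)"
    using assms len by (simp add: split_def)
  have 1: "cstep n (CPush g r1 r2 r # k, ts) = (CPut ?a r # k, ?ts1)"
    using rel_reads[OF rel] assms len
    by (simp add: cstep_def map2_act_update read)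
  have 2: "cstep n (CPut ?a r # k, ?ts1) = (k, ?ts2)"
    using assms len by (simp add: cstep_def map2_act_update)
  have "rel n (s(r := ?a # s r)) out ?ts2"
    using rel assms by (auto simp: rel_def nth_list_update stack_push simp del: act.simps)
  then show "\<exists>ts'. (cstep n ^^ 2) (CPush g r1 r2 r # k, ts) = (k, ts') \<and>
      rel n (s(r := ?a # s r)) out ts'"
    using 1 2 by (auto simp: numeral_2_eq_2)
qed

lemma runs_pop:
  assumes "r < n"
  shows "runs n (CPop r) s out (s(r := tl (s r))) out 1"
  unfolding runs_def
proof (intro allI impI)
  fix k ts
  assume rel: "rel n s out ts"
  have "rel n (s(r := tl (s r))) out (ts[r := act (0, Rgt) (ts ! r)])"
    using rel assms by (auto simp: rel_def nth_list_update stack_pop simp del: act.simps)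
  then show "\<exists>ts'. (cstep n ^^ 1) (CPop r # k, ts) = (k, ts') \<and> rel n (s(r := tl (s r))) out ts'"
    using rel assms by (auto simp: cstep_def map2_act_update rel_def)
qed

lemma written_snoc: "(written out)(int (length out) := if b then 2 else 1) = written (out @ [b])"
  by (auto simp: written_def fun_eq_iff nth_append)

lemma runs_emit: "runs n (CEmit b) s out s (out @ [b]) 1"
  unfolding runs_def
proof (intro allI impI)
  fix k ts
  assume rel: "rel n s out ts"
  let ?T = "act (if b then 2 else 1, Rgt) (ts ! n)"
  have "?T = (written (out @ [b]), int (length (out @ [b])))"
    using rel by (simp add: rel_def written_snoc[symmetric])
  then have "rel n s (out @ [b]) (ts[n := ?T])"
    using rel by (auto simp: rel_def nth_list_update simp del: act.simps)
  then show "\<exists>ts'. (cstep n ^^ 1) (CEmit b # k, ts) = (k, ts') \<and> rel n s (out @ [b]) ts'"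
    using rel by (auto simp: cstep_def map2_act_update rel_def)
qed

lemma runs_first_step:
  assumes "\<And>k ts. rel n s out ts \<Longrightarrow> cstep n (c # k, ts) = (d # k, ts)"
    and "runs n d s out s' out' t"
  shows "runs n c s out s' out' (Suc t)"
  using assms unfolding runs_def by (simp add: funpow_Suc_right del: funpow.simps)

lemma runs_seq:
  assumes "runs n c s out s1 out1 t1" "runs n d s1 out1 s2 out2 t2"
  shows "runs n (CSeq c d) s out s2 out2 (Suc (t1 + t2))"
  unfolding runs_def
proof (intro allI impI)
  fix k ts
  assume rel: "rel n s out ts"
  obtain ts1 where 1: "(cstep n ^^ t1) (c # d # k, ts) = (d # k, ts1)" "rel n s1 out1 ts1"
    using assms(1) rel unfolding runs_def by blast
  obtain ts2 where 2: "(cstep n ^^ t2) (d # k, ts1) = (k, ts2)" "rel n s2 out2 ts2"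
    using assms(2) 1 unfolding runs_def by blast
  have "cstep n (CSeq c d # k, ts) = (c # d # k, ts)"
    by (simp add: cstep_def keep_act)
  then have "(cstep n ^^ Suc (t2 + t1)) (CSeq c d # k, ts) = (k, ts2)"
    using 1 2 by (simp add: funpow_Suc_right funpow_add del: funpow.simps)
  then show "\<exists>ts'. (cstep n ^^ Suc (t1 + t2)) (CSeq c d # k, ts) = (k, ts') \<and> rel n s2 out2 ts'"
    using 2 by (auto simp: add.commute)
qed

lemma runs_if:
  assumes "r1 < n" "r2 < n"
    and "runs n (if P (top_of (s r1)) (top_of (s r2)) then c else d) s out s' out' t"
  shows "runs n (CIf P r1 r2 c d) s out s' out' (Suc t)"
  using assms(3)
  by (rule runs_first_step[rotated]) (auto simp: cstep_def keep_act rel_reads assms(1,2))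

lemma runs_while_end:
  assumes "r < n" "s r = []"
  shows "runs n (CWhile r c) s out s out 1"
  using assms by (auto simp: runs_def cstep_def keep_act rel_reads)

text \<open>On a nonempty register the loop makes the same first step as
  \<open>CSeq c (CWhile r c)\<close>, so the rule for sequences applies.\<close>

lemma runs_while_step:
  assumes "r < n" "s r \<noteq> []"
    and "runs n c s out s1 out1 t1" "runs n (CWhile r c) s1 out1 s2 out2 t2"
  shows "runs n (CWhile r c) s out s2 out2 (Suc (t1 + t2))"
proof -
  have "runs n (CSeq c (CWhile r c)) s out s2 out2 (Suc (t1 + t2))"
    using assms by (intro runs_seq)
  moreover have "cstep n (CWhile r c # k, ts) = cstep n (CSeq c (CWhile r c) # k, ts)"
    if "rel n s out ts" for k ts
    using assms(1,2) that by (cases "s r") (auto simp: cstep_def keep_act rel_reads)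
  ultimately show ?thesis
    unfolding runs_def by (simp add: funpow_Suc_right del: funpow.simps)
qed

definition input_store :: "bool list \<Rightarrow> store" where
  "input_store x = (\<lambda>r. if r = 0 then map Bit x else [])"

text \<open>The initial configuration represents \<open>input_store x\<close>: the input is the
  stack in register 0, the other registers are empty, and the output tape, number \<open>n\<close>,
  is the last one. With the empty continuation, finishing the command is halting.\<close>

lemma polytime_of_runs:
  assumes "n > 0"
    and "\<And>x. \<exists>t \<le> poly p (length x). \<exists>s'. runs n c (input_store x) [] s' (f x) t"
  shows "polytime f"
proof -
  obtain M h where M: "tm_wf M" "tapes M = Suc n" "start M = h [c]" "halt M = h []"
    and sim: "\<And>t ts l' ts'. length ts = Suc n \<Longrightarrow> (cstep n ^^ t) ([c], ts) = (l', ts') \<Longrightarrow>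
       (step M ^^ t) (h [c], ts) = (h l', ts')"
    using machine_exists[of n c] by metis
  have "outputs_within M x (f x) (poly p (length x))" for x
  proof -
    obtain t s' where t: "t \<le> poly p (length x)" "runs n c (input_store x) [] s' (f x) t"
      using assms(2) by blast
    define ts where "ts = (written x, 0 :: int) # replicate n ((\<lambda>_. 0) :: int \<Rightarrow> nat, 0 :: int)"
    have "written [] = (\<lambda>_. 0)"
      by (auto simp: written_def)
    then have rel: "rel n (input_store x) [] ts"
      using \<open>n > 0\<close>
      by (auto simp: rel_def ts_def stack_def input_store_def written_def nth_Cons')
    then obtain ts' where ts': "(cstep n ^^ t) ([c], ts) = ([], ts')" "rel n s' (f x) ts'"
      using t(2) unfolding runs_def by blast
    have "(step M ^^ t) (init M x) = (halt M, ts')"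
      using sim[of ts t] ts' rel by (simp add: init_def M ts_def rel_def)
    moreover have "fst (last ts') = written (f x)"
      using ts'(2) by (cases "ts' = []") (auto simp: rel_def last_conv_nth)
    ultimately show ?thesis
      using t(1) unfolding outputs_within_def by blast
  qed
  then show ?thesis
    using M unfolding polytime_def by blast
qed

section \<open>A bounded-loop language\<close>

type_synonym state = "store \<times> bool list"

datatype cmd =
    Nop
  | Push "sym option \<Rightarrow> sym option \<Rightarrow> sym" nat nat nat
  | Pop nat
  | Clear nat
  | Copy nat nat
  | Emit "bool list"
  | EmitAll "bool list" nat
  | Seq cmd cmd  (infixr ";;" 60)
  | If "sym option \<Rightarrow> sym option \<Rightarrow> bool" nat nat cmd cmd
  | IfEq nat nat cmd cmd
  | For nat nat cmd

text \<open>Register \<open>i\<close> is set anew from the list in every round, so the number of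
  rounds is fixed beforehand. For safe bodies, which leave \<open>i\<close> alone, this agrees with
  the compiled loop, which pops \<open>i\<close>.\<close>

primrec for_loop :: "(state \<Rightarrow> state) \<Rightarrow> nat \<Rightarrow> sym list \<Rightarrow> state \<Rightarrow> state" where
  "for_loop f i [] st = ((fst st)(i := []), snd st)"
| "for_loop f i (x # z) st = for_loop f i z (f ((fst st)(i := x # z), snd st))"

text \<open>The loop variable of \<open>For i r c\<close> runs through the nonempty suffixes of \<open>r\<close>, longest first.\<close>

primrec sem :: "cmd \<Rightarrow> state \<Rightarrow> state" where
  "sem Nop st = st"
| "sem (Push g r1 r2 r) st =
     ((fst st)(r := g (top_of (fst st r1)) (top_of (fst st r2)) # fst st r), snd st)"
| "sem (Pop r) st = ((fst st)(r := tl (fst st r)), snd st)"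
| "sem (Clear r) st = ((fst st)(r := []), snd st)"
| "sem (Copy r r') st = ((fst st)(r := fst st r'), snd st)"
| "sem (Emit bs) st = (fst st, snd st @ bs)"
| "sem (EmitAll bs r) st = (fst st, snd st @ concat (replicate (length (fst st r)) bs))"
| "sem (c ;; d) st = sem d (sem c st)"
| "sem (If P r1 r2 c d) st =
     (if P (top_of (fst st r1)) (top_of (fst st r2)) then sem c st else sem d st)"
| "sem (IfEq r1 r2 c d) st = (if fst st r1 = fst st r2 then sem c st else sem d st)"
| "sem (For i r c) st = for_loop (sem c) i (fst st r) st"

primrec mods :: "cmd \<Rightarrow> nat set" where
  "mods Nop = {}"
| "mods (Push g r1 r2 r) = {r}"
| "mods (Pop r) = {r}"
| "mods (Clear r) = {r}"
| "mods (Copy r r') = {r}"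
| "mods (Emit bs) = {}"
| "mods (EmitAll bs r) = {}"
| "mods (c ;; d) = mods c \<union> mods d"
| "mods (If P r1 r2 c d) = mods c \<union> mods d"
| "mods (IfEq r1 r2 c d) = mods c \<union> mods d"
| "mods (For i r c) = insert i (mods c)"

text \<open>Loops are bounded by registers of \<open>B\<close>, which the program does not modify; this is what
  makes the running time polynomial.\<close>

primrec safe :: "nat \<Rightarrow> nat set \<Rightarrow> cmd \<Rightarrow> bool" where
  "safe n B Nop = True"
| "safe n B (Push g r1 r2 r) = (r1 < n \<and> r2 < n \<and> r < n \<and> r \<notin> B)"
| "safe n B (Pop r) = (r < n \<and> r \<notin> B)"
| "safe n B (Clear r) = (r < n \<and> r \<notin> B)"
| "safe n B (Copy r r') = (r < n \<and> r' < n \<and> r \<noteq> r' \<and> r \<notin> B)"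
| "safe n B (Emit bs) = True"
| "safe n B (EmitAll bs r) = (r < n)"
| "safe n B (c ;; d) = (safe n B c \<and> safe n B d)"
| "safe n B (If P r1 r2 c d) = (r1 < n \<and> r2 < n \<and> safe n B c \<and> safe n B d)"
| "safe n B (IfEq r1 r2 c d) = (r1 < n \<and> r2 < n \<and> safe n B c \<and> safe n B d)"
| "safe n B (For i r c) = (r \<in> B \<and> r < n \<and> i < n \<and> i \<notin> B \<and> safe n (insert i B) c)"

definition clear_com :: "nat \<Rightarrow> com" where
  "clear_com r = CWhile r (CPop r)"

text \<open>Reading a stack consumes it. The source is therefore moved to \<open>tmp\<close>, in
  reverse, and from there onto both registers at once, which restores the order.\<close>

definition copy_com :: "nat \<Rightarrow> nat \<Rightarrow> nat \<Rightarrow> com" where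
  "copy_com tmp r r' =
     CSeq (clear_com r)
       (CSeq (CWhile r' (CSeq (CPush (\<lambda>a _. the a) r' r' tmp) (CPop r')))
         (CWhile tmp (CSeq (CPush (\<lambda>a _. the a) tmp tmp r')
           (CSeq (CPush (\<lambda>a _. the a) tmp tmp r) (CPop tmp)))))"

definition emit_com :: "bool list \<Rightarrow> com" where
  "emit_com bs = foldr (\<lambda>b. CSeq (CEmit b)) bs CSkip"

text \<open>Leaves \<open>r1\<close> empty, and \<open>r2\<close> empty exactly if the two stacks were equal.\<close>

definition compare_com :: "nat \<Rightarrow> nat \<Rightarrow> com" where
  "compare_com r1 r2 = CWhile r1 (CIf (=) r1 r2 (CSeq (CPop r1) (CPop r2))
     (CSeq (clear_com r1) (CSeq (clear_com r2) (CPush (\<lambda>_ _. Bit False) r1 r1 r2))))"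

text \<open>Registers \<open>n\<close>, \<open>n + 1\<close> and \<open>n + 2\<close> lie above
  those of the program and are scratch space: the first for copying, the others for operands of
  comparisons and the counter of \<open>EmitAll\<close>.\<close>

primrec compile :: "nat \<Rightarrow> cmd \<Rightarrow> com" where
  "compile n Nop = CSkip"
| "compile n (Push g r1 r2 r) = CPush g r1 r2 r"
| "compile n (Pop r) = CPop r"
| "compile n (Clear r) = clear_com r"
| "compile n (Copy r r') = copy_com n r r'"
| "compile n (Emit bs) = emit_com bs"
| "compile n (EmitAll bs r) =
     CSeq (copy_com n (n + 1) r) (CWhile (n + 1) (CSeq (emit_com bs) (CPop (n + 1))))"
| "compile n (c ;; d) = CSeq (compile n c) (compile n d)"
| "compile n (If P r1 r2 c d) = CIf P r1 r2 (compile n c) (compile n d)"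
| "compile n (IfEq r1 r2 c d) =
     CSeq (copy_com n (n + 1) r1) (CSeq (copy_com n (n + 2) r2) (CSeq (compare_com (n + 1) (n + 2))
       (CIf (\<lambda>a _. a = None) (n + 2) (n + 2) (compile n c)
         (CSeq (clear_com (n + 2)) (compile n d)))))"
| "compile n (For i r c) =
     CSeq (copy_com n i r) (CWhile i (CSeq (compile n c) (CPop i)))"

section \<open>Time bounds for compiled commands\<close>

definition runs_in where
  "runs_in n c s out s' out' T \<longleftrightarrow> (\<exists>t\<le>T. runs n c s out s' out' t)"

lemma runs_in_mono: "runs_in n c s out s' out' T \<Longrightarrow> T \<le> T' \<Longrightarrow> runs_in n c s out s' out' T'"
  unfolding runs_in_def using le_trans by blast

lemma runs_in_seq:
  assumes "runs_in n c s out s1 out1 T1" "runs_in n d s1 out1 s2 out2 T2"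
  shows "runs_in n (CSeq c d) s out s2 out2 (Suc (T1 + T2))"
  using assms runs_seq unfolding runs_in_def by (meson add_le_mono Suc_le_mono)

lemma runs_in_if:
  assumes "r1 < n" "r2 < n"
    and "runs_in n (if P (top_of (s r1)) (top_of (s r2)) then c else d) s out s' out' T"
  shows "runs_in n (CIf P r1 r2 c d) s out s' out' (Suc T)"
  using assms runs_if unfolding runs_in_def by (meson Suc_le_mono)

lemma runs_in_while_step:
  assumes "r < n" "s r \<noteq> []"
    and "runs_in n c s out s1 out1 T1" "runs_in n (CWhile r c) s1 out1 s2 out2 T2"
  shows "runs_in n (CWhile r c) s out s2 out2 (Suc (T1 + T2))"
  using assms runs_while_step unfolding runs_in_def by (meson add_le_mono Suc_le_mono)

lemma runs_in_push:
  assumes "r1 < n" "r2 < n" "r < n" "s' = s(r := g (top_of (s r1)) (top_of (s r2)) # s r)"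
  shows "runs_in n (CPush g r1 r2 r) s out s' out 2"
  using runs_push[OF assms(1-3)] assms(4) unfolding runs_in_def by blast

lemma runs_in_pop:
  assumes "r < n" "s' = s(r := tl (s r))"
  shows "runs_in n (CPop r) s out s' out 1"
  using runs_pop[OF assms(1)] assms(2) unfolding runs_in_def by blast

lemma runs_in_while_end:
  assumes "r < n" "s r = []"
  shows "runs_in n (CWhile r c) s out s out 1"
  using runs_while_end[of r n s c out] assms unfolding runs_in_def by blast

lemma runs_in_clear:
  "r < n \<Longrightarrow> runs_in n (clear_com r) s out (s(r := [])) out (2 * length (s r) + 1)"
proof (induction "length (s r)" arbitrary: s)
  case 0
  then have "s(r := []) = s" by auto
  then show ?case
    using runs_in_while_end[of r n s "CPop r"] 0 by (simp add: clear_com_def)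
next
  case (Suc m)
  let ?s = "s(r := tl (s r))"
  have "runs_in n (clear_com r) ?s out (?s(r := [])) out (2 * length (?s r) + 1)"
    using Suc.hyps(1)[of ?s] Suc.hyps(2) Suc.prems by simp
  note ih = this[unfolded clear_com_def]
  have "runs_in n (clear_com r) s out (?s(r := [])) out
      (Suc (1 + (2 * length (?s r) + 1)))"
    unfolding clear_com_def
    by (rule runs_in_while_step[OF _ _ runs_in_pop[OF _ refl] ih]) (use Suc in auto)
  then show ?case
    using Suc by (auto elim!: runs_in_mono)
qed

text \<open>Each symbol costs 5 steps on the way to \<open>tmp\<close> and 8 on the way back, hence
  the 13.\<close>

lemma runs_in_copy:
  assumes "tmp < n" "r < n" "r' < n" "tmp \<noteq> r" "tmp \<noteq> r'" "r \<noteq> r'" "s tmp = []"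
  shows "runs_in n (copy_com tmp r r') s out (s(r := s r')) out
    (2 * length (s r) + 13 * length (s r') + 5)"
proof -
  have there: "runs_in n (CWhile r' (CSeq (CPush (\<lambda>a _. the a) r' r' tmp) (CPop r'))) s out
      (s(r' := [], tmp := rev (s r') @ s tmp)) out (5 * length (s r') + 1)" for s
  proof (induction "s r'" arbitrary: s)
    case Nil
    then have eq: "s(r' := [], tmp := rev (s r') @ s tmp) = s" by auto
    show ?case
      unfolding eq using runs_in_while_end[of r' n s] Nil assms by simp
  next
    case (Cons a xs)
    let ?s = "s(tmp := a # s tmp, r' := xs)"
    have s: "s r' = a # xs" using Cons by simp
    have "runs_in n (CSeq (CPush (\<lambda>a _. the a) r' r' tmp) (CPop r')) s out ?s out (Suc (2 + 1))"
      by (rule runs_in_seq[OF runs_in_push[OF _ _ _ refl] runs_in_pop]) (use assms s in auto)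
    from runs_in_while_step[OF _ _ this Cons(1)[of ?s]]
    show ?case
      using assms s by (auto simp: fun_upd_twist elim!: runs_in_mono)
  qed
  have unload: "runs_in n (CWhile tmp (CSeq (CPush (\<lambda>a _. the a) tmp tmp r')
        (CSeq (CPush (\<lambda>a _. the a) tmp tmp r) (CPop tmp)))) s out
      (s(tmp := [], r' := rev (s tmp) @ s r', r := rev (s tmp) @ s r)) out
      (8 * length (s tmp) + 1)" for s
  proof (induction "s tmp" arbitrary: s)
    case Nil
    then have eq: "s(tmp := [], r' := rev (s tmp) @ s r', r := rev (s tmp) @ s r) = s" by auto
    show ?case
      unfolding eq using runs_in_while_end[of tmp n s] Nil assms by simp
  next
    case (Cons a xs)
    let ?s = "s(r' := a # s r', r := a # s r, tmp := xs)"
    have s: "s tmp = a # xs" using Cons by simp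
    have "runs_in n (CSeq (CPush (\<lambda>a _. the a) tmp tmp r')
        (CSeq (CPush (\<lambda>a _. the a) tmp tmp r) (CPop tmp))) s out ?s out (Suc (2 + Suc (2 + 1)))"
      by (rule runs_in_seq[OF runs_in_push[OF _ _ _ refl] runs_in_seq[OF runs_in_push[OF _ _ _ refl] runs_in_pop]]) (use assms s in auto)
    from runs_in_while_step[OF _ _ this Cons(1)[of ?s]]
    have "runs_in n (CWhile tmp (CSeq (CPush (\<lambda>a _. the a) tmp tmp r')
        (CSeq (CPush (\<lambda>a _. the a) tmp tmp r) (CPop tmp)))) s out
      (?s(tmp := [], r' := rev (?s tmp) @ ?s r', r := rev (?s tmp) @ ?s r)) out
      (8 * length (s tmp) + 1)"
      using assms s by (auto elim!: runs_in_mono)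
    also have "?s(tmp := [], r' := rev (?s tmp) @ ?s r', r := rev (?s tmp) @ ?s r) =
        s(tmp := [], r' := rev (s tmp) @ s r', r := rev (s tmp) @ s r)"
      using assms s by (auto simp: fun_eq_iff)
    finally show ?case .
  qed
  let ?s1 = "s(r := [])"
  let ?s2 = "?s1(r' := [], tmp := rev (?s1 r') @ ?s1 tmp)"
  let ?s3 = "?s2(tmp := [], r' := rev (?s2 tmp) @ ?s2 r', r := rev (?s2 tmp) @ ?s2 r)"
  have "runs_in n (copy_com tmp r r') s out ?s3 out (Suc ((2 * length (s r) + 1) +
      Suc ((5 * length (?s1 r') + 1) + (8 * length (?s2 tmp) + 1))))"
    unfolding copy_com_def
    by (rule runs_in_seq[OF runs_in_clear runs_in_seq[OF there unload]]) (use assms in auto)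
  moreover have "?s3 = s(r := s r')"
    using assms by (auto simp: fun_eq_iff)
  ultimately show ?thesis
    using assms by (auto elim!: runs_in_mono)
qed

lemma runs_in_emit: "runs_in n (emit_com bs) s out s (out @ bs) (2 * length bs + 1)"
proof (induction bs arbitrary: out)
  case Nil
  then show ?case
    using runs_skip[of n s out] by (auto simp: runs_in_def emit_com_def)
next
  case (Cons b bs)
  have "runs_in n (CEmit b) s out s (out @ [b]) 1"
    using runs_emit[of n b s out] by (auto simp: runs_in_def)
  from runs_in_seq[OF this Cons] show ?case
    by (simp add: emit_com_def)
qed

text \<open>If \<open>r1\<close> runs out first, the rest of \<open>r2\<close> is itself the answer;
  at a mismatch one symbol is pushed, because \<open>r2\<close> may have been the shorter one. The
  bound on \<open>w\<close> pays for clearing it afterwards.\<close>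

lemma runs_in_compare:
  assumes "r1 < n" "r2 < n" "r1 \<noteq> r2"
  obtains w where "w = [] \<longleftrightarrow> s r1 = s r2"
    "length w \<le> Suc (length (s r2))"
    "runs_in n (compare_com r1 r2) s out (s(r1 := [], r2 := w)) out
      (7 * length (s r1) + 2 * length (s r2) + 12)"
proof -
  have "\<exists>w. (w = [] \<longleftrightarrow> s r1 = s r2) \<and> length w \<le> Suc (length (s r2)) \<and>
    runs_in n (compare_com r1 r2) s out (s(r1 := [], r2 := w)) out
      (7 * length (s r1) + 2 * length (s r2) + 12)"
  proof (induction "s r1" arbitrary: s)
    case Nil
    have "runs_in n (compare_com r1 r2) s out s out (7 * length (s r1) + 2 * length (s r2) + 12)"
      unfolding compare_com_def
      using Nil assms by (intro runs_in_mono[OF runs_in_while_end]) auto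
    moreover have "s(r1 := [], r2 := s r2) = s"
      using Nil by auto
    ultimately show ?case
      using Nil by (intro exI[of _ "s r2"]) (auto simp del: fun_upd_apply)
  next
    case (Cons x xs)
    have s: "s r1 = x # xs" using Cons by simp
    show ?case
    proof (cases "top_of (s r2) = Some x")
      case True
      then obtain ys where ys: "s r2 = x # ys"
        by (cases "s r2") auto
      let ?s = "s(r1 := xs, r2 := ys)"
      obtain w where w: "w = [] \<longleftrightarrow> ?s r1 = ?s r2" "length w \<le> Suc (length (?s r2))"
        "runs_in n (compare_com r1 r2) ?s out (?s(r1 := [], r2 := w)) out
          (7 * length (?s r1) + 2 * length (?s r2) + 12)"
        using Cons(1)[of ?s] assms by auto
      have "runs_in n (CSeq (CPop r1) (CPop r2)) s out ?s out (Suc (1 + 1))"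
        by (rule runs_in_seq[OF runs_in_pop[OF _ refl] runs_in_pop]) (use assms s ys in auto)
      then have "runs_in n (CIf (=) r1 r2 (CSeq (CPop r1) (CPop r2))
         (CSeq (clear_com r1) (CSeq (clear_com r2) (CPush (\<lambda>_ _. Bit False) r1 r1 r2))))
         s out ?s out (Suc (Suc (1 + 1)))"
        by (intro runs_in_if) (use assms s ys in auto)
      from runs_in_while_step[OF _ _ this w(3)[unfolded compare_com_def]]
      have "runs_in n (compare_com r1 r2) s out (?s(r1 := [], r2 := w)) out
          (7 * length (s r1) + 2 * length (s r2) + 12)"
        using assms s ys unfolding compare_com_def by (auto elim!: runs_in_mono)
      moreover have "?s(r1 := [], r2 := w) = s(r1 := [], r2 := w)"
        by auto
      ultimately show ?thesis
        using w s ys assms by (intro exI[of _ w]) auto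
    next
      case False
      let ?s = "s(r1 := [], r2 := [Bit False])"
      have "runs_in n (CSeq (clear_com r1) (CSeq (clear_com r2) (CPush (\<lambda>_ _. Bit False) r1 r1 r2)))
          s out ?s out (Suc ((2 * length (s r1) + 1) + Suc ((2 * length ((s(r1 := [])) r2) + 1) + 2)))"
        by (rule runs_in_seq[OF runs_in_clear runs_in_seq[OF runs_in_clear runs_in_push]]) (use assms in auto)
      then have "runs_in n (CIf (=) r1 r2 (CSeq (CPop r1) (CPop r2))
         (CSeq (clear_com r1) (CSeq (clear_com r2) (CPush (\<lambda>_ _. Bit False) r1 r1 r2))))
         s out ?s out (2 * length (s r1) + 2 * length (s r2) + 7)"
        by (intro runs_in_mono[OF runs_in_if]) (use assms s False in auto)
      from runs_in_while_step[OF _ _ this runs_in_while_end[of r1]]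
      have "runs_in n (compare_com r1 r2) s out ?s out
          (7 * length (s r1) + 2 * length (s r2) + 12)"
        using assms s unfolding compare_com_def by (auto elim!: runs_in_mono)
      then show ?thesis
        using s False by (intro exI[of _ "[Bit False]"]) (metis length_Cons list.discI
            list.size(3) not_less_eq_eq top_of.simps(2) zero_le)
    qed
  qed
  then show ?thesis
    using that by blast
qed

section \<open>Frame properties and polynomial cost of safe programs\<close>

lemma for_loop_upd: "for_loop f i z (s(i := w), out) = for_loop f i z (s, out)"
  by (cases z) auto

lemma for_loop_frame:
  assumes "\<And>st. fst (f st) r = fst st r" "r \<noteq> i"
  shows "fst (for_loop f i z st) r = fst st r"
  using assms by (induction z arbitrary: st) auto

lemma sem_frame: "r \<notin> mods c \<Longrightarrow> fst (sem c st) r = fst st r"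
  by (induction c arbitrary: st) (auto simp: for_loop_frame)

lemma safe_mods: "safe n B c \<Longrightarrow> mods c \<subseteq> {..<n} - B"
  by (induction c arbitrary: B) auto

lemma poly_nat_mono: "a \<le> b \<Longrightarrow> poly p a \<le> poly p (b :: nat)"
  by (induction p) (auto intro: add_mono mult_mono)

text \<open>The scratch registers of \<open>compile\<close> have to be empty between
  commands.\<close>

definition clean :: "nat \<Rightarrow> store \<Rightarrow> bool" where
  "clean n s \<longleftrightarrow> (\<forall>r\<ge>n. s r = [])"

lemma clean_sem: "safe n B c \<Longrightarrow> clean n (fst st) \<Longrightarrow> clean n (fst (sem c st))"
  using safe_mods[of n B c] sem_frame[of _ c st] unfolding clean_def
  by (metis Diff_iff lessThan_iff not_le subsetD)

definition lens :: "nat set \<Rightarrow> store \<Rightarrow> nat \<Rightarrow> bool" where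
  "lens R s m \<longleftrightarrow> (\<forall>r\<in>R. length (s r) \<le> m)"

lemma lens_upd: "lens R s m \<Longrightarrow> length z \<le> m \<Longrightarrow> lens R (s(r := z)) m"
  by (auto simp: lens_def)

lemma lens_mono: "lens R s m \<Longrightarrow> m \<le> m' \<Longrightarrow> lens R s m'"
  by (auto simp: lens_def)

lemma lens_push: "lens R s m \<Longrightarrow> r \<in> R \<Longrightarrow> m < m' \<Longrightarrow> lens R (s(r := x # s r)) m'"
  by (fastforce simp: lens_def)

lemma lens_pop: "lens R s m \<Longrightarrow> r \<in> R \<Longrightarrow> m \<le> m' \<Longrightarrow> lens R (s(r := tl (s r))) m'"
  by (fastforce simp: lens_def)

lemma lens_copy: "lens R s m \<Longrightarrow> r' \<in> R \<Longrightarrow> m \<le> m' \<Longrightarrow> lens R (s(r := s r')) m'"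
  by (fastforce simp: lens_def)

lemma lensD: "lens R s m \<Longrightarrow> r \<in> R \<Longrightarrow> length (s r) \<le> m"
  by (simp add: lens_def)

text \<open>Time may be proportional to the longest register, but registers may only grow by an
  additive amount that depends on the loop bounds \<open>b\<close>. A factor on \<open>m\<close>
  would be compounded by every round of a loop, whereas additive growth adds up to a polynomial,
  since the registers of \<open>B\<close> never change.\<close>

definition cost :: "nat \<Rightarrow> nat set \<Rightarrow> cmd \<Rightarrow> nat poly \<Rightarrow> bool" where
  "cost n B c p \<longleftrightarrow> (\<forall>s out m b. clean n s \<longrightarrow> lens {..<n} s m \<longrightarrow> lens B s b \<longrightarrow>
     runs_in (n + 3) (compile n c) s out (fst (sem c (s, out))) (snd (sem c (s, out)))
       (poly p b * Suc m) \<and>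
     lens {..<n} (fst (sem c (s, out))) (m + poly p b))"

text \<open>After \<open>j\<close> rounds the registers have length at most
  \<open>m + j * P\<close>, so each of the at most \<open>b\<close> rounds takes no more than
  \<open>P * Suc (m + b * P) + 3\<close> steps. The 3 is the overhead of a round, and 30 covers the
  initial copy. The loop register may join \<open>B\<close> because it is never longer than
  \<open>r\<close>.\<close>

lemma cost_for:
  assumes safe: "safe n B (For i r c)" and p: "cost n (insert i B) c p"
  shows "cost n B (For i r c) ([:30:] + [:0, 1:] * (p * (1 + [:0, 1:] * p) + 3))"
  unfolding cost_def
proof (intro allI impI)
  fix s out m b
  assume s: "clean n s" "lens {..<n} s m" "lens B s b"
  define P where "P = poly p b"
  have i: "i < n" "i \<notin> B" "r < n" "r \<in> B" "i \<noteq> r" and safec: "safe n (insert i B) c"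
    using safe by auto
  \<comment> \<open>Stated for every \<open>m\<close>, because each round hands longer registers to
    the next.\<close>
  have loop: "runs_in (n + 3) (CWhile i (CSeq (compile n c) (CPop i))) s out
        (fst (for_loop (sem c) i z (s, out))) (snd (for_loop (sem c) i z (s, out)))
        (length z * (P * Suc (m + length z * P) + 3) + 1) \<and>
      lens {..<n} (fst (for_loop (sem c) i z (s, out))) (m + length z * P)"
    if "clean n s" "lens {..<n} s m" "lens B s b" "s i = z" "length z \<le> b" for z s out m
    using that
  proof (induction z arbitrary: s out m)
    case Nil
    then have "s(i := []) = s" by auto
    then show ?case
      using Nil runs_in_while_end[of i "n + 3" s] i by simp
  next
    case (Cons a z)
    obtain s1 out1 where 1: "sem c (s, out) = (s1, out1)"
      by fastforce
    have "lens (insert i B) s b"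
      using Cons.prems by (auto simp: lens_def)
    then have c: "runs_in (n + 3) (compile n c) s out s1 out1 (P * Suc m)" "lens {..<n} s1 (m + P)"
      using p Cons.prems 1 unfolding cost_def P_def by (metis fst_conv snd_conv)+
    have "s1 i = s i" and B: "\<And>x. x \<in> B \<Longrightarrow> s1 x = s x"
      using sem_frame[of _ c "(s, out)"] safe_mods[OF safec] 1 by auto
    then have si: "s1 i = a # z"
      using Cons.prems by simp
    let ?s = "s1(i := z)"
    have "runs_in (n + 3) (CSeq (compile n c) (CPop i)) s out ?s out1 (Suc (P * Suc m + 1))"
      by (rule runs_in_seq[OF c(1) runs_in_pop]) (use i si in auto)
    moreover have IH: "runs_in (n + 3) (CWhile i (CSeq (compile n c) (CPop i))) ?s out1
        (fst (for_loop (sem c) i z (?s, out1))) (snd (for_loop (sem c) i z (?s, out1)))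
        (length z * (P * Suc (m + P + length z * P) + 3) + 1) \<and>
      lens {..<n} (fst (for_loop (sem c) i z (?s, out1))) (m + P + length z * P)"
    proof (rule Cons.IH)
      show "clean n ?s"
        using clean_sem[OF safec, of "(s, out)"] Cons.prems(1) 1 i by (auto simp: clean_def)
      have "length (s1 i) \<le> m + P"
        using c(2) i by (auto simp: lens_def)
      then show "lens {..<n} ?s (m + P)"
        using c(2) si by (intro lens_upd) auto
      show "lens B ?s b"
        using Cons.prems B i by (auto simp: lens_def)
    qed (use Cons.prems in auto)
    ultimately have "runs_in (n + 3) (CWhile i (CSeq (compile n c) (CPop i))) s out
        (fst (for_loop (sem c) i z (?s, out1))) (snd (for_loop (sem c) i z (?s, out1)))
        (Suc (Suc (P * Suc m + 1) + (length z * (P * Suc (m + P + length z * P) + 3) + 1)))"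
      by (intro runs_in_while_step) (use i Cons.prems in auto)
    moreover have "P * Suc m \<le> P * Suc (m + P + length z * P)"
      by (intro mult_le_mono2) simp
    moreover have "s(i := a # z) = s"
      using Cons.prems by auto
    then have "for_loop (sem c) i (a # z) (s, out) = for_loop (sem c) i z (?s, out1)"
      using 1 by (simp add: for_loop_upd)
    ultimately show ?case
      using IH by (auto simp: algebra_simps elim!: runs_in_mono)
  qed
  let ?s = "s(i := s r)"
  have len: "length (s r) \<le> b" "length (s r) \<le> m" "length (s i) \<le> m"
    using s i by (auto simp: lens_def)
  have loop_eq: "sem (For i r c) (s, out) = for_loop (sem c) i (s r) (?s, out)"
    by (simp add: for_loop_upd)
  have L: "runs_in (n + 3) (CWhile i (CSeq (compile n c) (CPop i))) ?s out
        (fst (for_loop (sem c) i (s r) (?s, out))) (snd (for_loop (sem c) i (s r) (?s, out)))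
        (length (s r) * (P * Suc (m + length (s r) * P) + 3) + 1) \<and>
      lens {..<n} (fst (for_loop (sem c) i (s r) (?s, out))) (m + length (s r) * P)"
    by (rule loop) (use s i len in \<open>auto simp: clean_def lens_def\<close>)
  have "runs_in (n + 3) (copy_com n i r) s out ?s out (2 * length (s i) + 13 * length (s r) + 5)"
    using s i by (intro runs_in_copy) (auto simp: clean_def)
  from runs_in_seq[OF this conjunct1[OF L]]
  have R: "runs_in (n + 3) (compile n (For i r c)) s out (fst (sem (For i r c) (s, out)))
      (snd (sem (For i r c) (s, out)))
      (Suc (2 * length (s i) + 13 * length (s r) + 5 +
        (length (s r) * (P * Suc (m + length (s r) * P) + 3) + 1)))"
    by (simp only: loop_eq compile.simps)
  have "length (s r) * (P * Suc (m + length (s r) * P) + 3) \<le> b * (P * Suc (m + b * P) + 3)"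
    using len by (intro mult_le_mono add_le_mono) auto
  also have "\<dots> \<le> b * (P * (1 + b * P) + 3) * Suc m"
    by (simp add: algebra_simps)
  finally have time: "Suc (2 * length (s i) + 13 * length (s r) + 5 +
        (length (s r) * (P * Suc (m + length (s r) * P) + 3) + 1))
      \<le> (30 + b * (P * (1 + b * P) + 3)) * Suc m"
    using len by (simp add: algebra_simps)
  have "length (s r) * P \<le> b * P"
    using len by (intro mult_le_mono) auto
  also have "\<dots> \<le> 30 + b * (P * (1 + b * P) + 3)"
    by (simp add: algebra_simps)
  finally have "lens {..<n} (fst (sem (For i r c) (s, out))) (m + (30 + b * (P * (1 + b * P) + 3)))"
    unfolding loop_eq using L by (elim conjE lens_mono) auto
  then show "runs_in (n + 3) (compile n (For i r c)) s out (fst (sem (For i r c) (s, out)))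
      (snd (sem (For i r c) (s, out)))
      (poly ([:30:] + [:0, 1:] * (p * (1 + [:0, 1:] * p) + 3)) b * Suc m) \<and>
    lens {..<n} (fst (sem (For i r c) (s, out)))
      (m + poly ([:30:] + [:0, 1:] * (p * (1 + [:0, 1:] * p) + 3)) b)"
    using runs_in_mono[OF R time] by (simp add: P_def)
qed

text \<open>The second command starts from length at most \<open>m + P\<close>, and
  \<open>Suc (m + P) \<le> (1 + P) * Suc m\<close> brings its time back into the form required by
  \<open>cost\<close>.\<close>

lemma cost_seq:
  assumes safe: "safe n B (c ;; d)" and p: "cost n B c p" and q: "cost n B d q"
  shows "cost n B (c ;; d) (p + q * (1 + p) + 1)"
  unfolding cost_def
proof (intro allI impI)
  fix s out m b
  assume s: "clean n s" "lens {..<n} s m" "lens B s b"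
  obtain s1 out1 where 1: "sem c (s, out) = (s1, out1)"
    by fastforce
  obtain s2 out2 where 2: "sem d (s1, out1) = (s2, out2)"
    by fastforce
  define P Q where "P = poly p b" and "Q = poly q b"
  have c: "runs_in (n + 3) (compile n c) s out s1 out1 (P * Suc m)" "lens {..<n} s1 (m + P)"
    using p s 1 unfolding cost_def P_def by (metis fst_conv snd_conv)+
  have "clean n s1"
    using clean_sem[of n B c "(s, out)"] safe s 1 by simp
  moreover have "s1 r = s r" if "r \<in> B" for r
    using sem_frame[of r c "(s, out)"] safe_mods[of n B c] safe that 1 by auto
  then have "lens B s1 b"
    using s by (simp add: lens_def)
  ultimately have d: "runs_in (n + 3) (compile n d) s1 out1 s2 out2 (Q * Suc (m + P))"
    "lens {..<n} s2 (m + P + Q)"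
    using q c(2) 2 unfolding cost_def Q_def by (metis fst_conv snd_conv)+
  have "runs_in (n + 3) (compile n (c ;; d)) s out s2 out2 (Suc (P * Suc m + Q * Suc (m + P)))"
    using runs_in_seq[OF c(1) d(1)] by simp
  moreover have "Suc (P * Suc m + Q * Suc (m + P)) \<le> (P + Q * (1 + P) + 1) * Suc m"
    by (simp add: algebra_simps)
  moreover have "lens {..<n} s2 (m + (P + Q * (1 + P) + 1))"
    using d(2) by (rule lens_mono) (simp add: algebra_simps)
  ultimately show "runs_in (n + 3) (compile n (c ;; d)) s out (fst (sem (c ;; d) (s, out)))
      (snd (sem (c ;; d) (s, out))) (poly (p + q * (1 + p) + 1) b * Suc m) \<and>
    lens {..<n} (fst (sem (c ;; d) (s, out))) (m + poly (p + q * (1 + p) + 1) b)"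
    using runs_in_mono by (simp add: 1 2 P_def Q_def)
qed

lemma cost_choice:
  assumes p: "cost n B c p" and q: "cost n B d q"
    and s: "clean n s" "lens {..<n} s m" "lens B s b" and e: "e = (if x then c else d)"
  shows "runs_in (n + 3) (compile n e) s out (fst (sem e (s, out)))
      (snd (sem e (s, out))) (poly p b * Suc m + poly q b * Suc m) \<and>
    lens {..<n} (fst (sem e (s, out))) (m + (poly p b + poly q b))"
proof (cases x)
  case True
  have "runs_in (n + 3) (compile n c) s out (fst (sem c (s, out))) (snd (sem c (s, out)))
      (poly p b * Suc m) \<and> lens {..<n} (fst (sem c (s, out))) (m + poly p b)"
    using p s unfolding cost_def by blast
  then show ?thesis
    using True e by (auto elim!: runs_in_mono lens_mono)
next
  case False
  have "runs_in (n + 3) (compile n d) s out (fst (sem d (s, out))) (snd (sem d (s, out)))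
      (poly q b * Suc m) \<and> lens {..<n} (fst (sem d (s, out))) (m + poly q b)"
    using q s unfolding cost_def by blast
  then show ?thesis
    using False e by (auto elim!: runs_in_mono lens_mono)
qed

lemma cost_if:
  assumes safe: "safe n B (If P r1 r2 c d)" and p: "cost n B c p" and q: "cost n B d q"
  shows "cost n B (If P r1 r2 c d) (p + q + 1)"
  unfolding cost_def
proof (intro allI impI)
  fix s out m b
  assume s: "clean n s" "lens {..<n} s m" "lens B s b"
  define e where "e = (if P (top_of (s r1)) (top_of (s r2)) then c else d)"
  have "runs_in (n + 3) (compile n e) s out (fst (sem e (s, out)))
      (snd (sem e (s, out))) (poly p b * Suc m + poly q b * Suc m) \<and>
    lens {..<n} (fst (sem e (s, out))) (m + (poly p b + poly q b))"
    by (rule cost_choice[OF p q s e_def])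
  moreover have "sem (If P r1 r2 c d) (s, out) = sem e (s, out)"
    by (simp add: e_def)
  moreover have "compile n e = (if P (top_of (s r1)) (top_of (s r2)) then compile n c else compile n d)"
    by (simp add: e_def)
  ultimately show "runs_in (n + 3) (compile n (If P r1 r2 c d)) s out
      (fst (sem (If P r1 r2 c d) (s, out))) (snd (sem (If P r1 r2 c d) (s, out)))
      (poly (p + q + 1) b * Suc m) \<and>
    lens {..<n} (fst (sem (If P r1 r2 c d) (s, out))) (m + poly (p + q + 1) b)"
    using safe by (auto intro!: runs_in_mono[OF runs_in_if] elim!: lens_mono simp: algebra_simps
        simp del: sem.simps)
qed

text \<open>A comparison consumes its operands, so it works on copies; 80 generously covers copying,
  comparing and clearing.\<close>

lemma cost_if_eq:
  assumes safe: "safe n B (IfEq r1 r2 c d)" and p: "cost n B c p" and q: "cost n B d q"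
  shows "cost n B (IfEq r1 r2 c d) (p + q + [:80:])"
  unfolding cost_def
proof (intro allI impI)
  fix s out m b
  assume s: "clean n s" "lens {..<n} s m" "lens B s b"
  have r: "r1 < n" "r2 < n"
    using safe by auto
  then have len: "length (s r1) \<le> m" "length (s r2) \<le> m" and cl: "s n = []" "s (n + 1) = []" "s (n + 2) = []"
    using s by (auto simp: lens_def clean_def)
  define e where "e = (if s r1 = s r2 then c else d)"
  have e: "runs_in (n + 3) (compile n e) s out (fst (sem e (s, out)))
      (snd (sem e (s, out))) (poly p b * Suc m + poly q b * Suc m) \<and>
    lens {..<n} (fst (sem e (s, out))) (m + (poly p b + poly q b))"
    by (rule cost_choice[OF p q s e_def])
  let ?s1 = "s(n + 1 := s r1)"
  let ?s2 = "?s1(n + 2 := s r2)"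
  obtain w where w: "w = [] \<longleftrightarrow> ?s2 (n + 1) = ?s2 (n + 2)" "length w \<le> Suc (length (?s2 (n + 2)))"
    "runs_in (n + 3) (compare_com (n + 1) (n + 2)) ?s2 out (?s2(n + 1 := [], n + 2 := w)) out
      (7 * length (?s2 (n + 1)) + 2 * length (?s2 (n + 2)) + 12)"
    using runs_in_compare[of "n + 1" "n + 3" "n + 2" ?s2] by auto
  let ?s3 = "?s2(n + 1 := [], n + 2 := w)"
  have copy1: "runs_in (n + 3) (copy_com n (n + 1) r1) s out ?s1 out (13 * length (s r1) + 5)"
    using runs_in_copy[of n "n + 3" "n + 1" r1 s] r cl by simp
  have copy2: "runs_in (n + 3) (copy_com n (n + 2) r2) ?s1 out ?s2 out (13 * length (s r2) + 5)"
    using runs_in_copy[of n "n + 3" "n + 2" r2 ?s1] r cl by simp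
  have branch: "runs_in (n + 3) (CIf (\<lambda>a _. a = None) (n + 2) (n + 2) (compile n c)
         (CSeq (clear_com (n + 2)) (compile n d))) ?s3 out (fst (sem e (s, out))) (snd (sem e (s, out)))
         (Suc (Suc ((2 * length w + 1) + (poly p b * Suc m + poly q b * Suc m))))"
  proof (cases "s r1 = s r2")
    case True
    then have "w = []" "?s3 = s"
      using w cl by auto
    moreover have "s (n + 2) = []"
      using cl by simp
    ultimately show ?thesis
      using e True unfolding e_def by (intro runs_in_if) (auto elim!: runs_in_mono)
  next
    case False
    then have "w \<noteq> []" and s3: "?s3(n + 2 := []) = s"
      using w cl by auto
    then have "top_of w \<noteq> None"
      by (cases w) auto
    moreover have "runs_in (n + 3) (compile n d) (?s3(n + 2 := [])) out (fst (sem e (s, out)))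
        (snd (sem e (s, out))) (poly p b * Suc m + poly q b * Suc m)"
      unfolding s3 using e False by (simp add: e_def)
    then have "runs_in (n + 3) (CSeq (clear_com (n + 2)) (compile n d)) ?s3 out
        (fst (sem e (s, out))) (snd (sem e (s, out)))
        (Suc ((2 * length (?s3 (n + 2)) + 1) + (poly p b * Suc m + poly q b * Suc m)))"
      by (intro runs_in_seq[OF runs_in_clear]) simp
    ultimately show ?thesis
      by (intro runs_in_if) auto
  qed
  have "runs_in (n + 3) (compile n (IfEq r1 r2 c d)) s out (fst (sem e (s, out))) (snd (sem e (s, out)))
    (Suc ((13 * length (s r1) + 5) + Suc ((13 * length (s r2) + 5) +
       Suc ((7 * length (?s2 (n + 1)) + 2 * length (?s2 (n + 2)) + 12) +
       (Suc (Suc ((2 * length w + 1) + (poly p b * Suc m + poly q b * Suc m))))))))"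
    unfolding compile.simps
    by (rule runs_in_seq[OF copy1 runs_in_seq[OF copy2 runs_in_seq[OF w(3) branch]]])
  moreover have "Suc ((13 * length (s r1) + 5) + Suc ((13 * length (s r2) + 5) +
       Suc ((7 * length (?s2 (n + 1)) + 2 * length (?s2 (n + 2)) + 12) +
       (Suc (Suc ((2 * length w + 1) + (poly p b * Suc m + poly q b * Suc m)))))))
    \<le> poly (p + q + [:80:]) b * Suc m"
    using len w(2) by (simp add: algebra_simps)
  moreover have "sem (IfEq r1 r2 c d) (s, out) = sem e (s, out)"
    by (simp add: e_def)
  moreover have "lens {..<n} (fst (sem e (s, out))) (m + poly (p + q + [:80:]) b)"
    using e by (auto elim!: lens_mono)
  ultimately show "runs_in (n + 3) (compile n (IfEq r1 r2 c d)) s out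
      (fst (sem (IfEq r1 r2 c d) (s, out))) (snd (sem (IfEq r1 r2 c d) (s, out)))
      (poly (p + q + [:80:]) b * Suc m) \<and>
    lens {..<n} (fst (sem (IfEq r1 r2 c d) (s, out))) (m + poly (p + q + [:80:]) b)"
    by (simp only:) (blast intro: runs_in_mono)
qed

lemma runs_in_emit_all:
  assumes "r < n" "s n = []" "s (n + 1) = []"
  shows "runs_in (n + 3) (compile n (EmitAll bs r)) s out s
    (out @ concat (replicate (length (s r)) bs)) ((2 * length bs + 18) * Suc (length (s r)))"
proof -
  let ?c = "CWhile (n + 1) (CSeq (emit_com bs) (CPop (n + 1)))"
  have loop: "runs_in (n + 3) ?c (s(n + 1 := z)) out s
      (out @ concat (replicate (length z) bs)) ((2 * length bs + 4) * length z + 1)" for z out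
  proof (induction z arbitrary: out)
    case Nil
    have "s(n + 1 := []) = s" using assms by auto
    then show ?case
      using runs_in_while_end[of "n + 1" "n + 3" s] assms by simp
  next
    case (Cons x z)
    have "runs_in (n + 3) (CSeq (emit_com bs) (CPop (n + 1))) (s(n + 1 := x # z)) out (s(n + 1 := z))
       (out @ bs) (Suc ((2 * length bs + 1) + 1))"
      by (rule runs_in_seq[OF runs_in_emit runs_in_pop]) auto
    then have "runs_in (n + 3) ?c (s(n + 1 := x # z)) out s
        ((out @ bs) @ concat (replicate (length z) bs))
        (Suc (Suc ((2 * length bs + 1) + 1) + ((2 * length bs + 4) * length z + 1)))"
      by (rule runs_in_while_step[OF _ _ _ Cons, rotated -1]) auto
    then have "runs_in (n + 3) ?c (s(n + 1 := x # z)) out s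
        (out @ concat (replicate (length (x # z)) bs))
        (Suc (Suc ((2 * length bs + 1) + 1) + ((2 * length bs + 4) * length z + 1)))"
      by (simp del: fun_upd_apply)
    then show ?case
      by (rule runs_in_mono) simp
  qed
  have "runs_in (n + 3) (copy_com n (n + 1) r) s out (s(n + 1 := s r)) out (13 * length (s r) + 5)"
    using runs_in_copy[of n "n + 3" "n + 1" r s] assms by simp
  from runs_in_seq[OF this loop]
  show ?thesis
    by (auto simp: algebra_simps elim!: runs_in_mono)
qed

lemma cost_exists: "safe n B c \<Longrightarrow> \<exists>p. cost n B c p"
proof (induction c arbitrary: B)
  case Nop
  have "cost n B Nop [:1:]"
    using runs_skip by (auto simp: cost_def runs_in_def intro!: exI[of _ 1] elim!: lens_mono)
  then show ?case ..
next
  case (Push g r1 r2 r)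
  have "cost n B (Push g r1 r2 r) [:2:]"
    using Push by (auto simp: cost_def intro!: runs_in_mono[OF runs_in_push[OF _ _ _ refl]] elim!: lens_push)
  then show ?case ..
next
  case (Pop r)
  have "cost n B (Pop r) [:1:]"
    using Pop by (auto simp: cost_def intro!: runs_in_mono[OF runs_in_pop[OF _ refl]] elim!: lens_pop)
  then show ?case ..
next
  case (Clear r)
  have "cost n B (Clear r) [:2:]"
    using Clear lens_mono[OF lens_upd]
    by (auto simp: cost_def intro!: runs_in_mono[OF runs_in_clear] dest: lensD)
  then show ?case ..
next
  case (Copy r r')
  have "runs_in (n + 3) (copy_com n r r') s out (s(r := s r')) out (20 * Suc m)"
    if "clean n s" "lens {..<n} s m" for s out m
  proof -
    have "length (s r) \<le> m" "length (s r') \<le> m"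
      using that Copy by (auto simp: lens_def)
    then show ?thesis
      using that Copy by (intro runs_in_mono[OF runs_in_copy]) (auto simp: clean_def)
  qed
  then have "cost n B (Copy r r') [:20:]"
    using Copy by (auto simp: cost_def elim!: lens_copy)
  then show ?case ..
next
  case (Emit bs)
  have "cost n B (Emit bs) [:2 * length bs + 1:]"
    by (auto simp: cost_def intro!: runs_in_mono[OF runs_in_emit] elim!: lens_mono)
  then show ?case ..
next
  case (EmitAll bs r)
  have "runs_in (n + 3) (compile n (EmitAll bs r)) s out s
    (out @ concat (replicate (length (s r)) bs)) ((2 * length bs + 18) * Suc m)"
    if "clean n s" "lens {..<n} s m" for s out m
  proof (rule runs_in_mono[OF runs_in_emit_all])
    show "(2 * length bs + 18) * Suc (length (s r)) \<le> (2 * length bs + 18) * Suc m"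
      using that EmitAll by (intro mult_le_mono2) (auto simp: lens_def)
  qed (use that EmitAll in \<open>auto simp: clean_def\<close>)
  then have "cost n B (EmitAll bs r) [:2 * length bs + 18:]"
    by (auto simp: cost_def simp del: compile.simps elim!: lens_mono)
  then show ?case ..
next
  case (Seq c d)
  then show ?case using cost_seq[OF Seq.prems] by (meson safe.simps(8))
next
  case (If P r1 r2 c d)
  then show ?case using cost_if[OF If.prems] by (meson safe.simps(9))
next
  case (IfEq r1 r2 c d)
  then show ?case using cost_if_eq[OF IfEq.prems] by (meson safe.simps(10))
next
  case (For i r c)
  then show ?case using cost_for[OF For.prems] by (meson safe.simps(11))
qed

section \<open>Sequences of phases with different loop bounds\<close>

text \<open>Here everything is measured by the longest register alone. This form survives sequencing
  of phases that are safe for different sets \<open>B\<close>, such as one that fills a register and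
  one that loops over it.\<close>

definition timed :: "nat \<Rightarrow> cmd \<Rightarrow> nat poly \<Rightarrow> bool" where
  "timed n c p \<longleftrightarrow> (\<forall>s out m. clean n s \<longrightarrow> lens {..<n} s m \<longrightarrow>
     runs_in (n + 3) (compile n c) s out (fst (sem c (s, out))) (snd (sem c (s, out))) (poly p m) \<and>
     lens {..<n} (fst (sem c (s, out))) (poly p m) \<and> clean n (fst (sem c (s, out))))"

lemma timed_of_safe:
  assumes "safe n B c" "B \<subseteq> {..<n}"
  shows "\<exists>p. timed n c p"
proof -
  obtain p where p: "cost n B c p"
    using cost_exists assms by blast
  have "runs_in (n + 3) (compile n c) s out (fst (sem c (s, out))) (snd (sem c (s, out)))
       (poly (p * [:1, 1:] + [:0, 1:]) m) \<and>
     lens {..<n} (fst (sem c (s, out))) (poly (p * [:1, 1:] + [:0, 1:]) m) \<and>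
     clean n (fst (sem c (s, out)))"
    if s: "clean n s" "lens {..<n} s m" for s out m
  proof -
    have "lens B s m"
      using s assms(2) by (auto simp: lens_def)
    then have "runs_in (n + 3) (compile n c) s out (fst (sem c (s, out))) (snd (sem c (s, out)))
        (poly p m * Suc m)" "lens {..<n} (fst (sem c (s, out))) (m + poly p m)"
      using p s unfolding cost_def by blast+
    then show ?thesis
      using clean_sem[OF assms(1), of "(s, out)"] s(1)
      by (auto elim!: runs_in_mono lens_mono simp: algebra_simps)
  qed
  then show ?thesis
    unfolding timed_def by blast
qed

lemma timed_seq:
  assumes "timed n c p" "timed n d q"
  shows "timed n (c ;; d) (1 + p + pcompose q p)"
  unfolding timed_def
proof (intro allI impI)
  fix s out m
  assume s: "clean n s" "lens {..<n} s m"
  obtain s1 out1 where 1: "sem c (s, out) = (s1, out1)"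
    by fastforce
  obtain s2 out2 where 2: "sem d (s1, out1) = (s2, out2)"
    by fastforce
  have c: "runs_in (n + 3) (compile n c) s out s1 out1 (poly p m)" "lens {..<n} s1 (poly p m)"
    "clean n s1"
    using assms(1) s 1 unfolding timed_def by (metis fst_conv snd_conv)+
  have d: "runs_in (n + 3) (compile n d) s1 out1 s2 out2 (poly q (poly p m))"
    "lens {..<n} s2 (poly q (poly p m))" "clean n s2"
    using assms(2) c 2 unfolding timed_def by (metis fst_conv snd_conv)+
  show "runs_in (n + 3) (compile n (c ;; d)) s out (fst (sem (c ;; d) (s, out)))
       (snd (sem (c ;; d) (s, out))) (poly (1 + p + pcompose q p) m) \<and>
     lens {..<n} (fst (sem (c ;; d) (s, out))) (poly (1 + p + pcompose q p) m) \<and>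
     clean n (fst (sem (c ;; d) (s, out)))"
    using runs_in_seq[OF c(1) d(1)] d(2,3)
    by (auto simp: 1 2 poly_pcompose elim!: lens_mono)
qed

lemma polytime_cmd:
  assumes "timed n c p" "n > 0" and f: "\<And>x. snd (sem c (input_store x, [])) = f x"
  shows "polytime f"
proof (rule polytime_of_runs)
  fix x
  have "clean n (input_store x)" "lens {..<n} (input_store x) (length x)"
    using \<open>n > 0\<close> by (auto simp: clean_def lens_def input_store_def)
  then have "runs_in (n + 3) (compile n c) (input_store x) [] (fst (sem c (input_store x, [])))
      (f x) (poly p (length x))"
    using assms(1) f unfolding timed_def by metis
  then show "\<exists>t\<le>poly p (length x). \<exists>s'. runs (n + 3) (compile n c) (input_store x) [] s' (f x) t"
    unfolding runs_in_def by blast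
qed (use \<open>n > 0\<close> in simp)

section \<open>From Horn rules to symmetric formulas\<close>

text \<open>\<open>PT q as\<close> says that the state is \<open>q\<close> and that the first
  \<open>length as\<close> tapes show the codes \<open>as\<close> under their heads;
  \<open>XT j d a\<close> says that on side \<open>d\<close> of tape \<open>j\<close> there is a
  cell with code \<open>a\<close>. The two numbers added in \<open>var\<close> are the time and the
  distance from the head.\<close>

datatype tag = PT nat "nat list" | XT nat bool nat

type_synonym var = "tag \<times> nat \<times> nat"
type_synonym lit = "bool \<times> var"
type_synonym rule = "lit \<times> lit \<times> lit"

fun lsat :: "(var \<Rightarrow> bool) \<Rightarrow> lit \<Rightarrow> bool" where
  "lsat A (b, v) = (A v = b)"

fun rsat :: "(var \<Rightarrow> bool) \<Rightarrow> rule \<Rightarrow> bool" where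
  "rsat A (a, b, c) = (lsat A a \<or> lsat A b \<or> lsat A c)"

fun tag_code :: "tag \<Rightarrow> nat" where
  "tag_code (PT q as) = 2 * prod_encode (q, list_encode as)"
| "tag_code (XT j d a) = 2 * prod_encode (j, prod_encode (if d then 1 else 0, a)) + 1"

lemma tag_code_inject [simp]: "tag_code g = tag_code h \<longleftrightarrow> g = h"
proof
  assume *: "tag_code g = tag_code h"
  then have "even (tag_code g) = even (tag_code h)" "tag_code g div 2 = tag_code h div 2"
    by simp_all
  then show "g = h"
    by (cases g; cases h) (auto simp: list_encode_eq split: if_splits)
qed simp

text \<open>Any word ending in \<open>1\<close> is the binary representation of a number, so variables may be named
  by words.\<close>

fun num :: "bool list \<Rightarrow> nat" where
  "num [] = 0"
| "num (b # w) = of_bool b + 2 * num w"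

lemma num_pos: "w \<noteq> [] \<Longrightarrow> last w \<Longrightarrow> num w > 0"
  by (induction w) (auto split: if_splits)

lemma binary_num: "w = [] \<or> last w \<Longrightarrow> binary (num w) = w"
proof (induction w)
  case Nil
  then show ?case by (simp add: binary.simps)
next
  case (Cons b w)
  have "num (b # w) > 0"
    using num_pos[of "b # w"] Cons.prems by simp
  moreover have "w = [] \<or> last w"
    using Cons.prems by (auto split: if_splits)
  ultimately show ?case
    using Cons.IH by (subst binary.simps) (auto simp: div_mult_self1)
qed

lemma num_snoc_inject [simp]: "num (v @ [True]) = num (w @ [True]) \<longleftrightarrow> v = w"
proof
  assume "num (v @ [True]) = num (w @ [True])"
  then have "binary (num (v @ [True])) = binary (num (w @ [True]))"
    by (rule arg_cong)
  then show "v = w"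
    by (simp add: binary_num)
qed simp

text \<open>Three unary blocks, each closed by \<open>False\<close>: a program can print them by
  copying registers, and as a prefix-free code they can be followed by a second name, as in
  \<open>y_name\<close>.\<close>

fun word :: "var \<Rightarrow> bool list" where
  "word (g, t, i) = replicate t True @ False # replicate i True @ False #
     replicate (tag_code g) True @ [False]"

lemma replicate_True_append_inject [simp]:
  "replicate m True @ False # v = replicate n True @ False # w \<longleftrightarrow> m = n \<and> v = w"
  by (induction m arbitrary: n) (case_tac n; auto)+

lemma word_append_inject: "word v @ r = word w @ s \<longleftrightarrow> v = w \<and> r = s"
  by (cases v; cases w) auto

definition z_name :: nat where
  "z_name = num [True]"

definition v_name :: "var \<Rightarrow> nat" where
  "v_name v = num (word v @ [True])"

text \<open>The auxiliary variable is named after the first two literals of its clause. Clauses that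
  agree in these share it, which is sound because its intended value depends on nothing
  else.\<close>

fun y_name :: "lit \<Rightarrow> lit \<Rightarrow> nat" where
  "y_name (a, v) (b, w) = num (word v @ word w @ [a, b, True])"

lemma word_neq_Nil [simp]: "word v \<noteq> []"
  by (cases v) auto

lemma v_name_inject [simp]: "v_name v = v_name w \<longleftrightarrow> v = w"
  using num_snoc_inject[of "word v" "word w"] word_append_inject[of v "[]" w "[]"]
  by (simp add: v_name_def del: num_snoc_inject)

lemma z_neq_v [simp]: "z_name \<noteq> v_name v"
  using num_snoc_inject[of "[]" "word v"] word_neq_Nil[of v, symmetric]
  by (simp add: v_name_def z_name_def del: num_snoc_inject)

lemma y_neq_z [simp]: "y_name a b \<noteq> z_name"
  using num_snoc_inject[of "word (snd a) @ word (snd b) @ [fst a, fst b]" "[]"]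
  by (cases a; cases b) (simp add: z_name_def)

lemma y_neq_v [simp]: "y_name a b \<noteq> v_name v"
proof -
  have "word (snd a) @ word (snd b) @ [fst a, fst b] \<noteq> word v"
    using word_append_inject[of "snd a" "word (snd b) @ [fst a, fst b]" v "[]"] by auto
  then show ?thesis
    using num_snoc_inject[of "word (snd a) @ word (snd b) @ [fst a, fst b]" "word v"]
    by (cases a; cases b) (simp add: v_name_def)
qed

lemma y_name_inject [simp]: "y_name a b = y_name c d \<longleftrightarrow> a = c \<and> b = d"
  using num_snoc_inject[of "word (snd a) @ word (snd b) @ [fst a, fst b]"
      "word (snd c) @ word (snd d) @ [fst c, fst d]"]
  by (cases a; cases b; cases c; cases d)
    (auto simp: word_append_inject simp del: num_snoc_inject)

declare word.simps [simp del] y_name.simps [simp del]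

section \<open>Not-all-equal constraints as symmetric formulas\<close>

definition mk :: "bool \<Rightarrow> nat \<Rightarrow> literal" where
  "mk b j = (if b then Pos j else Neg j)"

definition lit :: "lit \<Rightarrow> literal" where
  "lit a = mk (fst a) (v_name (snd a))"

text \<open>The clause \<open>a \<or> b \<or> c\<close> becomes \<open>NAE(a, b, y)\<close> and \<open>NAE(\<not> y, c, z)\<close>, where \<open>z\<close> is shared by
  all clauses and plays the role of the constant false.\<close>

fun symz :: "rule \<Rightarrow> formula" where
  "symz (a, b, c) =
     (let C = (lit a, lit b, Pos (y_name a b)); D = (Neg (y_name a b), lit c, Pos z_name)
      in [C, mirror C, D, mirror D])"

lemma mirror_mirror [simp]: "mirror (mirror C) = C"
proof -
  have "negate (negate a) = a" for a
    by (cases a) auto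
  then show ?thesis
    by (cases C) auto
qed

text \<open>Mirroring is an involution, so in the block of each rule every clause is as frequent as
  its mirror, and counts add up over blocks even if clauses repeat. Membership of the mirror follows
  from a nonzero count.\<close>

lemma symmetric_symz: "symmetric (concat (map symz rs))"
proof -
  have eq: "C = mirror D \<longleftrightarrow> mirror C = D" for C D
    by auto
  have "negate a \<noteq> a" for a
    by (cases a) auto
  then have "mirror C \<noteq> C" for C
    by (cases C) auto
  then have symz: "count_list (symz r) (mirror C) = count_list (symz r) C" for r C
    by (cases r) (auto simp: Let_def eq simp del: mirror.simps)
  have "count_list (concat (map symz rs)) (mirror C) = count_list (concat (map symz rs)) C" for C
    by (induction rs) (auto simp: symz)
  then show ?thesis
    unfolding symmetric_def by (metis count_list_0_iff)
qed

lemma lit_sat_mk: "lit_sat v (mk b j) = (v j = b)"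
  by (simp add: mk_def)

lemma clause_sat_mirror: "clause_sat v (mirror (a, b, c)) \<longleftrightarrow>
    \<not> lit_sat v a \<or> \<not> lit_sat v b \<or> \<not> lit_sat v c"
proof -
  have "lit_sat v (negate l) = (\<not> lit_sat v l)" for l
    by (cases l) auto
  then show ?thesis by simp
qed

lemma satisfiable_symz:
  "satisfiable (concat (map symz rs)) \<longleftrightarrow> (\<exists>A. \<forall>r\<in>set rs. rsat A r)"
proof
  assume "satisfiable (concat (map symz rs))"
  then obtain v where v: "\<And>r C. r \<in> set rs \<Longrightarrow> C \<in> set (symz r) \<Longrightarrow> clause_sat v C"
    unfolding satisfiable_def by auto
  \<comment> \<open>Complementing all variables preserves not-all-equal constraints, so only values
    relative to \<open>z_name\<close> carry meaning.\<close>
  define A where "A x = (v (v_name x) \<noteq> v z_name)" for x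
  have "rsat A (a, b, c)" if "(a, b, c) \<in> set rs" for a b c
  proof -
    let ?C = "(lit a, lit b, Pos (y_name a b))" and ?D = "(Neg (y_name a b), lit c, Pos z_name)"
    have "clause_sat v ?C" "clause_sat v (mirror ?C)" "clause_sat v ?D" "clause_sat v (mirror ?D)"
      by (auto intro!: v[OF that] simp: Let_def simp del: mirror.simps clause_sat.simps)
    then show ?thesis
      by (cases a; cases b; cases c)
        (auto simp: clause_sat_mirror lit_def lit_sat_mk A_def simp del: mirror.simps)
  qed
  then show "\<exists>A. \<forall>r\<in>set rs. rsat A r"
    by (intro exI[of _ A]) auto
next
  assume "\<exists>A. \<forall>r\<in>set rs. rsat A r"
  then obtain A where A: "\<And>r. r \<in> set rs \<Longrightarrow> rsat A r"
    by blast
  \<comment> \<open>With \<open>z_name\<close> false, a true \<open>y\<close> makes the second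
    constraint demand \<open>c\<close>. So \<open>y\<close> is true only where the first constraint
    forces it, namely if \<open>a\<close> and \<open>b\<close> both fail.\<close>
  define v where "v j = ((\<exists>x. j = v_name x \<and> A x) \<or>
    (\<exists>a b. j = y_name a b \<and> \<not> lsat A a \<and> \<not> lsat A b))" for j
  have vv: "v (v_name x) = A x" and vy: "v (y_name a b) = (\<not> lsat A a \<and> \<not> lsat A b)"
    and vz: "\<not> v z_name" for x a b
    by (auto simp: v_def y_neq_v[symmetric] y_neq_z[symmetric])
  have "clause_sat v C" if "(a, b, c) \<in> set rs" "C \<in> set (symz (a, b, c))" for a b c C
    using A[OF that(1)] that(2)
    by (cases a; cases b; cases c)
      (auto simp: Let_def clause_sat_mirror lit_def lit_sat_mk vv vy vz simp del: mirror.simps)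
  then show "satisfiable (concat (map symz rs))"
    unfolding satisfiable_def by (intro exI[of _ v]) auto
qed

section \<open>Describing a computation by Horn rules\<close>

text \<open>Every tape is described relative to its head, and the origin of each tape carries a mark, so
  that a cell has one of \<open>2 * symbols M\<close> codes. Cells are addressed by a side (\<open>True\<close> is right, including
  the cell under the head) and a positive number.\<close>

definition code :: "nat \<Rightarrow> tape \<Rightarrow> int \<Rightarrow> nat" where
  "code S T d = fst T (snd T + d) + (if snd T + d = 0 then S else 0)"

fun off :: "bool \<times> nat \<Rightarrow> int" where
  "off (True, n) = int n - 1"
| "off (False, n) = - int n"

text \<open>Addresses move against the head: this is the new address of the cell that was at
  \<open>p\<close>. Only a cell at distance 1 can change sides.\<close>

fun mv :: "move \<Rightarrow> bool \<times> nat \<Rightarrow> bool \<times> nat" where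
  "mv Stay p = p"
| "mv Rgt (True, n) = (if n \<ge> 2 then (True, n - 1) else (False, 1))"
| "mv Rgt (False, n) = (False, n + 1)"
| "mv Lft (True, n) = (True, n + 1)"
| "mv Lft (False, n) = (if n \<ge> 2 then (False, n - 1) else (True, 1))"

lemma off_mv: "snd p \<ge> 1 \<Longrightarrow> off (mv d p) = off p - shift d"
  by (cases "(d, p)" rule: mv.cases) auto

text \<open>The transition in terms of codes; the mark of the cell survives the write. A halted
  machine idles, so every run can be continued to the full time bound.\<close>

definition next_of :: "tm \<Rightarrow> nat \<Rightarrow> nat list \<Rightarrow> nat \<times> (nat \<times> move) list" where
  "next_of M q as =
     (if q = halt M then (q, map (\<lambda>c. (c, Stay)) as)
      else let (q', acts) = trans M q (map (\<lambda>c. c mod symbols M) as)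
        in (q', map2 (\<lambda>(b, d) c. (b + symbols M * (c div symbols M), d)) acts as))"

definition reads :: "tm \<Rightarrow> tape list \<Rightarrow> nat list" where
  "reads M ts = map (\<lambda>T. code (symbols M) T 0) ts"

definition config_ok :: "tm \<Rightarrow> config \<Rightarrow> bool" where
  "config_ok M c \<longleftrightarrow> fst c < states M \<and> length (snd c) = tapes M \<and>
     (\<forall>T\<in>set (snd c). \<forall>i. fst T i < symbols M)"

lemma code_mod_div:
  assumes "\<forall>i. fst T i < S"
  shows "code S T d < 2 * S" "code S T d mod S = fst T (snd T + d)"
    "code S T d div S = (if snd T + d = 0 then 1 else 0)"
proof -
  have *: "fst T (snd T + d) < S"
    using assms by simp
  then show "code S T d < 2 * S" "code S T d mod S = fst T (snd T + d)"
    "code S T d div S = (if snd T + d = 0 then 1 else 0)"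
    by (auto simp: code_def)
qed

lemma code_act:
  "code S (act p T) e = (if e + shift (snd p) = 0 then fst p + (if snd T = 0 then S else 0)
     else code S T (e + shift (snd p)))"
  by (cases T; cases p) (auto simp: code_def algebra_simps)

lemma step_next:
  assumes M: "tm_wf M" and ok: "config_ok M (q, ts)" and nx: "next_of M q (reads M ts) = (q', acts)"
  obtains ts' where "step M (q, ts) = (q', ts')" "config_ok M (q', ts')" "length acts = tapes M"
    "\<And>j. j < tapes M \<Longrightarrow> \<bar>snd (ts' ! j)\<bar> \<le> \<bar>snd (ts ! j)\<bar> + 1"
    "\<And>j e. j < tapes M \<Longrightarrow> code (symbols M) (ts' ! j) e =
       (if e + shift (snd (acts ! j)) = 0 then fst (acts ! j)
        else code (symbols M) (ts ! j) (e + shift (snd (acts ! j))))"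
proof -
  let ?S = "symbols M"
  have len: "length ts = tapes M" and q: "q < states M"
    and sym: "\<And>j i. j < tapes M \<Longrightarrow> fst (ts ! j) i < ?S"
    using ok by (auto simp: config_ok_def)
  show ?thesis
  proof (cases "q = halt M")
    case True
    then have "q' = q" "acts = map (\<lambda>T. (code ?S T 0, Stay)) ts"
      using nx by (auto simp: next_of_def reads_def)
    then show ?thesis
      using True ok len by (intro that[of ts]) auto
  next
    case False
    have rd: "map (\<lambda>c. c mod ?S) (reads M ts) = map (\<lambda>(t, h). t h) ts"
      using sym len by (intro nth_equalityI) (auto simp: reads_def code_mod_div split: prod.splits)
    obtain acts' where t: "trans M q (map (\<lambda>(t, h). t h) ts) = (q', acts')"
      and acts: "acts = map2 (\<lambda>(b, d) c. (b + ?S * (c div ?S), d)) acts' (reads M ts)"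
      using nx False by (auto simp: next_of_def rd split: prod.splits)
    have "set (map (\<lambda>(t, h). t h) ts) \<subseteq> {..<?S}"
      using ok by (auto simp: config_ok_def)
    then have wf: "q' < states M" "length acts' = tapes M" "fst ` set acts' \<subseteq> {..<?S}"
      using M q t len unfolding tm_wf_def by (metis length_map)+
    define ts' where "ts' = map2 act acts' ts"
    have nth: "ts' ! j = act (acts' ! j) (ts ! j)"
      "acts ! j = (fst (acts' ! j) + ?S * (code ?S (ts ! j) 0 div ?S), snd (acts' ! j))"
      if "j < tapes M" for j
      using that wf len by (auto simp: ts'_def acts reads_def split: prod.splits)
    have less: "fst (acts' ! j) < ?S" if "j < tapes M" for j
      using wf that by (metis image_subset_iff lessThan_iff nth_mem)
    show ?thesis
    proof (rule that[of ts'])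
      show "step M (q, ts) = (q', ts')"
        using False t by (simp add: ts'_def)
      show "length acts = tapes M"
        using wf len by (simp add: acts reads_def)
      have "fst (ts' ! j) i < ?S" if "j < tapes M" for i j
        using nth(1)[OF that] less[OF that] sym[OF that] by (cases "ts ! j"; cases "acts' ! j") auto
      moreover have "length ts' = tapes M"
        using wf len by (simp add: ts'_def)
      ultimately show "config_ok M (q', ts')"
        using wf(1) unfolding config_ok_def by (metis fst_conv in_set_conv_nth snd_conv)
      show "\<bar>snd (ts' ! j)\<bar> \<le> \<bar>snd (ts ! j)\<bar> + 1" if "j < tapes M" for j
        using nth(1)[OF that] by (cases "ts ! j"; cases "acts' ! j"; cases "snd (acts' ! j)") auto
      show "code ?S (ts' ! j) e =
       (if e + shift (snd (acts ! j)) = 0 then fst (acts ! j)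
        else code ?S (ts ! j) (e + shift (snd (acts ! j))))" if "j < tapes M" for j e
        using code_mod_div(3)[of "ts ! j" ?S 0] sym[OF that]
        by (simp add: nth[OF that] code_act del: act.simps)
    qed
  qed
qed

section \<open>Patterns of rules, instantiated at times and cells\<close>

datatype base = Zero | Time | Cell | Full | Posn

text \<open>A place \<open>(b, e)\<close> stands for the number \<open>L b + e\<close>. Times are counted backwards: the moment at
  which \<open>r\<close> steps remain is written as \<open>r + 1\<close>, so that \<open>(Time, 1)\<close> is the present and \<open>(Time, 0)\<close>
  the next moment if \<open>Time\<close> stands for the number of remaining steps.\<close>

type_synonym place = "base \<times> nat"
type_synonym rule_scheme = "(bool \<times> tag \<times> place \<times> place) \<times> (bool \<times> tag \<times> place \<times> place) \<times>
  (bool \<times> tag \<times> place \<times> place)"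

fun inst_lit :: "(base \<Rightarrow> nat) \<Rightarrow> bool \<times> tag \<times> place \<times> place \<Rightarrow> lit" where
  "inst_lit L (s, g, (b, e), (b', e')) = (s, g, L b + e, L b' + e')"

fun inst :: "(base \<Rightarrow> nat) \<Rightarrow> rule_scheme \<Rightarrow> rule" where
  "inst L (a, b, c) = (inst_lit L a, inst_lit L b, inst_lit L c)"

text \<open>In a Horn rule the sign \<open>False\<close> marks a premise and \<open>True\<close> the
  conclusion.\<close>

definition p_cur :: "nat \<Rightarrow> nat list \<Rightarrow> bool \<times> tag \<times> place \<times> place" where
  "p_cur q as = (False, PT q as, (Time, 1), (Zero, 0))"

definition x_cur :: "nat \<Rightarrow> bool \<Rightarrow> nat \<Rightarrow> place \<Rightarrow> bool \<times> tag \<times> place \<times> place" where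
  "x_cur j d a p = (False, XT j d a, (Time, 1), p)"

definition x_next :: "nat \<Rightarrow> bool \<Rightarrow> nat \<Rightarrow> place \<Rightarrow> bool \<times> tag \<times> place \<times> place" where
  "x_next j d a p = (True, XT j d a, (Time, 0), p)"

definition x_init :: "nat \<Rightarrow> bool \<Rightarrow> nat \<Rightarrow> place \<Rightarrow> bool \<times> tag \<times> place \<times> place" where
  "x_init j d a p = (True, XT j d a, (Full, 1), p)"

text \<open>A transition depends on all tapes at once, but a clause has only three literals. Hence
  the codes under the heads are collected tape by tape in the second argument of
  \<open>PT\<close>.\<close>

definition read_rule :: "nat \<Rightarrow> nat list \<Rightarrow> nat \<Rightarrow> rule_scheme" where
  "read_rule q as a = (p_cur q as, x_cur (length as) True a (Zero, 1),
     (True, PT q (as @ [a]), (Time, 1), (Zero, 0)))"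

definition state_rule :: "tm \<Rightarrow> nat \<Rightarrow> nat list \<Rightarrow> rule_scheme" where
  "state_rule M q as = (p_cur q as, p_cur q as,
     (True, PT (fst (next_of M q as)) [], (Time, 0), (Zero, 0)))"

text \<open>The cell written was under the head, at \<open>(True, 1)\<close>, and is found at its
  new address afterwards. A premise is repeated where a rule would have fewer than three
  literals.\<close>

definition write_rule :: "tm \<Rightarrow> nat \<Rightarrow> nat list \<Rightarrow> nat \<Rightarrow> rule_scheme" where
  "write_rule M q as j = (let (c, m) = snd (next_of M q as) ! j; (d, n) = mv m (True, 1)
     in (p_cur q as, p_cur q as, x_next j d c (Zero, n)))"

text \<open>Cells at distance \<open>i + 1\<close> with \<open>i \<ge> 1\<close> keep their side, so
  their new distance is \<open>i\<close> plus a constant. The left neighbour of the head may cross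
  to the right and has a rule of its own; the cell under the head is left to
  \<open>write_rule\<close>.\<close>

definition move_rules :: "tm \<Rightarrow> nat \<Rightarrow> nat list \<Rightarrow> nat \<Rightarrow> nat \<Rightarrow> rule_scheme list" where
  "move_rules M q as j a = (let m = snd (snd (next_of M q as) ! j); (d, n) = mv m (False, 1) in
     [(p_cur q as, x_cur j True a (Cell, 1), x_next j True a (Cell, nat (1 - shift m))),
      (p_cur q as, x_cur j False a (Cell, 1), x_next j False a (Cell, nat (1 + shift m))),
      (p_cur q as, x_cur j False a (Zero, 1), x_next j d a (Zero, n))])"

definition codes :: "tm \<Rightarrow> nat list" where
  "codes M = [0..<2 * symbols M]"

definition step_rules :: "tm \<Rightarrow> rule_scheme list" where
  "step_rules M = concat (map (\<lambda>q.
     concat (map (\<lambda>l. concat (map (\<lambda>as. map (read_rule q as) (codes M)) (List.n_lists l (codes M))))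
       [0..<tapes M]) @
     concat (map (\<lambda>as. state_rule M q as # concat (map (\<lambda>j. write_rule M q as j #
       concat (map (move_rules M q as j) (codes M))) [0..<tapes M])) (List.n_lists (tapes M) (codes M))))
     [0..<states M])"

text \<open>At the start, everything beyond an unmarked blank is blank, so blanks spread outwards
  from a single one.\<close>

definition blank_rule :: "nat \<Rightarrow> bool \<Rightarrow> rule_scheme" where
  "blank_rule j d = (let l = (False, XT j d 0, (Full, 1), (Cell, 0))
     in (l, l, x_init j d 0 (Cell, 1)))"

definition unit_rule :: "bool \<times> tag \<times> place \<times> place \<Rightarrow> rule_scheme" where
  "unit_rule l = (l, l, l)"

text \<open>At the end, the origin of the last tape must not carry the symbol 1, i.e. the output \<open>0\<close>.\<close>

definition accept_rule :: "tm \<Rightarrow> bool \<Rightarrow> rule_scheme" where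
  "accept_rule M d = unit_rule (False, XT (tapes M - 1) d (1 + symbols M), (Zero, 1), (Cell, 0))"

definition cell_rules :: "tm \<Rightarrow> rule_scheme list" where
  "cell_rules M = accept_rule M True # accept_rule M False #
     concat (map (\<lambda>j. [blank_rule j True, blank_rule j False]) [0..<tapes M])"

text \<open>On the tapes other than the input tape the head stands on a blank origin, whose code is
  \<open>symbols M\<close> because of the mark; the first unmarked blank to the right has distance
  2.\<close>

definition start_rules :: "tm \<Rightarrow> rule_scheme list" where
  "start_rules M = unit_rule (True, PT (start M) [], (Full, 1), (Zero, 0)) #
     map (\<lambda>j. unit_rule (x_init j False 0 (Zero, 1))) [0..<tapes M] @
     concat (map (\<lambda>j. [unit_rule (x_init j True (symbols M) (Zero, 1)),
       unit_rule (x_init j True 0 (Zero, 2))]) [1..<tapes M])"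

definition input_code :: "tm \<Rightarrow> bool \<Rightarrow> nat \<Rightarrow> nat" where
  "input_code M b i = (if b then 2 else 1) + (if i = 0 then symbols M else 0)"

definition input_rule :: "tm \<Rightarrow> bool \<Rightarrow> nat \<Rightarrow> rule_scheme" where
  "input_rule M b i = unit_rule (x_init 0 True (input_code M b i) (Posn, 1))"

text \<open>The one rule with different positive literals: a certificate cell is blank or a bit. As
  blanks spread, the first of them ends the certificate, so all lengths up to \<open>m\<close> are
  covered.\<close>

definition guess_rule :: rule_scheme where
  "guess_rule = (x_init 0 True 0 (Posn, 1), x_init 0 True 1 (Posn, 1), x_init 0 True 2 (Posn, 1))"

definition end_rule :: rule_scheme where
  "end_rule = unit_rule (x_init 0 True 0 (Posn, 1))"

definition env :: "nat \<Rightarrow> nat \<Rightarrow> nat \<Rightarrow> nat \<Rightarrow> base \<Rightarrow> nat" where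
  "env \<tau> i T p b = (case b of Zero \<Rightarrow> 0 | Time \<Rightarrow> \<tau> | Cell \<Rightarrow> i | Full \<Rightarrow> T | Posn \<Rightarrow> p)"

lemma env_simps [simp]: "env \<tau> i T p Zero = 0" "env \<tau> i T p Time = \<tau>" "env \<tau> i T p Cell = i"
  "env \<tau> i T p Full = T" "env \<tau> i T p Posn = p"
  by (simp_all add: env_def)

text \<open>\<open>pair x []\<close> is the part of the input known in advance, a prefix of every
  \<open>pair x u\<close>. Times and cells run downwards because the loops of the printing program
  do.\<close>

definition rule_list :: "tm \<Rightarrow> bool list \<Rightarrow> nat \<Rightarrow> nat \<Rightarrow> nat \<Rightarrow> rule list" where
  "rule_list M x m T W =
     concat (map (\<lambda>\<tau>. concat (map (\<lambda>i. map (inst (env \<tau> i T 0)) (step_rules M)) (rev [1..<Suc W])))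
       (rev [1..<Suc T])) @
     concat (map (\<lambda>i. map (inst (env 0 i T 0)) (cell_rules M)) (rev [1..<Suc W])) @
     map (inst (env 0 0 T 0)) (start_rules M) @
     map (\<lambda>i. inst (env 0 0 T i) (input_rule M (pair x [] ! i) i)) [0..<2 * length x + 2] @
     map (\<lambda>i. inst (env 0 0 T i) guess_rule) [2 * length x + 2..<2 * length x + 2 + m] @
     [inst (env 0 0 T (2 * length x + 2 + m)) end_rule]"

section \<open>The run of the verifier in head-relative terms\<close>

lemma length_pair: "length (pair x u) = 2 * length x + 2 + length u"
  by (induction x) (auto simp: pair_def)

lemma pair_append: "pair x u = pair x [] @ u"
  by (simp add: pair_def)

abbreviation conf :: "tm \<Rightarrow> bool list \<Rightarrow> nat \<Rightarrow> config" where
  "conf M w t \<equiv> (step M ^^ t) (init M w)"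

text \<open>The bound on head positions keeps each origin within distance \<open>t + 1\<close> of
  its head, where \<open>accept_rule\<close> has to meet it.\<close>

lemma conf_invariant:
  assumes M: "tm_wf M"
  shows "config_ok M (conf M w t) \<and> (\<forall>j<tapes M. \<bar>snd (snd (conf M w t) ! j)\<bar> \<le> int t)"
proof (induction t)
  case 0
  have "written w i < 3" for i
    by (simp add: written_def)
  then show ?case
    using M by (auto simp: config_ok_def init_def tm_wf_def nth_Cons' intro: order_less_le_trans)
next
  case (Suc t)
  obtain q ts where c: "conf M w t = (q, ts)"
    by fastforce
  obtain q' acts where n: "next_of M q (reads M ts) = (q', acts)"
    by fastforce
  have "config_ok M (q, ts)"
    using Suc c by simp
  from step_next[OF M this n] obtain ts' where "step M (q, ts) = (q', ts')" "config_ok M (q', ts')"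
    "\<And>j. j < tapes M \<Longrightarrow> \<bar>snd (ts' ! j)\<bar> \<le> \<bar>snd (ts ! j)\<bar> + 1"
    by metis
  then show ?case
    using Suc c by fastforce
qed

definition cell_at :: "tm \<Rightarrow> bool list \<Rightarrow> nat \<Rightarrow> nat \<Rightarrow> bool \<times> nat \<Rightarrow> nat" where
  "cell_at M w t j p = code (symbols M) (snd (conf M w t) ! j) (off p)"

definition reads_at :: "tm \<Rightarrow> bool list \<Rightarrow> nat \<Rightarrow> nat list" where
  "reads_at M w t = reads M (snd (conf M w t))"

definition acts_at :: "tm \<Rightarrow> bool list \<Rightarrow> nat \<Rightarrow> (nat \<times> move) list" where
  "acts_at M w t = snd (next_of M (fst (conf M w t)) (reads_at M w t))"

lemma
  assumes M: "tm_wf M"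
  shows reads_at: "length (reads_at M w t) = tapes M" "set (reads_at M w t) \<subseteq> set (codes M)"
      "\<And>j. j < tapes M \<Longrightarrow> reads_at M w t ! j = cell_at M w t j (True, 1)"
    and cell_at_less: "\<And>j p. j < tapes M \<Longrightarrow> cell_at M w t j p \<in> set (codes M)"
proof -
  have *: "config_ok M (conf M w t)"
    using conf_invariant[OF M] by blast
  then have len: "length (snd (conf M w t)) = tapes M"
    by (simp add: config_ok_def)
  show "cell_at M w t j p \<in> set (codes M)" if "j < tapes M" for j p
    using that * code_mod_div(1) by (auto simp: cell_at_def codes_def config_ok_def)
  then show "length (reads_at M w t) = tapes M" "set (reads_at M w t) \<subseteq> set (codes M)"
      "\<And>j. j < tapes M \<Longrightarrow> reads_at M w t ! j = cell_at M w t j (True, 1)"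
    using len * code_mod_div(1)
    by (auto simp: reads_at_def reads_def cell_at_def codes_def config_ok_def)
qed

lemma conf_Suc:
  assumes M: "tm_wf M"
  shows "fst (conf M w (Suc t)) = fst (next_of M (fst (conf M w t)) (reads_at M w t))"
    and "j < tapes M \<Longrightarrow>
      cell_at M w (Suc t) j (mv (snd (acts_at M w t ! j)) (True, 1)) = fst (acts_at M w t ! j)"
    and "j < tapes M \<Longrightarrow> snd p \<ge> 1 \<Longrightarrow> p \<noteq> (True, 1) \<Longrightarrow>
      cell_at M w (Suc t) j (mv (snd (acts_at M w t ! j)) p) = cell_at M w t j p"
proof -
  obtain q ts where c: "conf M w t = (q, ts)"
    by fastforce
  obtain q' acts where n: "next_of M q (reads M ts) = (q', acts)"
    by fastforce
  have "config_ok M (q, ts)"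
    using conf_invariant[OF M, where w = w and t = t] c by simp
  from step_next[OF M this n] obtain ts' where s: "step M (q, ts) = (q', ts')"
    "\<And>j e. j < tapes M \<Longrightarrow> code (symbols M) (ts' ! j) e =
       (if e + shift (snd (acts ! j)) = 0 then fst (acts ! j)
        else code (symbols M) (ts ! j) (e + shift (snd (acts ! j))))"
    by metis
  have acts: "acts_at M w t = acts"
    by (simp add: acts_at_def reads_at_def c n)
  show "fst (conf M w (Suc t)) = fst (next_of M (fst (conf M w t)) (reads_at M w t))"
    using c s n by (simp add: reads_at_def)
  show "cell_at M w (Suc t) j (mv (snd (acts_at M w t ! j)) (True, 1)) = fst (acts_at M w t ! j)"
    if "j < tapes M"
    using c s that by (simp add: cell_at_def acts off_mv)
  have "off p \<noteq> 0" if "snd p \<ge> 1" "p \<noteq> (True, 1)"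
    using that by (cases p rule: off.cases) auto
  then show "cell_at M w (Suc t) j (mv (snd (acts_at M w t ! j)) p) = cell_at M w t j p"
    if "j < tapes M" "snd p \<ge> 1" "p \<noteq> (True, 1)"
    using c s that by (simp add: cell_at_def acts off_mv)
qed

lemma cell_at_0:
  assumes "tm_wf M" "n \<ge> 1"
  shows "cell_at M w 0 0 (True, n) = (if n - 1 < length w then input_code M (w ! (n - 1)) (n - 1)
      else if n = 1 then symbols M else 0)"
    and "0 < j \<Longrightarrow> j < tapes M \<Longrightarrow> cell_at M w 0 j (True, n) = (if n = 1 then symbols M else 0)"
    and "j < tapes M \<Longrightarrow> cell_at M w 0 j (False, n) = 0"
proof -
  have "nat (int n - 1) = n - 1"
    by simp
  then show "cell_at M w 0 0 (True, n) = (if n - 1 < length w then input_code M (w ! (n - 1)) (n - 1)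
      else if n = 1 then symbols M else 0)"
    using assms by (auto simp: cell_at_def init_def code_def written_def input_code_def)
  show "0 < j \<Longrightarrow> j < tapes M \<Longrightarrow> cell_at M w 0 j (True, n) = (if n = 1 then symbols M else 0)"
    using assms by (auto simp: cell_at_def init_def code_def written_def nth_Cons')
  show "j < tapes M \<Longrightarrow> cell_at M w 0 j (False, n) = 0"
    using assms by (auto simp: cell_at_def init_def code_def written_def nth_Cons')
qed

lemma conf_halted:
  assumes "outputs_within M w y T"
  shows "fst (last (snd (conf M w T))) = written y"
proof -
  obtain n ts where n: "n \<le> T" "conf M w n = (halt M, ts)" "fst (last ts) = written y"
    using assms unfolding outputs_within_def by blast
  have "conf M w (n + i) = (halt M, ts)" for i
    using n by (induction i) auto
  from this[of "T - n"] show ?thesis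
    using n by simp
qed

lemma step_rules_iff:
  "(\<forall>r\<in>set (step_rules M). Q r) \<longleftrightarrow>
     (\<forall>q\<in>{..<states M}. (\<forall>l\<in>{..<tapes M}. \<forall>as. length as = l \<and> set as \<subseteq> set (codes M) \<longrightarrow>
         (\<forall>a\<in>set (codes M). Q (read_rule q as a))) \<and>
       (\<forall>as. length as = tapes M \<and> set as \<subseteq> set (codes M) \<longrightarrow> Q (state_rule M q as) \<and>
         (\<forall>j\<in>{..<tapes M}. Q (write_rule M q as j) \<and>
           (\<forall>a\<in>set (codes M). \<forall>r\<in>set (move_rules M q as j a). Q r))))"
  unfolding step_rules_def by (simp add: set_n_lists ball_Un atLeast0LessThan)

lemma start_rules_iff:
  "(\<forall>r\<in>set (start_rules M). Q r) \<longleftrightarrow>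
     Q (unit_rule (True, PT (start M) [], (Full, 1), (Zero, 0))) \<and>
     (\<forall>j<tapes M. Q (unit_rule (x_init j False 0 (Zero, 1)))) \<and>
     (\<forall>j\<in>{1..<tapes M}. Q (unit_rule (x_init j True (symbols M) (Zero, 1))) \<and>
       Q (unit_rule (x_init j True 0 (Zero, 2))))"
  unfolding start_rules_def by auto

lemma rule_list_iff:
  "(\<forall>r\<in>set (rule_list M x m T W). Q r) \<longleftrightarrow>
     (\<forall>\<tau>\<in>{1..T}. \<forall>i\<in>{1..W}. \<forall>r\<in>set (step_rules M). Q (inst (env \<tau> i T 0) r)) \<and>
     (\<forall>i\<in>{1..W}. \<forall>r\<in>set (cell_rules M). Q (inst (env 0 i T 0) r)) \<and>
     (\<forall>r\<in>set (start_rules M). Q (inst (env 0 0 T 0) r)) \<and>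
     (\<forall>i\<in>{..<2 * length x + 2}. Q (inst (env 0 0 T i) (input_rule M (pair x [] ! i) i))) \<and>
     (\<forall>i\<in>{2 * length x + 2..<2 * length x + 2 + m}. Q (inst (env 0 0 T i) guess_rule)) \<and>
     Q (inst (env 0 0 T (2 * length x + 2 + m)) end_rule)"
proof -
  define b where "b = 2 * length x + 2"
  show ?thesis
    unfolding rule_list_def b_def[symmetric]
    by (simp add: atLeastLessThanSuc_atLeastAtMost atLeast0LessThan ball_Un conj_ac del: upt_Suc)
qed

section \<open>Facts forced by the rules, and the equivalence with acceptance\<close>

lemma mv_inner:
  assumes "n \<ge> 1"
  shows "mv m (True, Suc n) = (True, n + nat (1 - shift m))"
    "mv m (False, Suc n) = (False, n + nat (1 + shift m))"
  using assms by (cases m; simp)+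

text \<open>A cell comes from at most one place further out; this is the loss of one cell of the
  window per step.\<close>

lemma mv_surj:
  assumes "n \<ge> 1"
  obtains p where "snd p \<ge> 1" "snd p \<le> Suc n" "mv m p = (d, n)"
proof (cases m)
  case Stay
  then show ?thesis using assms that[of "(d, n)"] by simp
next
  case Rgt
  show ?thesis
  proof (cases "d \<or> n = 1")
    case True
    then show ?thesis using Rgt assms that[of "(True, if d then n + 1 else 1)"] by (cases d) auto
  next
    case False
    then show ?thesis using Rgt assms that[of "(False, n - 1)"] by auto
  qed
next
  case Lft
  show ?thesis
  proof (cases "\<not> d \<or> n = 1")
    case True
    then show ?thesis using Lft assms that[of "(False, if d then 1 else n + 1)"] by (cases d) auto
  next
    case False
    then show ?thesis using Lft assms that[of "(True, n - 1)"] by auto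
  qed
qed

lemma facts_step:
  assumes M: "tm_wf M" and A: "\<forall>r\<in>set (rule_list M x m T W). rsat A r" and t: "t < T" "T < W"
    and state: "A (PT (fst (conf M w t)) [], T - t + 1, 0)"
    and cells: "\<And>j d n. j < tapes M \<Longrightarrow> 1 \<le> n \<Longrightarrow> n \<le> W + 1 - t \<Longrightarrow>
      A (XT j d (cell_at M w t j (d, n)), T - t + 1, n)"
  shows "A (PT (fst (conf M w (Suc t))) [], T - t, 0)"
    and "\<And>j d n. j < tapes M \<Longrightarrow> 1 \<le> n \<Longrightarrow> n \<le> W - t \<Longrightarrow>
      A (XT j d (cell_at M w (Suc t) j (d, n)), T - t, n)"
proof -
  let ?q = "fst (conf M w t)" and ?as = "reads_at M w t" and ?k = "tapes M"
  have "config_ok M (conf M w t)"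
    using conf_invariant[OF M] by blast
  then have q: "?q < states M"
    by (simp add: config_ok_def)
  have rules: "\<forall>r\<in>set (step_rules M). rsat A (inst (env (T - t) i T 0) r)" if "1 \<le> i" "i \<le> W" for i
    using A that t unfolding rule_list_iff by auto
  have read: "rsat A (inst (env (T - t) i T 0) (read_rule ?q as a))"
    if "1 \<le> i" "i \<le> W" "set as \<subseteq> set (codes M)" "length as < ?k" "a \<in> set (codes M)" for i as a
    using rules[OF that(1,2)] that(3-) q unfolding step_rules_iff by blast
  have acts: "rsat A (inst (env (T - t) i T 0) (state_rule M ?q ?as))"
    "j < ?k \<Longrightarrow> rsat A (inst (env (T - t) i T 0) (write_rule M ?q ?as j))"
    "j < ?k \<Longrightarrow> a \<in> set (codes M) \<Longrightarrow>
       \<forall>r\<in>set (move_rules M ?q ?as j a). rsat A (inst (env (T - t) i T 0) r)"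
    if "1 \<le> i" "i \<le> W" for i j a
    using rules[OF that] q reads_at(1,2)[OF M] unfolding step_rules_iff by blast+
  have W: "1 \<le> W"
    using t by simp
  \<comment> \<open>One \<open>read_rule\<close> per tape lengthens the known prefix of the codes
    under the heads.\<close>
  have "A (PT ?q (take l ?as), T - t + 1, 0)" if "l \<le> ?k" for l
    using that
  proof (induction l)
    case 0
    then show ?case using state by simp
  next
    case (Suc l)
    have len: "length ?as = ?k"
      using reads_at(1)[OF M] by simp
    have "set (take l ?as) \<subseteq> set (codes M)" "?as ! l \<in> set (codes M)"
      using reads_at(2)[OF M, of w t] Suc.prems len nth_mem[of l ?as] set_take_subset[of l ?as] by auto
    then have "rsat A (inst (env (T - t) 1 T 0) (read_rule ?q (take l ?as) (?as ! l)))"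
      using Suc.prems len W by (intro read) auto
    moreover have "A (XT l True (?as ! l), T - t + 1, 1)"
      using cells[of l 1 True] Suc.prems t reads_at(3)[OF M, of l w t] by simp
    ultimately show ?case
      using Suc len by (simp add: read_rule_def p_cur_def x_cur_def take_Suc_conv_app_nth)
  qed
  from this[of ?k] have P: "A (PT ?q ?as, Suc (T - t), 0)"
    using reads_at(1)[OF M] by simp
  show "A (PT (fst (conf M w (Suc t))) [], T - t, 0)"
    using acts(1)[of 1] W P
    by (simp add: state_rule_def p_cur_def conf_Suc(1)[OF M] del: funpow.simps)
  fix j d n
  assume j: "j < ?k" and n: "1 \<le> n" "n \<le> W - t"
  define c mo where "c = fst (acts_at M w t ! j)" and "mo = snd (acts_at M w t ! j)"
  have act: "snd (next_of M ?q ?as) ! j = (c, mo)"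
    by (simp add: c_def mo_def acts_at_def)
  obtain p where p: "snd p \<ge> 1" "snd p \<le> Suc n" "mv mo p = (d, n)"
    using mv_surj[OF n(1)] by blast
  show "A (XT j d (cell_at M w (Suc t) j (d, n)), T - t, n)"
  \<comment> \<open>The cell was under the head, directly to its left, or further away. The patterns
    for the first two do not mention \<open>Cell\<close>, so the instance at 1 serves; the third
    uses the instance at \<open>n'\<close>.\<close>
  proof (cases "p = (True, 1)")
    case True
    then have "cell_at M w (Suc t) j (d, n) = c"
      using conf_Suc(2)[OF M j, of w t] p by (simp add: c_def mo_def)
    then show ?thesis
      using acts(2)[of 1 j] W j P p True
      by (simp add: write_rule_def act p_cur_def x_next_def)
  next
    case False
    let ?a = "cell_at M w t j p"
    have eq: "cell_at M w (Suc t) j (d, n) = ?a"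
      using conf_Suc(3)[OF M j p(1) False, of w t] p(3) by (simp add: mo_def)
    have a: "?a \<in> set (codes M)"
      using cell_at_less[OF M j] .
    obtain e n' where p': "p = (e, Suc n')"
      using p(1) by (cases p; cases "snd p") auto
    have X: "A (XT j e ?a, Suc (T - t), Suc n')"
      using cells[OF j, of "Suc n'" e] p p' n by simp
    obtain d1 n1 where mv1: "mv mo (False, 1) = (d1, n1)"
      by fastforce
    note r = acts(3)[OF _ _ j a, unfolded move_rules_def act Let_def snd_conv mv1 prod.case]
    show ?thesis
    proof (cases "n' = 0")
      case True
      then have e: "e = False"
        using False p' by simp
      show ?thesis
        using r[of 1] mv1 p W P X eq p' True e
        by (simp add: p_cur_def x_cur_def x_next_def)
    next
      case n': False
      then have "n' \<le> W" "1 \<le> n'"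
        using p p' n by auto
      then show ?thesis
        using r[of n'] p P X eq p' mv_inner[of n' mo]
        by (cases e) (simp_all add: p_cur_def x_cur_def x_next_def)
    qed
  qed
qed

text \<open>The certificate extends to the first certificate position that is blank in
  \<open>A\<close>, which exists because of \<open>end_rule\<close>. Before it
  \<open>guess_rule\<close> forces a bit; if both bits hold, \<open>u\<close> takes
  \<open>True\<close>, and the fact required for it holds as well.\<close>

lemma facts_start:
  assumes M: "tm_wf M" and A: "\<forall>r\<in>set (rule_list M x m T W). rsat A r"
  obtains u where "length u \<le> m" "A (PT (fst (conf M (pair x u) 0)) [], T + 1, 0)"
    "\<And>j d n. j < tapes M \<Longrightarrow> 1 \<le> n \<Longrightarrow> n \<le> W + 1 \<Longrightarrow>
      A (XT j d (cell_at M (pair x u) 0 j (d, n)), T + 1, n)"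
proof -
  let ?X = "\<lambda>j d a n. A (XT j d a, Suc T, n)"
  let ?b = "2 * length x + 2"
  have start: "\<forall>r\<in>set (start_rules M). rsat A (inst (env 0 0 T 0) r)"
    and input: "\<forall>i\<in>{..<?b}. rsat A (inst (env 0 0 T i) (input_rule M (pair x [] ! i) i))"
    and guess: "\<forall>i\<in>{?b..<?b + m}. rsat A (inst (env 0 0 T i) guess_rule)"
    and e: "rsat A (inst (env 0 0 T (?b + m)) end_rule)"
    using A unfolding rule_list_iff by blast+
  have "end": "?X 0 True 0 (Suc (?b + m))"
    using e by (simp add: end_rule_def unit_rule_def x_init_def)
  have blank: "?X j d 0 n" if "?X j d 0 n0" "n0 \<ge> 1" "n0 \<le> n" "n \<le> W + 1" "j < tapes M" for j d n0 n
    using that(3,4)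
  proof (induction n rule: dec_induct)
    case base
    then show ?case using that by simp
  next
    case (step n)
    have "rsat A (inst (env 0 n T 0) (blank_rule j d))"
      using A that step unfolding rule_list_iff by (cases d) (auto simp: cell_rules_def)
    then show ?case
      using step by (simp add: blank_rule_def x_init_def Let_def)
  qed
  have L: "?X j False 0 1" if "j < tapes M" for j
    using start that unfolding start_rules_iff by (auto simp: unit_rule_def x_init_def)
  have R: "?X j True (symbols M) 1" "?X j True 0 2" if "0 < j" "j < tapes M" for j
    using start that unfolding start_rules_iff
    by (auto simp: unit_rule_def x_init_def numeral_2_eq_2)
  define Y where "Y l = ?X 0 True 0 (Suc (?b + l))" for l
  define l where "l = (LEAST l. Y l)"
  have "Y m"
    using "end" by (simp add: Y_def)
  then have "Y l" "l \<le> m"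
    unfolding l_def by (rule LeastI, rule Least_le)
  moreover have "\<not> Y i" if "i < l" for i
    using that unfolding l_def by (rule not_less_Least)
  ultimately have l: "?X 0 True 0 (Suc (?b + l))" "l \<le> m"
    "\<And>i. i < l \<Longrightarrow> \<not> ?X 0 True 0 (Suc (?b + i))"
    unfolding Y_def by blast+
  define u where "u = map (\<lambda>i. ?X 0 True 2 (Suc (?b + i))) [0..<l]"
  have len: "length (pair x u) = ?b + l"
    by (simp add: length_pair u_def)
  have in_x: "pair x u ! i = pair x [] ! i" if "i < ?b" for i
    using that by (subst pair_append) (simp add: nth_append length_pair)
  have in_u: "pair x u ! (?b + i) = u ! i" for i
    by (subst pair_append) (simp add: nth_append length_pair)
  have input_cells: "?X 0 True (input_code M (pair x u ! i) i) (Suc i)" if "i < length (pair x u)" for i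
  proof (cases "i < ?b")
    case True
    then show ?thesis
      using input in_x by (simp add: input_rule_def unit_rule_def x_init_def)
  next
    case False
    define i' where "i' = i - ?b"
    then have i': "i = ?b + i'" "i' < l"
      using that len False by auto
    have "rsat A (inst (env 0 0 T i) guess_rule)"
      using guess i' l(2) by auto
    then show ?thesis
      using l(3)[OF i'(2)] i' in_u[of i']
      by (auto simp: guess_rule_def x_init_def u_def input_code_def)
  qed
  have k: "0 < tapes M"
    using M by (simp add: tm_wf_def)
  show ?thesis
  proof (rule that[of u])
    show "length u \<le> m"
      using l by (simp add: u_def)
    show "A (PT (fst (conf M (pair x u) 0)) [], T + 1, 0)"
      using start unfolding start_rules_iff by (auto simp: unit_rule_def init_def)
    fix j d n
    assume j: "j < tapes M" and n: "1 \<le> n" "n \<le> W + 1"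
    show "A (XT j d (cell_at M (pair x u) 0 j (d, n)), T + 1, n)"
    proof (cases d)
      case False
      then show ?thesis
        using blank[OF L] j n cell_at_0(3)[OF M n(1) j] by simp
    next
      case d: True
      show ?thesis
      proof (cases "j = 0")
        case True
        have "n - 1 < length (pair x u)" if "n = 1"
          using that by (simp add: length_pair)
        moreover have "?X 0 True 0 n" if "\<not> n - 1 < length (pair x u)"
          using blank[OF l(1) _ _ n(2) k] that len by simp
        ultimately show ?thesis
          using input_cells[of "n - 1"] n d True cell_at_0(1)[OF M n(1), of "pair x u"] by auto
      next
        case False
        then show ?thesis
          using R[of j] blank[OF R(2), of j n] j n d cell_at_0(2)[OF M n(1), of j] by (cases "n = 1") auto
      qed
    qed
  qed
qed

text \<open>The mark finds the output: as \<open>symbols M \<ge> 3\<close>, an unmarked cell of a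
  tape containing \<open>[b]\<close> cannot have the code \<open>1 + symbols M\<close>.\<close>

lemma output_cell:
  assumes M: "tm_wf M" and out: "outputs_within M w [b] T"
  obtains d n where "1 \<le> n" "n \<le> T + 1"
    "cell_at M w T (tapes M - 1) (d, n) = (if b then 2 else 1) + symbols M"
    "\<And>p. cell_at M w T (tapes M - 1) p = 1 + symbols M \<Longrightarrow> \<not> b"
proof -
  define U where "U = snd (conf M w T) ! (tapes M - 1)"
  have inv: "config_ok M (conf M w T)" "\<forall>j<tapes M. \<bar>snd (snd (conf M w T) ! j)\<bar> \<le> int T"
    using conf_invariant[OF M, where w = w and t = T] by auto
  have k: "tapes M > 0" "3 \<le> symbols M"
    using M by (auto simp: tm_wf_def)
  then have last: "last (snd (conf M w T)) = U"
    unfolding U_def using inv by (subst last_conv_nth) (auto simp: config_ok_def)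
  then have written: "fst U = written [b]"
    using conf_halted[OF out] by simp
  have h: "\<bar>snd U\<bar> \<le> int T"
    unfolding U_def using inv k by simp
  have cell: "cell_at M w T (tapes M - 1) p = code (symbols M) U (off p)" for p
    by (simp add: cell_at_def U_def)
  \<comment> \<open>The address of the origin as seen from a head at position
    \<open>snd U\<close>.\<close>
  define p where "p = (if snd U \<le> 0 then (True, nat (1 - snd U)) else (False, nat (snd U)))"
  have "off p = - snd U" "1 \<le> snd p" "snd p \<le> T + 1"
    using h by (auto simp: p_def)
  moreover have "cell_at M w T (tapes M - 1) p = (if b then 2 else 1) + symbols M"
    using \<open>off p = - snd U\<close> unfolding cell by (simp add: code_def written) (simp add: written_def)
  moreover have "\<not> b" if "cell_at M w T (tapes M - 1) p = 1 + symbols M" for p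
    using that k unfolding cell by (auto simp: code_def written written_def split: if_splits)
  ultimately show ?thesis
    using that[of "snd p" "fst p"] by auto
qed

text \<open>The window of cells whose contents are known shrinks by one in every step and must still
  contain the origin at the end; hence the bound on \<open>W\<close>.\<close>

theorem cook_levin:
  assumes M: "tm_wf M" and W: "2 * T < W"
    and out: "\<And>u. length u \<le> m \<Longrightarrow> outputs_within M (pair x u) [pair x u \<in> V] T"
  shows "(\<exists>A. \<forall>r\<in>set (rule_list M x m T W). rsat A r) \<longleftrightarrow> (\<exists>u. length u \<le> m \<and> pair x u \<in> V)"
proof
  assume "\<exists>A. \<forall>r\<in>set (rule_list M x m T W). rsat A r"
  then obtain A where A: "\<forall>r\<in>set (rule_list M x m T W). rsat A r" ..
  obtain u where u: "length u \<le> m" "A (PT (fst (conf M (pair x u) 0)) [], T + 1, 0)"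
    "\<And>j d n. j < tapes M \<Longrightarrow> 1 \<le> n \<Longrightarrow> n \<le> W + 1 \<Longrightarrow>
      A (XT j d (cell_at M (pair x u) 0 j (d, n)), T + 1, n)"
    using facts_start[OF M A] by blast
  let ?w = "pair x u" and ?k = "tapes M - 1"
  have facts: "A (PT (fst (conf M ?w t)) [], T - t + 1, 0) \<and>
    (\<forall>j d n. j < tapes M \<longrightarrow> 1 \<le> n \<longrightarrow> n \<le> W + 1 - t \<longrightarrow>
      A (XT j d (cell_at M ?w t j (d, n)), T - t + 1, n))" if "t \<le> T" for t
    using that
  proof (induction t)
    case 0
    then show ?case using u by simp
  next
    case (Suc t)
    have t: "t < T" "T < W" "T - Suc t + 1 = T - t"
      using Suc.prems W by auto
    show ?case
      unfolding t(3) using facts_step[OF M A t(1,2), of ?w] Suc by (auto simp del: funpow.simps)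
  qed
  obtain d n where out': "1 \<le> n" "n \<le> T + 1"
    "cell_at M ?w T ?k (d, n) = (if ?w \<in> V then 2 else 1) + symbols M"
    using output_cell[OF M out[OF u(1)]] by metis
  have "tapes M > 0"
    using M by (simp add: tm_wf_def)
  then have fact: "A (XT ?k d (cell_at M ?w T ?k (d, n)), 1, n)"
    using facts[of T, THEN conjunct2, rule_format, of ?k n d] out'(1,2) W by simp
  have "rsat A (inst (env 0 n T 0) (accept_rule M d))"
    using A out' W unfolding rule_list_iff by (cases d) (auto simp: cell_rules_def)
  then have "?w \<in> V"
    using fact out'(3) by (auto simp: accept_rule_def unit_rule_def split: if_splits)
  then show "\<exists>u. length u \<le> m \<and> pair x u \<in> V"
    using u(1) by blast
next
  assume "\<exists>u. length u \<le> m \<and> pair x u \<in> V"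
  then obtain u where u: "length u \<le> m" "pair x u \<in> V"
    by blast
  let ?w = "pair x u" and ?k = "tapes M" and ?b = "2 * length x + 2"
  \<comment> \<open>The facts of the run on \<open>?w\<close>. Since times are remaining steps plus
    one, time \<open>\<tau>\<close> belongs to the configuration after \<open>T + 1 - \<tau>\<close>
    steps.\<close>
  define A where "A = (\<lambda>(g, \<tau>, n). case g of
      PT q as \<Rightarrow> q = fst (conf M ?w (T + 1 - \<tau>)) \<and>
        as = take (length as) (reads_at M ?w (T + 1 - \<tau>))
    | XT j d a \<Rightarrow> a = cell_at M ?w (T + 1 - \<tau>) j (d, n))"
  have k: "0 < ?k" "symbols M \<ge> 3"
    using M by (auto simp: tm_wf_def)
  have out': "\<And>p. cell_at M ?w T (?k - 1) p \<noteq> 1 + symbols M"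
    using output_cell[OF M out[OF u(1)]] u(2) by metis
  have steps: "rsat A (inst (env \<tau> i T 0) r)"
    if "\<tau> \<in> {1..T}" "i \<in> {1..W}" "r \<in> set (step_rules M)" for \<tau> i r
  proof -
    define t where "t = T - \<tau>"
    have t: "T - \<tau> = t" "Suc T - \<tau> = Suc t"
      using that by (auto simp: t_def)
    have P: "p = fst (conf M ?w t) \<and> as = reads_at M ?w t"
      if "A (PT p as, Suc \<tau>, 0)" "length as = ?k" for p as
      using that by (simp add: A_def t reads_at(1)[OF M])
    have act: "next_of M (fst (conf M ?w t)) (reads_at M ?w t) =
        (fst (conf M ?w (Suc t)), acts_at M ?w t)"
      by (simp add: acts_at_def conf_Suc(1)[OF M] del: funpow.simps)
    have "\<forall>r\<in>set (step_rules M). rsat A (inst (env \<tau> i T 0) r)"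
      unfolding step_rules_iff
    proof (intro allI impI conjI ballI)
      fix q l a :: nat and as :: "nat list"
      assume "l \<in> {..<?k}" "length as = l \<and> set as \<subseteq> set (codes M)"
      then have *: "length as < ?k"
        by simp
      show "rsat A (inst (env \<tau> i T 0) (read_rule q as a))"
        using * reads_at(3)[OF M, of "length as" ?w t] reads_at(1)[OF M, of ?w t]
        by (auto simp: read_rule_def p_cur_def x_cur_def A_def t take_Suc_conv_app_nth)
    next
      fix q :: nat and as :: "nat list"
      assume "length as = ?k \<and> set as \<subseteq> set (codes M)"
      then have as: "length as = ?k"
        by simp
      show "rsat A (inst (env \<tau> i T 0) (state_rule M q as))"
        using P[OF _ as, of q] act
        by (auto simp: state_rule_def p_cur_def A_def t simp del: funpow.simps)
      fix j
      assume "j \<in> {..<?k}"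
      then have j: "j < ?k"
        by simp
      show "rsat A (inst (env \<tau> i T 0) (write_rule M q as j))"
        using P[OF _ as, of q] act conf_Suc(2)[OF M j, of ?w t]
        by (auto simp: write_rule_def p_cur_def x_next_def Let_def split: prod.splits
            simp del: funpow.simps) (auto simp: A_def t simp del: funpow.simps)
      fix a r
      assume r: "r \<in> set (move_rules M q as j a)"
      define mo where "mo = snd (acts_at M ?w t ! j)"
      have mv: "cell_at M ?w (Suc t) j (mv mo p) = cell_at M ?w t j p"
        if "snd p \<ge> 1" "p \<noteq> (True, 1)" for p
        using conf_Suc(3)[OF M j that] by (simp add: mo_def)
      show "rsat A (inst (env \<tau> i T 0) r)"
      proof (cases "A (PT q as, Suc \<tau>, 0)")
        case True
        have i: "i \<ge> 1"
          using \<open>i \<in> {1..W}\<close> by simp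
        note P[OF True as]
        then have "snd (snd (next_of M q as) ! j) = mo"
          using act by (simp add: mo_def)
        then show ?thesis
          using r mv[of "(True, Suc i)"] mv[of "(False, Suc i)"] mv[of "(False, 1)"] mv_inner[OF i, of mo] i
          by (auto simp: move_rules_def Let_def x_cur_def x_next_def A_def t split: prod.splits
              simp del: funpow.simps)
      next
        case False
        then show ?thesis
          using r by (auto simp: move_rules_def Let_def p_cur_def split: prod.splits)
      qed
    qed
    then show ?thesis
      using that(3) by blast
  qed
  have X: "A (XT j d a, T + 1, n) \<longleftrightarrow> cell_at M ?w 0 j (d, n) = a" for j d a n
    by (auto simp: A_def)
  have blank: "rsat A (inst (env 0 i T 0) (blank_rule j d))" if "j < ?k" "i \<ge> 1" for i j d
  proof -
    \<comment> \<open>Input bits have nonzero codes and a blank origin carries the mark, so code 0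
      appears only where all further cells are blank.\<close>
    have "cell_at M ?w 0 j (d, Suc i) = 0" if 0: "cell_at M ?w 0 j (d, i) = 0"
    proof (cases d)
      case False
      then show ?thesis using cell_at_0(3)[OF M _ \<open>j < ?k\<close>] by simp
    next
      case True
      then show ?thesis
        using 0 k \<open>i \<ge> 1\<close> \<open>j < ?k\<close> cell_at_0(1,2)[OF M, of i] cell_at_0(1,2)[OF M, of "Suc i"]
        by (cases "j = 0") (auto simp: input_code_def split: if_splits)
    qed
    then show ?thesis
      using X by (cases "cell_at M ?w 0 j (d, i) = 0") (auto simp: blank_rule_def x_init_def Let_def)
  qed
  have accept: "rsat A (inst (env 0 i T 0) (accept_rule M d))" for i d
    using out'[of "(d, i)"] by (auto simp: accept_rule_def unit_rule_def A_def)
  have start: "\<forall>r\<in>set (start_rules M). rsat A (inst (env 0 0 T 0) r)"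
    unfolding start_rules_iff
    using cell_at_0[OF M, of 1] cell_at_0(2)[OF M, of "Suc (Suc 0)"]
    by (auto simp: unit_rule_def x_init_def A_def init_def)
  have in_x: "?w ! i = pair x [] ! i" if "i < ?b" for i
    using that by (subst pair_append) (simp add: nth_append length_pair)
  have input: "rsat A (inst (env 0 0 T i) (input_rule M (pair x [] ! i) i))" if "i < ?b" for i
    using that cell_at_0(1)[OF M, of "Suc i" ?w] in_x
    by (simp add: input_rule_def unit_rule_def x_init_def A_def length_pair)
  have guess: "rsat A (inst (env 0 0 T i) guess_rule)" if "i \<ge> ?b" for i
    using that cell_at_0(1)[OF M, of "Suc i" ?w]
    by (auto simp: guess_rule_def x_init_def A_def input_code_def)
  have "end": "rsat A (inst (env 0 0 T (?b + m)) end_rule)"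
    using cell_at_0(1)[OF M, of "Suc (?b + m)" ?w] u(1)
    by (auto simp: end_rule_def unit_rule_def x_init_def A_def length_pair)
  have "\<forall>r\<in>set (rule_list M x m T W). rsat A r"
    unfolding rule_list_iff
    using steps blank accept start input guess "end" by (auto simp: cell_rules_def)
  then show "\<exists>A. \<forall>r\<in>set (rule_list M x m T W). rsat A r"
    by blast
qed

section \<open>The reduction\<close>

text \<open>Register 1 stays empty, so \<open>Zero\<close> can be treated like the other
  bases.\<close>

fun reg :: "base \<Rightarrow> nat" where
  "reg Zero = 1"
| "reg Time = 2"
| "reg Cell = 3"
| "reg Full = 4"
| "reg Posn = 5"

definition digits :: "bool list \<Rightarrow> bool list" where
  "digits w = concat (map (\<lambda>b. [False, b]) w)"

lemma digits_simps [simp]: "digits [] = []" "digits (b # w) = False # b # digits w"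
  "digits (v @ w) = digits v @ digits w"
  "concat (replicate k [False, b]) = digits (replicate k b)"
  by (simp_all add: digits_def map_replicate_const)

text \<open>In unary, \<open>L b + e\<close> is a register followed by \<open>e\<close> fixed
  digits, so no addition is performed.\<close>

definition place_cmd :: "place \<Rightarrow> cmd" where
  "place_cmd p = EmitAll [False, True] (reg (fst p)) ;;
     Emit (digits (replicate (snd p) True @ [False]))"

fun word_cmd :: "bool \<times> tag \<times> place \<times> place \<Rightarrow> cmd" where
  "word_cmd (s, g, p, p') = place_cmd p ;; place_cmd p' ;;
     Emit (digits (replicate (tag_code g) True @ [False]))"

text \<open>The first two bits are the sign character; \<open>b\<close> chooses between the literal
  and its negation.\<close>

definition v_cmd :: "bool \<Rightarrow> bool \<times> tag \<times> place \<times> place \<Rightarrow> cmd" where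
  "v_cmd b l = Emit [True, fst l = b] ;; word_cmd l ;; Emit (digits [True])"

definition y_cmd :: "bool \<Rightarrow> bool \<times> tag \<times> place \<times> place \<Rightarrow> bool \<times> tag \<times> place \<times> place \<Rightarrow> cmd" where
  "y_cmd b k l = Emit [True, b] ;; word_cmd k ;; word_cmd l ;; Emit (digits [fst k, fst l, True])"

definition z_cmd :: "bool \<Rightarrow> cmd" where
  "z_cmd b = Emit ([True, b] @ digits [True])"

fun rule_cmd :: "rule_scheme \<Rightarrow> cmd" where
  "rule_cmd (k, l, m) =
     v_cmd True k ;; v_cmd True l ;; y_cmd True k l ;;
     v_cmd False k ;; v_cmd False l ;; y_cmd False k l ;;
     y_cmd False k l ;; v_cmd True m ;; z_cmd True ;;
     y_cmd True k l ;; v_cmd False m ;; z_cmd False"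

definition rules_cmd :: "rule_scheme list \<Rightarrow> cmd" where
  "rules_cmd rs = foldr (\<lambda>r c. rule_cmd r ;; c) rs Nop"

abbreviation lengths :: "store \<Rightarrow> base \<Rightarrow> nat" where
  "lengths s b \<equiv> length (s (reg b))"

lemma sem_word_cmd:
  "sem (word_cmd l) st = (fst st, snd st @ digits (word (snd (inst_lit (lengths (fst st)) l))))"
  by (cases l) (auto simp: place_cmd_def word.simps replicate_add simp flip: append_assoc)

lemma inst_lit_fst: "fst (inst_lit L l) = fst l"
  by (cases l) auto

lemma encode_mk: "encode_literal (mk b j) = [True, b] @ digits (binary j)"
  by (simp add: mk_def encode_index_def digits_def)

lemma binary_names: "binary (v_name v) = word v @ [True]" "binary z_name = [True]"
  "binary (y_name k l) = word (snd k) @ word (snd l) @ [fst k, fst l, True]"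
proof -
  show "binary (v_name v) = word v @ [True]" "binary z_name = [True]"
    unfolding v_name_def z_name_def by (rule binary_num, simp)+
  show "binary (y_name k l) = word (snd k) @ word (snd l) @ [fst k, fst l, True]"
    by (cases k; cases l) (simp add: y_name.simps binary_num)
qed

lemma negate_mk: "negate (mk b j) = mk (\<not> b) j"
  by (simp add: mk_def)

lemma Pos_Neg_mk: "Pos j = mk True j" "Neg j = mk False j"
  by (simp_all add: mk_def)

lemma sem_v_cmd:
  "sem (v_cmd b l) st = (fst st, snd st @ encode_literal
     (mk (fst l = b) (v_name (snd (inst_lit (lengths (fst st)) l)))))"
  by (simp add: v_cmd_def sem_word_cmd encode_mk binary_names)

lemma sem_y_cmd:
  "sem (y_cmd b k l) st = (fst st, snd st @ encode_literal
     (mk b (y_name (inst_lit (lengths (fst st)) k) (inst_lit (lengths (fst st)) l))))"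
  by (simp add: y_cmd_def sem_word_cmd encode_mk binary_names inst_lit_fst)

lemma sem_z_cmd: "sem (z_cmd b) st = (fst st, snd st @ encode_literal (mk b z_name))"
  by (simp add: z_cmd_def encode_mk binary_names)

lemma encode_append [simp]: "encode (\<phi> @ \<psi>) = encode \<phi> @ encode \<psi>"
  by (simp add: encode_def)

lemma sem_rule_cmd:
  "sem (rule_cmd r) st = (fst st, snd st @ encode (symz (inst (lengths (fst st)) r)))"
  by (cases r) (simp add: sem_v_cmd sem_y_cmd sem_z_cmd Let_def encode_def lit_def Pos_Neg_mk
      negate_mk inst_lit_fst)

lemma sem_rules_cmd:
  "sem (rules_cmd rs) st =
     (fst st, snd st @ encode (concat (map symz (map (inst (lengths (fst st))) rs))))"
  by (induction rs arbitrary: st) (auto simp: rules_cmd_def sem_rule_cmd encode_def[of "[]"])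

lemma reg_less: "6 \<le> n \<Longrightarrow> reg b < n"
  by (cases b) auto

lemma safe_word_cmd: "6 \<le> n \<Longrightarrow> safe n B (word_cmd l)"
  by (cases l) (simp add: place_cmd_def reg_less)

lemma safe_rule_cmd: "6 \<le> n \<Longrightarrow> safe n B (rule_cmd r)"
  by (cases r) (simp add: v_cmd_def y_cmd_def z_cmd_def safe_word_cmd del: word_cmd.simps)

lemma safe_rules_cmd: "6 \<le> n \<Longrightarrow> safe n B (rules_cmd rs)"
  by (induction rs) (auto simp: rules_cmd_def safe_rule_cmd)

lemma for_loop_emits:
  assumes "\<And>x z out. f (s(i := x # z), out) = (s(i := x # z), out @ E (Suc (length z)))"
  shows "for_loop f i w (s, out) = (s(i := []), out @ concat (map E (rev [1..<Suc (length w)])))"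
proof (induction w arbitrary: out)
  case (Cons x w)
  then show ?case
    by (simp add: assms for_loop_upd)
qed simp

lemma lengths_env:
  "s 1 = [] \<Longrightarrow> lengths s = env (length (s 2)) (length (s 3)) (length (s 4)) (length (s 5))"
proof
  show "lengths s b = env (length (s 2)) (length (s 3)) (length (s 4)) (length (s 5)) b"
    if "s 1 = []" for b
    using that by (cases b) auto
qed

definition advance :: cmd where
  "advance = Push (\<lambda>_ _. Bit True) 5 5 5"

text \<open>Only position 0, recognised by an empty register 5, has a marked code; at all others the
  pattern is the one for position 1.\<close>

definition input_cmd :: "tm \<Rightarrow> bool \<Rightarrow> cmd" where
  "input_cmd M b = If (\<lambda>a _. a = None) 5 5 (rule_cmd (input_rule M b 0)) (rule_cmd (input_rule M b 1)) ;;
     advance"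

text \<open>Registers 4, 6 and 7 contain, in unary, the number of steps, the width of the window and the
  bound on the length of the certificate; register 5 is the position on the input tape.\<close>

definition formula_cmd :: "tm \<Rightarrow> cmd" where
  "formula_cmd M =
     For 2 4 (For 3 6 (rules_cmd (step_rules M))) ;;
     For 3 6 (rules_cmd (cell_rules M)) ;;
     rules_cmd (start_rules M) ;;
     For 8 0 (If (\<lambda>a _. a = Some (Bit True)) 8 8
       (input_cmd M True ;; input_cmd M True) (input_cmd M False ;; input_cmd M False)) ;;
     input_cmd M False ;; input_cmd M True ;;
     For 8 7 (rule_cmd guess_rule ;; advance) ;;
     rule_cmd end_rule"

lemma safe_formula_cmd: "safe 12 {0, 4, 6, 7} (formula_cmd M)"
  by (simp add: formula_cmd_def input_cmd_def advance_def safe_rule_cmd safe_rules_cmd)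

definition out_rules :: "rule list \<Rightarrow> bool list" where
  "out_rules rs = encode (concat (map symz rs))"

lemma out_rules_append: "out_rules (rs @ rs') = out_rules rs @ out_rules rs'"
  by (simp add: out_rules_def)

lemma out_rules_concat: "out_rules (concat rss) = concat (map out_rules rss)"
  by (induction rss) (simp_all add: out_rules_append, simp add: out_rules_def encode_def)

lemma out_rules_single: "encode (symz r) = out_rules [r]"
  by (simp add: out_rules_def)

definition at_pos :: "store \<Rightarrow> nat \<Rightarrow> store" where
  "at_pos s k = s(5 := replicate k (Bit True))"

lemma at_pos_simps [simp]:
  "at_pos s k 5 = replicate k (Bit True)" "r \<noteq> 5 \<Longrightarrow> at_pos s k r = s r"
  "(at_pos s k)(5 := Bit True # replicate k (Bit True)) = at_pos s (Suc k)"
  "(at_pos s k)(8 := z) = at_pos (s(8 := z)) k"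
  by (auto simp: at_pos_def)

lemma sem_input_cmd:
  assumes "s 1 = []" "s 2 = []" "s 3 = []" "length (s 4) = T"
  shows "sem (input_cmd M b) (at_pos s k, out) =
    (at_pos s (Suc k), out @ out_rules [inst (env 0 0 T k) (input_rule M b k)])"
proof -
  have "input_rule M b k = input_rule M b 1" if "k > 0"
    using that by (simp add: input_rule_def input_code_def)
  moreover have "top_of (replicate k (Bit True)) = None \<longleftrightarrow> k = 0"
    by (cases k) auto
  ultimately show ?thesis
    using assms lengths_env[of "at_pos s k"]
    by (auto simp: input_cmd_def advance_def sem_rule_cmd out_rules_single)
qed

lemma input_loop:
  assumes "s 1 = []" "s 2 = []" "s 3 = []" "length (s 4) = T"
  shows "for_loop (sem (If (\<lambda>a _. a = Some (Bit True)) 8 8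
       (input_cmd M True ;; input_cmd M True) (input_cmd M False ;; input_cmd M False))) 8
       (map Bit x) (at_pos s k, out) =
     (at_pos (s(8 := [])) (k + 2 * length x), out @ out_rules
       (map (\<lambda>(i, b). inst (env 0 0 T i) (input_rule M b i))
         (List.enumerate k (concat (map (\<lambda>b. [b, b]) x)))))"
proof (induction x arbitrary: k out)
  case Nil
  then show ?case by (simp add: out_rules_def encode_def del: fun_upd_apply)
next
  case (Cons b x)
  note step = sem_input_cmd[of "s(8 := q)" T M for q]
  have loop: "for_loop f 8 z (at_pos (s(8 := q)) k, out) = for_loop f 8 z (at_pos s k, out)" for f z q k out
    using for_loop_upd[of f 8 z "at_pos s k"] by simp
  show ?case
    using assms Cons step
    by (cases b) (simp_all add: loop flip: out_rules_append)
qed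

lemma guess_loop:
  assumes "s 1 = []" "s 2 = []" "s 3 = []" "length (s 4) = T"
  shows "for_loop (sem (rule_cmd guess_rule ;; advance)) 8 z (at_pos s k, out) =
     (at_pos (s(8 := [])) (k + length z), out @ out_rules
       (map (\<lambda>i. inst (env 0 0 T i) guess_rule) [k..<k + length z]))"
proof (induction z arbitrary: k out)
  case Nil
  then show ?case by (simp add: out_rules_def encode_def del: fun_upd_apply)
next
  case (Cons a z)
  have loop: "for_loop f 8 z (at_pos (s(8 := q)) k, out) = for_loop f 8 z (at_pos s k, out)" for f z q k out
    using for_loop_upd[of f 8 z "at_pos s k"] by simp
  show ?case
    using assms Cons lengths_env[of "at_pos (s(8 := q)) k" for q]
    by (simp add: loop upt_conv_Cons advance_def sem_rule_cmd out_rules_single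
        del: upt_Suc flip: out_rules_append)
qed

lemma sem_formula_cmd:
  assumes s: "s 1 = []" "s 2 = []" "s 3 = []" "s 5 = []" "s 8 = []"
    "length (s 4) = T" "length (s 6) = W" "length (s 7) = m" "s 0 = map Bit x"
  shows "snd (sem (formula_cmd M) (s, out)) = out @ out_rules (rule_list M x m T W)"
proof -
  have loop1: "sem (For 2 4 (For 3 6 (rules_cmd (step_rules M)))) (s, out) = (s, out @ out_rules
      (concat (map (\<lambda>\<tau>. concat (map (\<lambda>i. map (inst (env \<tau> i T 0)) (step_rules M)) (rev [1..<Suc W])))
       (rev [1..<Suc T]))))" for out
  proof -
    have inner: "sem (For 3 6 (rules_cmd (step_rules M))) (s(2 := x # z), out) =
        (s(2 := x # z), out @ concat (map (\<lambda>i. out_rules (map (inst (env (Suc (length z)) i T 0))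
          (step_rules M))) (rev [1..<Suc W])))" for x z out
    proof -
      have "for_loop (sem (rules_cmd (step_rules M))) 3 (s 6) (s(2 := x # z), out) =
        ((s(2 := x # z))(3 := []), out @ concat (map (\<lambda>i. out_rules (map (inst (env (Suc (length z)) i T 0))
          (step_rules M))) (rev [1..<Suc (length (s 6))])))"
        by (rule for_loop_emits)
          (use s lengths_env[of "s(2 := x # z, 3 := x' # z')" for x' z'] in
            \<open>simp add: sem_rules_cmd out_rules_def\<close>)
      moreover have "(s(2 := x # z))(3 := []) = s(2 := x # z)"
        using s by auto
      ultimately show ?thesis
        using s by simp
    qed
    have "sem (For 2 4 (For 3 6 (rules_cmd (step_rules M)))) (s, out) = (s(2 := []), out @
      concat (map (\<lambda>\<tau>. concat (map (\<lambda>i. out_rules (map (inst (env \<tau> i T 0)) (step_rules M)))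
        (rev [1..<Suc W]))) (rev [1..<Suc (length (s 4))])))"
      unfolding sem.simps(11)[of 2] by (simp only: fst_conv, rule for_loop_emits) (rule inner)
    moreover have "s(2 := []) = s"
      using s by auto
    ultimately show ?thesis
      using s by (simp add: out_rules_concat comp_def del: upt_Suc)
  qed
  have loop2: "sem (For 3 6 (rules_cmd (cell_rules M))) (s, out) = (s, out @ out_rules
      (concat (map (\<lambda>i. map (inst (env 0 i T 0)) (cell_rules M)) (rev [1..<Suc W]))))" for out
  proof -
    have "for_loop (sem (rules_cmd (cell_rules M))) 3 (s 6) (s, out) =
        (s(3 := []), out @ concat (map (\<lambda>i. out_rules (map (inst (env 0 i T 0))
          (cell_rules M))) (rev [1..<Suc (length (s 6))])))"
      by (rule for_loop_emits)
        (use s lengths_env[of "s(3 := x' # z')" for x' z'] in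
          \<open>simp add: sem_rules_cmd out_rules_def\<close>)
    moreover have "s(3 := []) = s"
      using s by auto
    ultimately show ?thesis
      using s by (simp add: out_rules_concat comp_def del: upt_Suc)
  qed
  have start: "sem (rules_cmd (start_rules M)) (s, out) =
      (s, out @ out_rules (map (inst (env 0 0 T 0)) (start_rules M)))" for out
    using s lengths_env[of s] by (simp add: sem_rules_cmd out_rules_def)
  have s5: "at_pos s 0 = s" "s(8 := []) = s"
    using s by (auto simp: at_pos_def)
  let ?n = "2 * length x"
  let ?input = "\<lambda>(i, b). inst (env 0 0 T i) (input_rule M b i)"
  have input: "sem (For 8 0 (If (\<lambda>a _. a = Some (Bit True)) 8 8
       (input_cmd M True ;; input_cmd M True) (input_cmd M False ;; input_cmd M False)) ;;
     input_cmd M False ;; input_cmd M True) (s, out) =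
     (at_pos s (?n + 2), out @ out_rules (map ?input (List.enumerate 0 (pair x []))))" for out
    using input_loop[OF s(1-3,6), of M x 0] s s5
    by (simp add: pair_def enumerate_append_eq out_rules_append length_concat comp_def
        sum_list_triv mult_2_right mult.commute[of 2] sem_input_cmd[OF s(1-3,6)] flip: out_rules_append)
  have "map ?input (List.enumerate 0 (pair x [])) =
      map (\<lambda>i. inst (env 0 0 T i) (input_rule M (pair x [] ! i) i)) [0..<?n + 2]"
    by (rule nth_equalityI) (auto simp: length_pair nth_enumerate_eq simp del: upt_Suc)
  note input = input[unfolded this]
  have guess: "sem (For 8 7 (rule_cmd guess_rule ;; advance)) (at_pos s (?n + 2), out) =
     (at_pos s (?n + 2 + m), out @ out_rules
       (map (\<lambda>i. inst (env 0 0 T i) guess_rule) [?n + 2..<?n + 2 + m]))" for out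
    using guess_loop[OF s(1-3,6), of "s 7" "?n + 2" out] s s5 by simp
  have "end": "sem (rule_cmd end_rule) (at_pos s (?n + 2 + m), out) =
     (at_pos s (?n + 2 + m), out @ out_rules [inst (env 0 0 T (?n + 2 + m)) end_rule])" for out
    using s lengths_env[of "at_pos s (?n + 2 + m)"] by (simp add: sem_rule_cmd out_rules_single)
  show ?thesis
    unfolding formula_cmd_def rule_list_def sem.simps(8) loop1 loop2 start
      input[unfolded sem.simps(8)] guess "end" out_rules_append
    by simp
qed

section \<open>Polynomials of the input length in unary\<close>

definition push_bit :: "nat \<Rightarrow> cmd" where
  "push_bit r = Push (\<lambda>_ _. Bit True) r r r"

definition product_cmd :: "nat \<Rightarrow> cmd" where
  "product_cmd r = For 10 9 (For 11 0 (push_bit r))"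

lemma sem_product_cmd:
  assumes "r \<in> {4, 6, 7}"
  shows "snd (sem (product_cmd r) st) = snd st"
    "length (fst (sem (product_cmd r) st) r) =
       length (fst st r) + length (fst st 9) * length (fst st 0)"
    "\<And>x. x \<notin> {r, 10, 11} \<Longrightarrow> fst (sem (product_cmd r) st) x = fst st x"
proof -
  have r: "r \<noteq> 0" "r \<noteq> 10" "r \<noteq> 11" "r \<noteq> 9"
    using assms by auto
  have inner: "snd (for_loop (sem (push_bit r)) 11 z st) = snd st \<and>
      length (fst (for_loop (sem (push_bit r)) 11 z st) r) = length (fst st r) + length z \<and>
      (\<forall>x. x \<notin> {r, 11} \<longrightarrow> fst (for_loop (sem (push_bit r)) 11 z st) x = fst st x)" for z st
    using r by (induction z arbitrary: st) (auto simp: push_bit_def)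
  have outer: "snd (for_loop (sem (For 11 0 (push_bit r))) 10 z st) = snd st \<and>
      length (fst (for_loop (sem (For 11 0 (push_bit r))) 10 z st) r) =
        length (fst st r) + length z * length (fst st 0) \<and>
      (\<forall>x. x \<notin> {r, 10, 11} \<longrightarrow>
        fst (for_loop (sem (For 11 0 (push_bit r))) 10 z st) x = fst st x)" for z st
    using r by (induction z arbitrary: st) (auto simp: inner)
  from outer[of "fst st 9" st] show "snd (sem (product_cmd r) st) = snd st"
    "length (fst (sem (product_cmd r) st) r) =
       length (fst st r) + length (fst st 9) * length (fst st 0)"
    "\<And>x. x \<notin> {r, 10, 11} \<Longrightarrow> fst (sem (product_cmd r) st) x = fst st x"
    unfolding product_cmd_def sem.simps(11)[of 10] by auto
qed

lemma timed_seq_exists: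
  "\<exists>q. timed n c q \<Longrightarrow> \<exists>q. timed n d q \<Longrightarrow> \<exists>q. timed n (c ;; d) q"
  by (blast intro: timed_seq)

definition computes_poly :: "nat \<Rightarrow> nat poly \<Rightarrow> cmd \<Rightarrow> bool" where
  "computes_poly r p c \<longleftrightarrow> (\<exists>q. timed 12 c q) \<and> (\<forall>st. snd (sem c st) = snd st \<and>
    length (fst (sem c st) r) = poly p (length (fst st 0)) \<and>
    (\<forall>x. x \<notin> {r, 9, 10, 11} \<longrightarrow> fst (sem c st) x = fst st x))"

text \<open>Horner's rule: the value for \<open>p\<close> is moved to register 9, multiplied by the
  input length into the emptied register \<open>r\<close>, and \<open>a\<close> is added.\<close>

lemma computes_poly_exists:
  assumes r: "r \<in> {4, 6, 7}"
  shows "\<exists>c. computes_poly r p c"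
  unfolding computes_poly_def
proof (induction p)
  case 0
  have "safe 12 {} (Clear r)"
    using r by auto
  then have "\<exists>q. timed 12 (Clear r) q"
    by (rule timed_of_safe) simp
  then show ?case
    by (intro exI[of _ "Clear r"]) auto
next
  case (pCons a p)
  then obtain c where c: "\<exists>q. timed 12 c q" "\<And>st. snd (sem c st) = snd st"
    "\<And>st. length (fst (sem c st) r) = poly p (length (fst st 0))"
    "\<And>st x. x \<notin> {r, 9, 10, 11} \<Longrightarrow> fst (sem c st) x = fst st x"
    by blast
  define pushes where "pushes = ((\<lambda>d. push_bit r ;; d) ^^ a) Nop"
  have pushes: "safe 12 {} pushes \<and> (\<forall>st. snd (sem pushes st) = snd st \<and>
      length (fst (sem pushes st) r) = length (fst st r) + a \<and>
      (\<forall>x. x \<noteq> r \<longrightarrow> fst (sem pushes st) x = fst st x))"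
    unfolding pushes_def using r by (induction a) (auto simp: push_bit_def)
  then have pushes': "safe 12 {} pushes" "\<And>st. snd (sem pushes st) = snd st"
    "\<And>st. length (fst (sem pushes st) r) = length (fst st r) + a"
    "\<And>st x. x \<noteq> r \<Longrightarrow> fst (sem pushes st) x = fst st x"
    by blast+
  \<comment> \<open>Register 9 is written in one phase and bounds a loop of the next, so the phases
    are joined by \<open>timed_seq_exists\<close> and not by one \<open>safe\<close>
    statement.\<close>
  let ?c = "c ;; (Copy 9 r ;; Clear r) ;; product_cmd r ;; pushes"
  have "safe 12 {} (Copy 9 r ;; Clear r)" "safe 12 {0, 9} (product_cmd r)"
    using r by (auto simp: product_cmd_def push_bit_def)
  then have "\<exists>q. timed 12 ?c q"
    using pushes'(1)
    by (intro timed_seq_exists c(1) timed_of_safe[of 12 "{}"] timed_of_safe[of 12 "{0, 9}"]) auto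
  moreover have "snd (sem ?c st) = snd st \<and>
    length (fst (sem ?c st) r) = poly (pCons a p) (length (fst st 0)) \<and>
    (\<forall>x. x \<notin> {r, 9, 10, 11} \<longrightarrow> fst (sem ?c st) x = fst st x)" for st
  proof -
    have "fst (sem c st) 0 = fst st 0" "9 \<noteq> r" "0 \<noteq> r"
      using c(4)[of 0 st] r by auto
    then show ?thesis
      by (simp add: pushes' sem_product_cmd[OF r] c(2-4) algebra_simps)
  qed
  ultimately show ?case
    by blast
qed

lemma outputs_within_mono: "outputs_within M w y T \<Longrightarrow> T \<le> T' \<Longrightarrow> outputs_within M w y T'"
  unfolding outputs_within_def by (meson le_trans)

theorem NP_hard_symmetric_3SAT: "NP_hard symmetric_3SAT"
  unfolding NP_hard_def
proof (intro allI impI)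
  fix A
  assume "in_NP A"
  then obtain V p where V: "in_P V"
    "\<And>x. x \<in> A \<longleftrightarrow> (\<exists>u. length u \<le> poly p (length x) \<and> pair x u \<in> V)"
    unfolding in_NP_def by blast
  then obtain M q where M: "tm_wf M" "\<And>w. outputs_within M w [w \<in> V] (poly q (length w))"
    unfolding in_P_def polytime_def by blast
  \<comment> \<open>A pair with an admissible certificate has length at most
    \<open>2 + 2 * length x + poly p (length x)\<close>, so \<open>qT\<close> bounds the time for
    all of them; \<open>qW\<close> is chosen to satisfy \<open>2 * T < W\<close>.\<close>
  define qT where "qT = pcompose q ([:2, 2:] + p)"
  define qW where "qW = qT + qT + 1"
  obtain c1 where c1: "computes_poly 4 qT c1"
    using computes_poly_exists[of 4] by auto
  obtain c2 where c2: "computes_poly 6 qW c2"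
    using computes_poly_exists[of 6] by auto
  obtain c3 where c3: "computes_poly 7 p c3"
    using computes_poly_exists[of 7] by auto
  have c: "\<exists>q. timed 12 c1 q" "\<exists>q. timed 12 c2 q" "\<exists>q. timed 12 c3 q"
    "\<And>st. snd (sem c1 st) = snd st" "\<And>st. snd (sem c2 st) = snd st" "\<And>st. snd (sem c3 st) = snd st"
    "\<And>st. length (fst (sem c1 st) 4) = poly qT (length (fst st 0))"
    "\<And>st. length (fst (sem c2 st) 6) = poly qW (length (fst st 0))"
    "\<And>st. length (fst (sem c3 st) 7) = poly p (length (fst st 0))"
    "\<And>st x. x \<notin> {4, 9, 10, 11} \<Longrightarrow> fst (sem c1 st) x = fst st x"
    "\<And>st x. x \<notin> {6, 9, 10, 11} \<Longrightarrow> fst (sem c2 st) x = fst st x"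
    "\<And>st x. x \<notin> {7, 9, 10, 11} \<Longrightarrow> fst (sem c3 st) x = fst st x"
    using c1 c2 c3 unfolding computes_poly_def by blast+
  define c where "c = c1 ;; c2 ;; c3 ;; formula_cmd M"
  define rules where "rules x = rule_list M x (poly p (length x)) (poly qT (length x))
    (poly qW (length x))" for x
  have sem: "snd (sem c (input_store x, [])) = out_rules (rules x)" for x
  proof -
    obtain s out where s: "sem c3 (sem c2 (sem c1 (input_store x, []))) = (s, out)"
      by fastforce
    then have s': "s = fst (sem c3 (sem c2 (sem c1 (input_store x, []))))"
      by simp
    have "out = []"
      using c(4)[of "(input_store x, [])"] c(5,6) s by (metis snd_conv)
    moreover have "s 1 = []" "s 2 = []" "s 3 = []" "s 5 = []" "s 8 = []" "s 0 = map Bit x"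
      "length (s 4) = poly qT (length x)" "length (s 6) = poly qW (length x)"
      "length (s 7) = poly p (length x)"
      unfolding s' by (simp_all add: c(7-12) input_store_def)
    ultimately show ?thesis
      using sem_formula_cmd[of s _ _ _ x M "[]"] s by (simp add: c_def rules_def)
  qed
  have "\<exists>q. timed 12 (formula_cmd M) q"
    by (rule timed_of_safe[OF safe_formula_cmd]) auto
  then have "\<exists>q. timed 12 c q"
    unfolding c_def by (intro timed_seq_exists c(1-3))
  then have poly: "polytime (\<lambda>x. out_rules (rules x))"
    using polytime_cmd[of 12 c] sem by auto
  have "x \<in> A \<longleftrightarrow> out_rules (rules x) \<in> symmetric_3SAT" for x
  proof -
    have out: "outputs_within M (pair x u) [pair x u \<in> V] (poly qT (length x))"
      if "length u \<le> poly p (length x)" for u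
    proof (rule outputs_within_mono[OF M(2)])
      have "length (pair x u) \<le> 2 + 2 * length x + poly p (length x)"
        using that by (simp add: length_pair)
      then show "poly q (length (pair x u)) \<le> poly qT (length x)"
        using poly_nat_mono by (simp add: qT_def poly_pcompose mult.commute)
    qed
    have "x \<in> A \<longleftrightarrow> (\<exists>A. \<forall>r\<in>set (rules x). rsat A r)"
      unfolding V(2) rules_def
      by (rule cook_levin[symmetric]) (use M(1) out in \<open>auto simp: qW_def\<close>)
    also have "\<dots> \<longleftrightarrow> satisfiable (concat (map symz (rules x)))"
      by (rule satisfiable_symz[symmetric])
    \<comment> \<open>By injectivity of \<open>encode\<close>, the printed word is in the language
      only on account of this very formula.\<close>
    also have "\<dots> \<longleftrightarrow> out_rules (rules x) \<in> symmetric_3SAT"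
      using symmetric_symz encode_inj unfolding symmetric_3SAT_def out_rules_def
      by (auto dest: injD)
    finally show ?thesis .
  qed
  then show "poly_reducible A symmetric_3SAT"
    unfolding poly_reducible_def using poly by blast
qed

section \<open>The verifier\<close>

definition read_sym :: "nat \<Rightarrow> nat \<Rightarrow> cmd" where
  "read_sym r r' = Push (\<lambda>a _. the a) r r r'"

text \<open>Register 6 is the flag for rejection, which no part of \<open>check_cmd\<close> ever
  empties.\<close>

definition fail :: cmd where
  "fail = Push (\<lambda>_ _. Bit True) 6 6 6"

definition fail_unless_empty :: "nat \<Rightarrow> cmd" where
  "fail_unless_empty r = If (\<lambda>a _. a = None) r r Nop fail"

text \<open>Registers 4 and 5 receive the two components of a pair, both reversed.\<close>

definition split_cmd :: cmd where
  "split_cmd = For 1 0 (If (\<lambda>a _. a \<noteq> None) 3 3 (read_sym 1 5)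
     (If (\<lambda>a _. a = None) 2 2 (read_sym 1 2)
       (If (=) 1 2 (read_sym 1 4 ;; Pop 2) (read_sym 1 3))))"

definition is_bit :: "bool \<Rightarrow> sym option \<Rightarrow> bool" where
  "is_bit b a \<longleftrightarrow> a = Some (Bit b)"

lemma is_bit_Some [simp]: "is_bit b (Some (Bit c)) \<longleftrightarrow> b = c"
  by (auto simp: is_bit_def)

text \<open>A counter modulo 3 with states \<open>[]\<close>, \<open>[Bit False]\<close> and
  \<open>[Bit True, Bit False]\<close>, running \<open>c\<close> at every third call.\<close>

definition count3 :: "nat \<Rightarrow> cmd \<Rightarrow> cmd" where
  "count3 r c = If (\<lambda>a _. is_bit True a) r r (c ;; Clear r) (Push (\<lambda>a _. Bit (a \<noteq> None)) r r r)"

text \<open>Register 8 keeps the value bit of a character until its type bit is read. The first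
  digit met in an index is its most significant one and must not be 0, since \<open>binary\<close>
  has no leading zeros.\<close>

definition valid_body :: cmd where
  "valid_body = If (\<lambda>a _. a = None) 8 8 (read_sym 7 8)
     (If (\<lambda>a _. is_bit False a) 7 7
       (If (\<lambda>a h. a = None \<and> is_bit False h) 9 8 fail Nop ;; read_sym 8 9)
       (Clear 9 ;; count3 10 Nop) ;; Pop 8)"

text \<open>An incomplete character, digits without a sign or an incomplete clause would remain in
  register 8, 9 or 10.\<close>

definition valid_cmd :: cmd where
  "valid_cmd = For 7 4 valid_body ;; fail_unless_empty 8 ;; fail_unless_empty 9 ;;
     fail_unless_empty 10"

text \<open>The word is read from its end, so the value of a two-bit character comes before its type and
  the sign of a literal after its index. The certificate supplies one bit for every literal, its
  truth value. When \<open>K\<close> runs, \<open>b + 4\<close> holds the index of the last literal together with the truth value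
  of the variable, \<open>b + 5\<close> the same with the opposite value, \<open>b + 6\<close> and \<open>b + 7\<close> hold the current clause
  and its mirror, and \<open>b + 8\<close> is empty if no literal of the clause has been true.\<close>

definition scan_body :: "nat \<Rightarrow> cmd \<Rightarrow> cmd" where
  "scan_body b K = If (\<lambda>a _. a = None) (b + 3) (b + 3) (read_sym (b + 2) (b + 3))
     (If (\<lambda>a _. is_bit False a) (b + 2) (b + 2)
       (read_sym (b + 3) (b + 4) ;; read_sym (b + 3) (b + 5) ;; read_sym (b + 3) (b + 6) ;;
        read_sym (b + 3) (b + 7))
       (Push (\<lambda>h m. Sgn (is_bit True h = is_bit True m)) (b + 3) (b + 9) (b + 4) ;;
        Push (\<lambda>h m. Sgn (is_bit True h \<noteq> is_bit True m)) (b + 3) (b + 9) (b + 5) ;;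
        Push (\<lambda>h _. Sgn (is_bit True h)) (b + 3) (b + 3) (b + 6) ;;
        Push (\<lambda>h _. Sgn (\<not> is_bit True h)) (b + 3) (b + 3) (b + 7) ;;
        If (\<lambda>m _. is_bit True m) (b + 9) (b + 9) (read_sym (b + 9) (b + 8)) Nop ;;
        Pop (b + 9) ;; K ;; Clear (b + 4) ;; Clear (b + 5)) ;; Pop (b + 3))"

text \<open>The parameter \<open>b\<close> gives every scan registers of its own, so that one scan
  can run inside another.\<close>

definition scan :: "nat \<Rightarrow> cmd \<Rightarrow> cmd" where
  "scan b K = Clear (b + 3) ;; Clear (b + 4) ;; Clear (b + 5) ;; Clear (b + 6) ;; Clear (b + 7) ;;
     Clear (b + 8) ;; Clear (b + 10) ;; Copy (b + 9) 5 ;; For (b + 2) 4 (scan_body b K)"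

definition clause_step :: "nat \<Rightarrow> cmd \<Rightarrow> cmd" where
  "clause_step b K = count3 (b + 10) (K ;; Clear (b + 6) ;; Clear (b + 7) ;; Clear (b + 8))"

text \<open>Register 24 holds the index and value of an occurrence in the outer scan, register 35
  the index and opposite value in the inner one. If they agree, a variable has received both
  values.\<close>

definition consistent_cmd :: cmd where
  "consistent_cmd = scan 20 (scan 30 (IfEq 24 35 fail Nop))"

text \<open>Registers 11 and 12 count the occurrences of the outer clause and of its mirror, the
  latter by mirroring the inner clause instead.\<close>

definition count_body :: cmd where
  "count_body = IfEq 26 36 (push_bit 11) Nop ;; IfEq 26 37 (push_bit 12) Nop"

definition clauses_cmd :: cmd where
  "clauses_cmd = scan 20 (clause_step 20 (If (\<lambda>a _. a = None) 28 28 fail Nop ;;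
     Clear 11 ;; Clear 12 ;; scan 30 (clause_step 30 count_body) ;; IfEq 11 12 Nop fail))"

definition check_cmd :: cmd where
  "check_cmd = valid_cmd ;; consistent_cmd ;; clauses_cmd"

definition verify_cmd :: cmd where
  "verify_cmd = (split_cmd ;; check_cmd) ;; If (\<lambda>a _. a = None) 6 6 (Emit [True]) (Emit [False])"

lemmas cmd_defs = read_sym_def fail_def fail_unless_empty_def split_cmd_def count3_def valid_body_def
  valid_cmd_def scan_body_def scan_def clause_step_def consistent_cmd_def count_body_def
  clauses_cmd_def check_cmd_def push_bit_def

section \<open>Programs without output and the persistence of the rejection flag\<close>

primrec silent :: "cmd \<Rightarrow> bool" where
  "silent Nop = True"
| "silent (Push g r1 r2 r) = True"
| "silent (Pop r) = True"
| "silent (Clear r) = True"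
| "silent (Copy r r') = True"
| "silent (Emit bs) = False"
| "silent (EmitAll bs r) = False"
| "silent (c ;; d) = (silent c \<and> silent d)"
| "silent (If P r1 r2 c d) = (silent c \<and> silent d)"
| "silent (IfEq r1 r2 c d) = (silent c \<and> silent d)"
| "silent (For i r c) = silent c"

lemma silent_sem: "silent c \<Longrightarrow> snd (sem c st) = snd st"
proof (induction c arbitrary: st)
  case (For i r c)
  then have "snd (for_loop (sem c) i z st) = snd st" for z st
    by (induction z arbitrary: st) auto
  then show ?case by simp
qed auto

primrec grows :: "nat \<Rightarrow> cmd \<Rightarrow> bool" where
  "grows r Nop = True"
| "grows r (Push g r1 r2 r') = True"
| "grows r (Pop r') = (r' \<noteq> r)"
| "grows r (Clear r') = (r' \<noteq> r)"
| "grows r (Copy r' r'') = (r' \<noteq> r)"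
| "grows r (Emit bs) = True"
| "grows r (EmitAll bs r') = True"
| "grows r (c ;; d) = (grows r c \<and> grows r d)"
| "grows r (If P r1 r2 c d) = (grows r c \<and> grows r d)"
| "grows r (IfEq r1 r2 c d) = (grows r c \<and> grows r d)"
| "grows r (For i r' c) = (i \<noteq> r \<and> grows r c)"

lemma grows_sem: "grows r c \<Longrightarrow> fst st r \<noteq> [] \<Longrightarrow> fst (sem c st) r \<noteq> []"
proof (induction c arbitrary: st)
  case (For i r' c)
  then have "fst st r \<noteq> [] \<Longrightarrow> fst (for_loop (sem c) i z st) r \<noteq> []" for z st
    by (induction z arbitrary: st) auto
  then show ?case using For.prems by simp
qed auto

lemma for_loop_cong:
  "(\<And>r. r \<noteq> i \<Longrightarrow> s r = s' r) \<Longrightarrow> for_loop f i z (s, out) = for_loop f i z (s', out)"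
  using for_loop_upd[of f i z s "s' i" out] by (metis fun_upd_other fun_upd_same fun_upd_triv ext)

lemma silent_check: "silent (split_cmd ;; check_cmd)"
  by (simp add: cmd_defs)

lemma grows_check: "grows 6 valid_cmd" "grows 6 consistent_cmd" "grows 6 clauses_cmd"
  by (simp_all add: cmd_defs)

lemma safe_split: "safe 45 {0} split_cmd"
  by (simp add: cmd_defs)

text \<open>The checks loop over register 4, which \<open>split_cmd\<close> fills; hence two phases
  with different sets.\<close>

lemma safe_check: "safe 45 {4} (check_cmd ;; If (\<lambda>a _. a = None) 6 6 (Emit [True]) (Emit [False]))"
  by (simp add: cmd_defs)

subsection \<open>Splitting the input\<close>

text \<open>Register 2 keeps the first bit of a doubled pair until the second is seen. The first
  unequal pair is the separator: its second bit enters register 3 and redirects all later bits to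
  register 5.\<close>

lemma sem_split:
  "sem split_cmd (input_store (pair x u), []) =
    ((\<lambda>_. [])(0 := map Bit (pair x u), 2 := [Bit False], 3 := [Bit True],
      4 := rev (map Bit x), 5 := rev (map Bit u)), [])"
proof -
  define f where "f = sem (If (\<lambda>a _. a \<noteq> None) 3 3 (read_sym 1 5)
     (If (\<lambda>a _. a = None) 2 2 (read_sym 1 2)
       (If (=) 1 2 (read_sym 1 4 ;; Pop 2) (read_sym 1 3))))"
  have drop: "for_loop f 1 z (s, out) = for_loop f 1 z (s', out)"
    if "\<And>r. r \<noteq> 1 \<Longrightarrow> s r = s' r" for z s s' out
    using that by (rule for_loop_cong)
  have bit: "for_loop f 1 (Bit b # Bit b # z) (s, out) = for_loop f 1 z (s(4 := Bit b # s 4), out)"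
    if "s 3 = []" "s 2 = []" for b z s out
  proof -
    have "for_loop f 1 (Bit b # Bit b # z) (s, out) =
        for_loop f 1 z (s(1 := Bit b # z, 2 := [], 4 := Bit b # s 4), out)"
      using that by (simp add: f_def read_sym_def) (rule for_loop_cong, auto)
    also have "\<dots> = for_loop f 1 z (s(4 := Bit b # s 4), out)"
      using that by (intro drop) auto
    finally show ?thesis .
  qed
  have first: "for_loop f 1 (concat (map (\<lambda>b. [Bit b, Bit b]) x) @ z) (s, out) =
      for_loop f 1 z (s(4 := rev (map Bit x) @ s 4), out)" if "s 3 = []" "s 2 = []" for x z s out
    using that
  proof (induction x arbitrary: s)
    case (Cons b x)
    have "for_loop f 1 (concat (map (\<lambda>b. [Bit b, Bit b]) (b # x)) @ z) (s, out) =
        for_loop f 1 (concat (map (\<lambda>b. [Bit b, Bit b]) x) @ z) (s(4 := Bit b # s 4), out)"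
      using bit[OF Cons.prems] by simp
    also have "\<dots> = for_loop f 1 z ((s(4 := Bit b # s 4))
        (4 := rev (map Bit x) @ (s(4 := Bit b # s 4)) 4), out)"
      by (rule Cons.IH) (use Cons.prems in auto)
    also have "\<dots> = for_loop f 1 z (s(4 := rev (map Bit (b # x)) @ s 4), out)"
      by (intro drop) auto
    finally show ?case .
  qed (simp add: fun_upd_idem)
  have sep: "for_loop f 1 (Bit False # Bit True # z) (s, out) =
      for_loop f 1 z (s(2 := [Bit False], 3 := [Bit True]), out)"
    if "s 3 = []" "s 2 = []" for z s out
    using that by (simp add: f_def read_sym_def) (rule for_loop_cong, auto)
  have second: "for_loop f 1 (map Bit u) (s, out) = (s(1 := [], 5 := rev (map Bit u) @ s 5), out)"
    if "s 3 = [Bit True]" for u s out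
    using that
  proof (induction u arbitrary: s)
    case Nil
    then show ?case by (auto simp: fun_eq_iff)
  next
    case (Cons b u)
    have "for_loop f 1 (map Bit (b # u)) (s, out) =
        for_loop f 1 (map Bit u) (s(5 := Bit b # s 5), out)"
      using Cons.prems by (simp add: f_def read_sym_def) (rule for_loop_cong, auto)
    also have "\<dots> = ((s(5 := Bit b # s 5))(1 := [], 5 := rev (map Bit u) @ (s(5 := Bit b # s 5)) 5), out)"
      by (rule Cons.IH) (use Cons.prems in auto)
    also have "\<dots> = (s(1 := [], 5 := rev (map Bit (b # u)) @ s 5), out)"
      by (auto simp: fun_eq_iff)
    finally show ?case .
  qed
  let ?s = "input_store (pair x u)"
  let ?s1 = "?s(4 := rev (map Bit x) @ ?s 4)"
  have "map Bit (pair x u) = concat (map (\<lambda>b. [Bit b, Bit b]) x) @ Bit False # Bit True # map Bit u"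
    by (simp add: pair_def map_concat comp_def)
  then have "sem split_cmd (?s, []) =
      for_loop f 1 (concat (map (\<lambda>b. [Bit b, Bit b]) x) @ Bit False # Bit True # map Bit u) (?s, [])"
    by (simp add: split_cmd_def f_def input_store_def)
  also have "\<dots> = for_loop f 1 (Bit False # Bit True # map Bit u) (?s1, [])"
    by (rule first) (auto simp: input_store_def)
  also have "\<dots> = for_loop f 1 (map Bit u) (?s1(2 := [Bit False], 3 := [Bit True]), [])"
    by (rule sep) (auto simp: input_store_def)
  also have "\<dots> = ((?s1(2 := [Bit False], 3 := [Bit True]))
      (1 := [], 5 := rev (map Bit u) @ (?s1(2 := [Bit False], 3 := [Bit True])) 5), [])"
    by (rule second) simp
  finally show ?thesis
    by (auto simp: input_store_def fun_eq_iff)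
qed

subsection \<open>Recognising formulas\<close>

fun sg :: "literal \<Rightarrow> bool" where
  "sg (Pos j) = True"
| "sg (Neg j) = False"

fun vr :: "literal \<Rightarrow> nat" where
  "vr (Pos j) = j"
| "vr (Neg j) = j"

lemma encode_literal_eq: "encode_literal l = [True, sg l] @ digits (binary (vr l))"
  by (cases l) (auto simp: encode_index_def digits_def)

fun lits :: "clause3 \<Rightarrow> literal list" where
  "lits (a, b, c) = [a, b, c]"

lemma encode_lits: "encode \<phi> = concat (map encode_literal (concat (map lits \<phi>)))"
  by (induction \<phi>) (auto simp: encode_def)

lemma length_3_lits: "3 dvd length ls \<Longrightarrow> \<exists>\<phi>. ls = concat (map lits \<phi>)"
proof (induction "length ls" arbitrary: ls rule: less_induct)
  case less
  show ?case
  proof (cases "ls = []")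
    case True
    then have "ls = concat (map lits [])" by simp
    then show ?thesis ..
  next
    case False
    with less.prems have "length ls \<ge> 3"
      by (auto dest: dvd_imp_le)
    then obtain a b c r where ls: "ls = a # b # c # r"
      by (metis Suc_le_length_iff numeral_3_eq_3)
    have "3 dvd length r"
      using less.prems by (simp add: ls) presburger
    then obtain \<phi> where "r = concat (map lits \<phi>)"
      using less.hyps[of r] ls by auto
    then have "ls = concat (map lits ((a, b, c) # \<phi>))"
      by (simp add: ls)
    then show ?thesis ..
  qed
qed

definition digit_syms :: "bool list \<Rightarrow> sym list" where
  "digit_syms ds = concat (map (\<lambda>d. [Bit d, Bit False]) ds)"

lemma digit_syms_simps [simp]: "digit_syms [] = []"
  "digit_syms (d # ds) = Bit d # Bit False # digit_syms ds"
  "digit_syms (ds @ es) = digit_syms ds @ digit_syms es"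
  by (simp_all add: digit_syms_def)

lemma rev_digits: "rev (map Bit (digits ds)) = digit_syms (rev ds)"
  by (induction ds) auto

text \<open>A literal as met from its end: most significant digit first, and in each character the
  value before the type.\<close>

definition lit_syms :: "literal \<Rightarrow> sym list" where
  "lit_syms l = digit_syms (rev (binary (vr l))) @ [Bit (sg l), Bit True]"

lemma rev_encode_literal: "rev (map Bit (encode_literal l)) = lit_syms l"
  by (simp add: encode_literal_eq lit_syms_def rev_digits)

lemma rev_encode:
  "rev (map Bit (encode \<phi>)) = concat (map lit_syms (rev (concat (map lits \<phi>))))"
proof -
  have "rev (map Bit (concat (map encode_literal ls))) = concat (map lit_syms (rev ls))" for ls
    by (induction ls) (auto simp: rev_encode_literal)
  then show ?thesis
    by (simp add: encode_lits)
qed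

definition cnt :: "nat \<Rightarrow> sym list" where
  "cnt n = (if n mod 3 = 0 then [] else if n mod 3 = 1 then [Bit False] else [Bit True, Bit False])"

definition cnt_next :: "sym list \<Rightarrow> sym list" where
  "cnt_next xs = (if is_bit True (top_of xs) then [] else Bit (top_of xs \<noteq> None) # xs)"

lemma cnt_next: "cnt_next (cnt n) = cnt (Suc n)"
proof -
  have "n mod 3 = 0 \<or> n mod 3 = 1 \<or> n mod 3 = 2"
    by presburger
  then show ?thesis
    by (auto simp: cnt_def cnt_next_def is_bit_def mod_Suc)
qed

lemma is_bit_None [simp]: "\<not> is_bit b None"
  by (simp add: is_bit_def)

lemma top_of_None [simp]: "top_of xs = None \<longleftrightarrow> xs = []"
  by (cases xs) auto

lemma top_of_Some [simp]: "(\<exists>y. top_of xs = Some y) \<longleftrightarrow> xs \<noteq> []"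
  by (cases xs) auto

abbreviation valid_loop :: "sym list \<Rightarrow> state \<Rightarrow> state" where
  "valid_loop \<equiv> for_loop (sem valid_body) 7"

lemma valid_digit:
  assumes "s 8 = []"
  shows "valid_loop (Bit d # Bit False # z) (s, out) = valid_loop z
    (s(6 := if s 9 = [] \<and> \<not> d then Bit True # s 6 else s 6, 9 := Bit d # s 9), out)"
proof -
  have "sem valid_body (s(7 := y # z), out) = (s(7 := y # z, 8 := [y]), out)" for y z
    using assms by (auto simp: valid_body_def read_sym_def fun_eq_iff)
  moreover have "sem valid_body (s(7 := Bit False # z, 8 := [Bit d]), out) =
    (s(7 := Bit False # z, 6 := if s 9 = [] \<and> \<not> d then Bit True # s 6 else s 6, 9 := Bit d # s 9), out)"
    using assms by (auto simp: valid_body_def read_sym_def fail_def fun_eq_iff)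
  ultimately have "valid_loop (Bit d # Bit False # z) (s, out) = valid_loop z
    (s(7 := Bit False # z, 6 := if s 9 = [] \<and> \<not> d then Bit True # s 6 else s 6, 9 := Bit d # s 9), out)"
    by (simp add: fun_upd_twist[of 8 7])
  also have "\<dots> = valid_loop z
    (s(6 := if s 9 = [] \<and> \<not> d then Bit True # s 6 else s 6, 9 := Bit d # s 9), out)"
    by (rule for_loop_cong) auto
  finally show ?thesis .
qed

lemma valid_sign:
  assumes "s 8 = []"
  shows "valid_loop (Bit d # Bit True # z) (s, out) =
    valid_loop z (s(9 := [], 10 := cnt_next (s 10)), out)"
proof -
  have "sem valid_body (s(7 := y # z), out) = (s(7 := y # z, 8 := [y]), out)" for y z
    using assms by (auto simp: valid_body_def read_sym_def fun_eq_iff)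
  moreover have "sem valid_body (s(7 := Bit True # z, 8 := [Bit d]), out) =
    (s(7 := Bit True # z, 9 := [], 10 := cnt_next (s 10)), out)"
    using assms by (auto simp: valid_body_def count3_def cnt_next_def fun_eq_iff)
  ultimately have "valid_loop (Bit d # Bit True # z) (s, out) =
      valid_loop z (s(7 := Bit True # z, 9 := [], 10 := cnt_next (s 10)), out)"
    by (simp add: fun_upd_twist[of 8 7])
  also have "\<dots> = valid_loop z (s(9 := [], 10 := cnt_next (s 10)), out)"
    by (rule for_loop_cong) auto
  finally show ?thesis .
qed

lemma valid_digits:
  assumes "s 8 = []" "s 9 \<noteq> [] \<or> ds = [] \<or> hd ds"
  shows "valid_loop (digit_syms ds @ z) (s, out) =
    valid_loop z (s(9 := rev (map Bit ds) @ s 9), out)"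
  using assms
proof (induction ds arbitrary: s)
  case (Cons d ds)
  have "s(6 := if s 9 = [] \<and> \<not> d then Bit True # s 6 else s 6) = s"
    using Cons.prems by (auto simp: fun_upd_idem)
  then have "valid_loop (digit_syms (d # ds) @ z) (s, out) =
      valid_loop (digit_syms ds @ z) (s(9 := Bit d # s 9), out)"
    using valid_digit[where s = s, OF Cons.prems(1)] by (simp del: for_loop.simps)
  also have "\<dots> = valid_loop z ((s(9 := Bit d # s 9))(9 := rev (map Bit ds) @ (s(9 := Bit d # s 9)) 9), out)"
    by (rule Cons.IH) (use Cons.prems in auto)
  also have "\<dots> = valid_loop z (s(9 := rev (map Bit (d # ds)) @ s 9), out)"
    by (intro for_loop_cong) auto
  finally show ?case .
qed (simp add: fun_upd_idem)

lemma last_binary: "binary n = [] \<or> last (binary n)"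
proof (induction n rule: binary.induct)
  case (1 n)
  show ?case
  proof (cases "n = 0 \<or> n = 1")
    case True
    then show ?thesis by (auto simp: binary.simps[of 0] binary.simps[of "Suc 0"])
  next
    case False
    then have "binary n = odd n # binary (n div 2)"
      by (subst binary.simps) auto
    moreover have "n div 2 \<noteq> 0"
      using False by presburger
    ultimately show ?thesis
      using 1 False binary.simps[of "n div 2"] by auto
  qed
qed

lemma valid_literals:
  assumes "s 8 = []" "s 9 = []" "s 10 = cnt k"
  shows "valid_loop (concat (map lit_syms ls)) (s, out) = (s(7 := [], 10 := cnt (k + length ls)), out)"
  using assms
proof (induction ls arbitrary: s k)
  case Nil
  then show ?case by (auto simp: fun_eq_iff)
next
  case (Cons l ls)
  have 1: "hd (rev (binary (vr l)))" if "binary (vr l) \<noteq> []"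
    using last_binary[of "vr l"] that by (simp add: hd_rev)
  let ?z = "concat (map lit_syms ls)"
  have "valid_loop (concat (map lit_syms (l # ls))) (s, out) =
      valid_loop (Bit (sg l) # Bit True # ?z) (s(9 := map Bit (binary (vr l))), out)"
    using valid_digits[of s "rev (binary (vr l))" "Bit (sg l) # Bit True # ?z" out] Cons.prems 1
    by (auto simp: lit_syms_def rev_map simp del: for_loop.simps)
  also have "\<dots> = valid_loop ?z (s(9 := [], 10 := cnt (Suc k)), out)"
    using valid_sign[of "s(9 := map Bit (binary (vr l)))"] Cons.prems by (simp add: cnt_next del: for_loop.simps)
  also have "\<dots> = ((s(9 := [], 10 := cnt (Suc k)))(7 := [], 10 := cnt (Suc k + length ls)), out)"
    by (rule Cons.IH) (use Cons.prems in auto)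
  also have "\<dots> = (s(7 := [], 10 := cnt (k + length (l # ls))), out)"
    using Cons.prems by (auto simp: fun_eq_iff)
  finally show ?case .
qed

lemma valid_loop_fail: "s 6 \<noteq> [] \<Longrightarrow> fst (valid_loop z (s, out)) 6 \<noteq> []"
proof -
  have "grows 6 valid_body"
    by (simp add: cmd_defs)
  then have "fst st 6 \<noteq> [] \<Longrightarrow> fst (valid_loop z st) 6 \<noteq> []" for st
    by (induction z arbitrary: st) (auto simp: grows_sem)
  then show "s 6 \<noteq> [] \<Longrightarrow> fst (valid_loop z (s, out)) 6 \<noteq> []"
    by simp
qed

text \<open>\<open>y\<close> is the part already read: digits whose sign is still to come, then
  complete literals. Once set, the flag stays set, so an empty flag at the end means that every
  check on the way succeeded.\<close>

lemma valid_loop_sound: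
  assumes "s 8 = []" "y = digits ds @ concat (map encode_literal ls)" "s 9 = map Bit ds"
    "ds = [] \<or> last ds" "s 10 = cnt (length ls)"
    and "s' = fst (valid_loop (map Bit z) (s, out))" "s' 6 = []" "s' 8 = []" "s' 9 = []" "s' 10 = []"
  shows "\<exists>\<phi>. rev z @ y = encode \<phi>"
  using assms
\<comment> \<open>Two symbols at a time make one character; a single one left over would stay in
  register 8.\<close>
proof (induction z arbitrary: s y ds ls rule: induct_list012)
  case 1
  then have "ds = []" "cnt (length ls) = []"
    by auto
  then have "3 dvd length ls"
    by (auto simp: cnt_def split: if_splits)
  then show ?case
    using length_3_lits[of ls] 1 \<open>ds = []\<close> by (auto simp: encode_lits)
next
  case (2 b)
  then show ?case
    by (auto simp: valid_body_def read_sym_def)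
next
  case (3 b t z)
  show ?case
  proof (cases t)
    case False
    let ?s = "s(6 := if s 9 = [] \<and> \<not> b then Bit True # s 6 else s 6, 9 := Bit b # s 9)"
    have s': "s' = fst (valid_loop (map Bit z) (?s, out))"
      using "3.prems"(6) False valid_digit[where s = s, OF "3.prems"(1)] by (simp del: for_loop.simps)
    then have "?s 6 = []"
      using valid_loop_fail[of ?s] "3.prems"(7) by metis
    then have "s 9 \<noteq> [] \<or> b"
      by (auto split: if_splits)
    then have "\<exists>\<phi>. rev z @ (False # b # y) = encode \<phi>"
      by (intro "3.IH"(1)[OF _ _ _ _ _ s' "3.prems"(7-10), where ds = "b # ds" and ls = ls])
        (use "3.prems"(1-5) in auto)
    then show ?thesis
      using False by simp
  next
    case True
    let ?s = "s(9 := [], 10 := cnt_next (s 10))"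
    have s': "s' = fst (valid_loop (map Bit z) (?s, out))"
      using "3.prems"(6) True valid_sign[where s = s, OF "3.prems"(1)] by (simp del: for_loop.simps)
    \<comment> \<open>A sign completes an index: digits that are empty or end in 1 are the
      \<open>binary\<close> word of a number.\<close>
    have "[True, b] @ digits ds = encode_literal (mk b (num ds))"
      using "3.prems"(4) by (simp add: encode_mk binary_num)
    then have "\<exists>\<phi>. rev z @ (True # b # y) = encode \<phi>"
      by (intro "3.IH"(1)[OF _ _ _ _ _ s' "3.prems"(7-10), where ds = "[]" and ls = "mk b (num ds) # ls"])
        (use "3.prems"(1-5) in \<open>auto simp: cnt_next\<close>)
    then show ?thesis
      using True by simp
  qed
qed

lemma sem_valid:
  assumes s: "s 4 = rev (map Bit x)" "s 6 = []" "s 8 = []" "s 9 = []" "s 10 = []"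
  shows "fst (sem valid_cmd (s, out)) 6 = [] \<longleftrightarrow> (\<exists>\<phi>. x = encode \<phi>)"
proof -
  let ?s = "fst (valid_loop (rev (map Bit x)) (s, out))"
  have *: "fst (sem valid_cmd (s, out)) 6 = [] \<longleftrightarrow> ?s 6 = [] \<and> ?s 8 = [] \<and> ?s 9 = [] \<and> ?s 10 = []"
    using s by (auto simp: valid_cmd_def fail_unless_empty_def fail_def)
  show ?thesis
  proof
    assume "fst (sem valid_cmd (s, out)) 6 = []"
    then show "\<exists>\<phi>. x = encode \<phi>"
      using valid_loop_sound[of s "[]" "[]" "[]" ?s "rev x" out] s * by (auto simp: rev_map cnt_def)
  next
    assume "\<exists>\<phi>. x = encode \<phi>"
    then obtain \<phi> where x: "x = encode \<phi>" ..
    have "length (concat (map lits \<phi>)) = 3 * length \<phi>"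
      by (induction \<phi>) auto
    then have "?s = s(7 := [], 10 := [])"
      using valid_literals[of s 0 "rev (concat (map lits \<phi>))" out] s x
      by (simp add: rev_encode cnt_def)
    then show "fst (sem valid_cmd (s, out)) 6 = []"
      using * s by simp
  qed
qed

subsection \<open>Scanning the clauses\<close>

declare add_2_eq_Suc [simp del] add_2_eq_Suc' [simp del]

abbreviation index_syms :: "literal \<Rightarrow> sym list" where
  "index_syms l \<equiv> map Bit (binary (vr l))"

definition lit_word :: "literal \<Rightarrow> sym list" where
  "lit_word l = Sgn (sg l) # index_syms l"

fun clause_word :: "clause3 \<Rightarrow> sym list" where
  "clause_word (a, b, c) = lit_word a @ lit_word b @ lit_word c"

text \<open>The certificate bit of the \<open>m\<close>-th literal; a certificate that is too short
  is read as if continued by \<open>False\<close>.\<close>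

definition mark :: "sym list \<Rightarrow> nat \<Rightarrow> bool" where
  "mark us m \<longleftrightarrow> is_bit True (top_of (drop m us))"

abbreviation scan_loop :: "nat \<Rightarrow> cmd \<Rightarrow> sym list \<Rightarrow> state \<Rightarrow> state" where
  "scan_loop b K \<equiv> for_loop (sem (scan_body b K)) (b + 2)"

lemma scan_first:
  "s (b + 3) = [] \<Longrightarrow>
    sem (scan_body b K) (s(b + 2 := y # z), out) = (s(b + 2 := y # z, b + 3 := [y]), out)"
  by (auto simp: scan_body_def read_sym_def fun_eq_iff)

lemma scan_digit:
  assumes "s (b + 3) = []"
  shows "scan_loop b K (Bit d # Bit False # z) (s, out) = scan_loop b K z
    (s(b + 4 := Bit d # s (b + 4), b + 5 := Bit d # s (b + 5), b + 6 := Bit d # s (b + 6),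
       b + 7 := Bit d # s (b + 7)), out)"
proof -
  let ?s = "s(b + 4 := Bit d # s (b + 4), b + 5 := Bit d # s (b + 5), b + 6 := Bit d # s (b + 6),
       b + 7 := Bit d # s (b + 7))"
  have "sem (scan_body b K) (s(b + 2 := Bit False # z, b + 3 := [Bit d]), out) =
      (?s(b + 2 := Bit False # z), out)"
    using assms by (auto simp: scan_body_def read_sym_def fun_eq_iff)
  then have "scan_loop b K (Bit d # Bit False # z) (s, out) =
      scan_loop b K z (?s(b + 2 := Bit False # z), out)"
    using scan_first[of s b K "Bit d" "Bit False # z" out] assms
    by (simp add: fun_upd_twist[of "b + 3" "b + 2"])
  also have "\<dots> = scan_loop b K z (?s, out)"
    by (rule for_loop_cong) simp
  finally show ?thesis .
qed

lemma scan_digits: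
  assumes "s (b + 3) = []"
  shows "scan_loop b K (digit_syms ds @ z) (s, out) = scan_loop b K z
    (s(b + 4 := rev (map Bit ds) @ s (b + 4), b + 5 := rev (map Bit ds) @ s (b + 5),
       b + 6 := rev (map Bit ds) @ s (b + 6), b + 7 := rev (map Bit ds) @ s (b + 7)), out)"
  using assms
proof (induction ds arbitrary: s)
  case Nil
  have "s(b + 4 := s (b + 4), b + 5 := s (b + 5), b + 6 := s (b + 6), b + 7 := s (b + 7)) = s"
    by simp
  then show ?case by simp
next
  case (Cons d ds)
  let ?s = "s(b + 4 := Bit d # s (b + 4), b + 5 := Bit d # s (b + 5), b + 6 := Bit d # s (b + 6),
       b + 7 := Bit d # s (b + 7))"
  have "scan_loop b K (digit_syms (d # ds) @ z) (s, out) =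
      scan_loop b K (digit_syms ds @ z) (?s, out)"
    using scan_digit[where s = s and b = b, OF Cons.prems] by (simp del: for_loop.simps)
  also have "\<dots> = scan_loop b K z
    (?s(b + 4 := rev (map Bit ds) @ ?s (b + 4), b + 5 := rev (map Bit ds) @ ?s (b + 5),
       b + 6 := rev (map Bit ds) @ ?s (b + 6), b + 7 := rev (map Bit ds) @ ?s (b + 7)), out)"
    by (rule Cons.IH) (use Cons.prems in simp)
  also have "\<dots> = scan_loop b K z
    (s(b + 4 := rev (map Bit (d # ds)) @ s (b + 4), b + 5 := rev (map Bit (d # ds)) @ s (b + 5),
       b + 6 := rev (map Bit (d # ds)) @ s (b + 6), b + 7 := rev (map Bit (d # ds)) @ s (b + 7)), out)"
    by (rule for_loop_cong) simp
  finally show ?case .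
qed

text \<open>The store on which \<open>K\<close> is called for the literal \<open>l\<close>, apart
  from the loop register \<open>b + 2\<close>.\<close>

definition scan_pre :: "nat \<Rightarrow> literal \<Rightarrow> store \<Rightarrow> store" where
  "scan_pre b l s = s(b + 3 := [Bit (sg l)],
     b + 4 := Sgn (sg l = mark (s (b + 9)) 0) # index_syms l,
     b + 5 := Sgn (sg l \<noteq> mark (s (b + 9)) 0) # index_syms l,
     b + 6 := lit_word l @ s (b + 6), b + 7 := lit_word (negate l) @ s (b + 7),
     b + 8 := (if mark (s (b + 9)) 0 then Bit True # s (b + 8) else s (b + 8)),
     b + 9 := tl (s (b + 9)))"

lemma negate_sg [simp]: "sg (negate l) = (\<not> sg l)" "vr (negate l) = vr l"
  by (cases l; simp)+

lemma is_bit_the: "is_bit c x \<Longrightarrow> the x = Bit c"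
  by (simp add: is_bit_def)

lemma scan_literal:
  assumes s: "s (b + 3) = []" "s (b + 4) = []" "s (b + 5) = []"
    and K: "b + 3 \<notin> mods K"
  obtains s1 where "\<And>r. r \<noteq> b + 2 \<Longrightarrow> s1 r = scan_pre b l s r"
    "scan_loop b K (lit_syms l @ z) (s, out) = scan_loop b K z
       ((fst (sem K (s1, out)))(b + 3 := [], b + 4 := [], b + 5 := []), snd (sem K (s1, out)))"
proof -
  let ?w = "index_syms l"
  let ?s = "s(b + 4 := ?w, b + 5 := ?w, b + 6 := ?w @ s (b + 6), b + 7 := ?w @ s (b + 7))"
  define s1 where "s1 = (scan_pre b l s)(b + 2 := Bit True # z)"
  let ?st = "sem K (s1, out)"
  have "scan_loop b K (lit_syms l @ z) (s, out) =
      scan_loop b K (Bit (sg l) # Bit True # z) (?s, out)"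
    using scan_digits[of s b K "rev (binary (vr l))" "Bit (sg l) # Bit True # z" out] s
    by (simp add: lit_syms_def rev_map del: for_loop.simps)
  also have "\<dots> = scan_loop b K z (sem (scan_body b K) (?s(b + 2 := Bit True # z, b + 3 := [Bit (sg l)]), out))"
    using scan_first[of ?s b K "Bit (sg l)" "Bit True # z" out] s
    by (simp add: fun_upd_twist[of "b + 3" "b + 2"])
  also have "sem (scan_body b K) (?s(b + 2 := Bit True # z, b + 3 := [Bit (sg l)]), out) =
      ((fst ?st)(b + 4 := [], b + 5 := [], b + 3 := tl (fst ?st (b + 3))), snd ?st)"
  proof -
    define c where "c = Push (\<lambda>h m. Sgn (is_bit True h = is_bit True m)) (b + 3) (b + 9) (b + 4) ;;
        Push (\<lambda>h m. Sgn (is_bit True h \<noteq> is_bit True m)) (b + 3) (b + 9) (b + 5) ;;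
        Push (\<lambda>h _. Sgn (is_bit True h)) (b + 3) (b + 3) (b + 6) ;;
        Push (\<lambda>h _. Sgn (\<not> is_bit True h)) (b + 3) (b + 3) (b + 7) ;;
        If (\<lambda>m _. is_bit True m) (b + 9) (b + 9) (read_sym (b + 9) (b + 8)) Nop ;;
        Pop (b + 9)"
    have "sem c (?s(b + 2 := Bit True # z, b + 3 := [Bit (sg l)]), out) = (s1, out)"
      by (auto simp: c_def read_sym_def s1_def scan_pre_def lit_word_def mark_def is_bit_the fun_eq_iff)
    moreover have "sem (scan_body b K) (?s(b + 2 := Bit True # z, b + 3 := [Bit (sg l)]), out) =
        sem (K ;; Clear (b + 4) ;; Clear (b + 5) ;; Pop (b + 3))
          (sem c (?s(b + 2 := Bit True # z, b + 3 := [Bit (sg l)]), out))"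
      by (simp add: scan_body_def c_def)
    ultimately show ?thesis
      by simp
  qed
  also have "fst ?st (b + 3) = [Bit (sg l)]"
    using sem_frame[OF K, of "(s1, out)"] by (simp add: s1_def scan_pre_def)
  also have "scan_loop b K z ((fst ?st)(b + 4 := [], b + 5 := [], b + 3 := tl [Bit (sg l)]), snd ?st) =
      scan_loop b K z ((fst ?st)(b + 3 := [], b + 4 := [], b + 5 := []), snd ?st)"
    by (rule for_loop_cong) simp
  finally have "scan_loop b K (lit_syms l @ z) (s, out) = scan_loop b K z
       ((fst ?st)(b + 3 := [], b + 4 := [], b + 5 := []), snd ?st)" .
  moreover have "\<And>r. r \<noteq> b + 2 \<Longrightarrow> s1 r = scan_pre b l s r"
    by (simp add: s1_def)
  ultimately show ?thesis
    using that by blast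
qed

lemma sem_scan:
  assumes "b \<ge> 10"
  obtains s0 where "\<And>r. r \<in> {b + 3..<b + 9} \<union> {b + 10} \<Longrightarrow> s0 r = []" "s0 (b + 9) = s 5"
    "\<And>r. r \<notin> {b + 2..<b + 11} \<Longrightarrow> s0 r = s r"
    "sem (scan b K) (s, out) = scan_loop b K (s 4) (s0, out)"
proof -
  define s0 where "s0 = s(b + 3 := [], b + 4 := [], b + 5 := [], b + 6 := [], b + 7 := [],
    b + 8 := [], b + 10 := [], b + 9 := s 5)"
  have "sem (scan b K) (s, out) = scan_loop b K (s 4) (s0, out)"
    using assms by (simp add: scan_def s0_def)
  moreover have "s0 r = []" if "r \<in> {b + 3..<b + 9} \<union> {b + 10}" for r
  proof -
    have "r = b + 3 \<or> r = b + 4 \<or> r = b + 5 \<or> r = b + 6 \<or> r = b + 7 \<or> r = b + 8 \<or> r = b + 10"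
      using that by auto
    then show ?thesis by (auto simp: s0_def)
  qed
  moreover have "s0 (b + 9) = s 5" "r \<notin> {b + 2..<b + 11} \<Longrightarrow> s0 r = s r" for r
    by (auto simp: s0_def)
  ultimately show ?thesis
    using that by blast
qed

text \<open>An invariant rule: \<open>J m\<close> describes the store after \<open>m\<close> calls
  of \<open>K\<close>. It must be insensitive to the registers of the scan, which change between the
  calls.\<close>

lemma scan_literals:
  assumes b: "b \<ge> 10" and s: "s 4 = concat (map lit_syms ls)" "s 5 = us"
    and K: "mods K \<inter> {b + 2, b + 3, b + 4, b + 5, b + 9} = {}"
    and J0: "J 0 s"
    and J: "\<And>m s s'. J m s \<Longrightarrow> (\<And>r. r \<notin> {b + 2..<b + 11} \<Longrightarrow> s' r = s r) \<Longrightarrow> J m s'"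
    and step: "\<And>m s out. m < length ls \<Longrightarrow> J m s \<Longrightarrow>
      s (b + 4) = Sgn (sg (ls ! m) = mark us m) # index_syms (ls ! m) \<Longrightarrow>
      s (b + 5) = Sgn (sg (ls ! m) \<noteq> mark us m) # index_syms (ls ! m) \<Longrightarrow>
      J (Suc m) (fst (sem K (s, out)))"
  shows "J (length ls) (fst (sem (scan b K) (s, out)))"
proof -
  have loop: "J (length ls) (fst (scan_loop b K (concat (map lit_syms (drop m ls))) (s, out)))"
    if "m \<le> length ls" "J m s" "s (b + 3) = []" "s (b + 4) = []" "s (b + 5) = []"
      "s (b + 9) = drop m us" for m s out
    using that
  proof (induction "length ls - m" arbitrary: m s out)
    case 0
    then show ?case
      by (auto elim!: J)
  next
    case (Suc n)
    then have m: "m < length ls" by simp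
    then have drop: "drop m ls = ls ! m # drop (Suc m) ls"
      by (simp add: Cons_nth_drop_Suc)
    obtain s1 where s1: "\<And>r. r \<noteq> b + 2 \<Longrightarrow> s1 r = scan_pre b (ls ! m) s r"
      "scan_loop b K (lit_syms (ls ! m) @ concat (map lit_syms (drop (Suc m) ls))) (s, out) =
       scan_loop b K (concat (map lit_syms (drop (Suc m) ls)))
       ((fst (sem K (s1, out)))(b + 3 := [], b + 4 := [], b + 5 := []), snd (sem K (s1, out)))"
      using scan_literal[of s b K] Suc.prems K by blast
    have mark: "mark (s (b + 9)) 0 = mark us m"
      by (simp add: Suc.prems mark_def)
    have "J m s1"
      using Suc.prems(2) by (rule J) (auto simp: s1(1) scan_pre_def)
    then have "J (Suc m) (fst (sem K (s1, out)))"
      by (rule step[OF m]) (use s1(1) mark in \<open>simp_all add: scan_pre_def\<close>)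
    then have "J (Suc m) ((fst (sem K (s1, out)))(b + 3 := [], b + 4 := [], b + 5 := []))"
      by (rule J) auto
    moreover have "fst (sem K (s1, out)) (b + 9) = drop (Suc m) us"
      using sem_frame[of "b + 9" K "(s1, out)"] K s1(1) Suc.prems
      by (simp add: scan_pre_def tl_drop drop_Suc)
    ultimately show ?case
      unfolding drop list.map concat.simps s1(2) using Suc.hyps(2) m
      by (intro Suc.hyps(1)) auto
  qed
  obtain s0 where s0: "\<And>r. r \<in> {b + 3..<b + 9} \<union> {b + 10} \<Longrightarrow> s0 r = []" "s0 (b + 9) = s 5"
    "\<And>r. r \<notin> {b + 2..<b + 11} \<Longrightarrow> s0 r = s r"
    "sem (scan b K) (s, out) = scan_loop b K (s 4) (s0, out)"
    using sem_scan[OF b] by blast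
  have "J 0 s0"
    using J0 by (rule J) (rule s0(3))
  then show ?thesis
    using loop[of 0 s0 out] s s0 by simp
qed

text \<open>Only the third of the three calls of \<open>clause_step\<close> runs \<open>K\<close>.
  By then the clause stands in its written order, since the backward scan puts each literal in front
  of the previous ones.\<close>

lemma scan_clause:
  assumes s: "\<And>r. r \<in> {b + 3..<b + 9} \<union> {b + 10} \<Longrightarrow> s r = []"
    and K: "mods K \<inter> {b + 2..<b + 11} = {}"
  obtains s1 s2 where "\<And>r. r \<notin> {b + 2..<b + 11} \<Longrightarrow> s1 r = s r"
    "s1 (b + 6) = clause_word C" "s1 (b + 7) = clause_word (mirror C)"
    "s1 (b + 8) = [] \<longleftrightarrow> (\<forall>i<3. \<not> mark (s (b + 9)) i)"
    "\<And>r. r \<in> {b + 3..<b + 9} \<union> {b + 10} \<Longrightarrow> s2 r = []" "s2 (b + 9) = drop 3 (s (b + 9))"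
    "\<And>r. r \<notin> {b + 2..<b + 11} \<Longrightarrow> s2 r = fst (sem K (s1, out)) r"
    "scan_loop b (clause_step b K) (concat (map lit_syms (rev (lits C))) @ z) (s, out) =
     scan_loop b (clause_step b K) z (s2, snd (sem K (s1, out)))"
proof -
  obtain l1 l2 l3 where C: "C = (l3, l2, l1)"
    by (cases C)
  let ?K = "clause_step b K"
  have regs: "s (b + 3) = []" "s (b + 4) = []" "s (b + 5) = []" "s (b + 6) = []" "s (b + 7) = []"
    "s (b + 8) = []" "s (b + 10) = []"
    by (rule s; simp)+
  have fr: "b + 3 \<notin> mods ?K"
    using K by (auto simp: clause_step_def count3_def)
  obtain a1 where a1: "\<And>r. r \<noteq> b + 2 \<Longrightarrow> a1 r = scan_pre b l1 s r"
    "scan_loop b ?K (lit_syms l1 @ lit_syms l2 @ lit_syms l3 @ z) (s, out) =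
     scan_loop b ?K (lit_syms l2 @ lit_syms l3 @ z)
       ((fst (sem ?K (a1, out)))(b + 3 := [], b + 4 := [], b + 5 := []), snd (sem ?K (a1, out)))"
    using scan_literal[OF regs(1-3) fr] by blast
  have K1: "sem ?K (a1, out) = (a1(b + 10 := [Bit False]), out)"
    using regs a1(1) by (simp add: clause_step_def count3_def scan_pre_def)
  define t1 where "t1 = a1(b + 10 := [Bit False], b + 3 := [], b + 4 := [], b + 5 := [])"
  have t1: "t1 (b + 3) = []" "t1 (b + 4) = []" "t1 (b + 5) = []"
    by (simp_all add: t1_def)
  obtain a2 where a2: "\<And>r. r \<noteq> b + 2 \<Longrightarrow> a2 r = scan_pre b l2 t1 r"
    "scan_loop b ?K (lit_syms l2 @ lit_syms l3 @ z) (t1, out) =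
     scan_loop b ?K (lit_syms l3 @ z)
       ((fst (sem ?K (a2, out)))(b + 3 := [], b + 4 := [], b + 5 := []), snd (sem ?K (a2, out)))"
    using scan_literal[OF t1 fr] by blast
  have K2: "sem ?K (a2, out) = (a2(b + 10 := [Bit True, Bit False]), out)"
    using a2(1) by (simp add: clause_step_def count3_def scan_pre_def t1_def)
  define t2 where "t2 = a2(b + 10 := [Bit True, Bit False], b + 3 := [], b + 4 := [], b + 5 := [])"
  have t2: "t2 (b + 3) = []" "t2 (b + 4) = []" "t2 (b + 5) = []"
    by (simp_all add: t2_def)
  obtain a3 where a3: "\<And>r. r \<noteq> b + 2 \<Longrightarrow> a3 r = scan_pre b l3 t2 r"
    "scan_loop b ?K (lit_syms l3 @ z) (t2, out) = scan_loop b ?K z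
       ((fst (sem ?K (a3, out)))(b + 3 := [], b + 4 := [], b + 5 := []), snd (sem ?K (a3, out)))"
    using scan_literal[OF t2 fr] by blast
  have K3: "sem ?K (a3, out) = ((fst (sem K (a3, out)))(b + 6 := [], b + 7 := [], b + 8 := [], b + 10 := []),
      snd (sem K (a3, out)))"
    using a3(1) by (simp add: clause_step_def count3_def scan_pre_def t2_def)
  define t3 where "t3 = (fst (sem K (a3, out)))(b + 6 := [], b + 7 := [], b + 8 := [], b + 10 := [],
    b + 3 := [], b + 4 := [], b + 5 := [])"
  have eq: "scan_loop b ?K (concat (map lit_syms (rev (lits C))) @ z) (s, out) =
      scan_loop b ?K z (t3, snd (sem K (a3, out)))"
    by (simp add: C a1(2) K1 a2(2)[unfolded t1_def] K2 a3(2)[unfolded t2_def] K3 t3_def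
        del: for_loop.simps)
  have tl3: "tl (tl (tl xs)) = drop 3 xs" for xs :: "sym list"
    by (simp add: drop_Suc numeral_3_eq_3 tl_drop)
  have marks: "mark (tl xs) i = mark xs (Suc i)" for xs i
    by (simp add: mark_def drop_Suc)
  have less3: "(\<forall>i<3. P i) \<longleftrightarrow> P 0 \<and> P (Suc 0) \<and> P (Suc (Suc 0))" for P
    by (auto simp: numeral_3_eq_3 less_Suc_eq)
  have rest: "a3 r = s r" if "r \<notin> {b + 2..<b + 11}" for r
    using that a1(1)[of r] a2(1)[of r] a3(1)[of r] by (auto simp: scan_pre_def t1_def t2_def)
  have "t3 r = []" if "r \<in> {b + 3..<b + 9} \<union> {b + 10}" for r
  proof -
    have "r = b + 3 \<or> r = b + 4 \<or> r = b + 5 \<or> r = b + 6 \<or> r = b + 7 \<or> r = b + 8 \<or> r = b + 10"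
      using that by auto
    then show ?thesis by (auto simp: t3_def)
  qed
  moreover have "b + 9 \<in> {b + 2..<b + 11}"
    by simp
  then have "b + 9 \<notin> mods K"
    using K by blast
  then have "fst (sem K (a3, out)) (b + 9) = a3 (b + 9)"
    by (simp add: sem_frame)
  then have "t3 (b + 9) = drop 3 (s (b + 9))"
    by (simp add: t3_def a3(1) t2_def a2(1) t1_def a1(1) scan_pre_def tl3)
  moreover have "t3 r = fst (sem K (a3, out)) r" if "r \<notin> {b + 2..<b + 11}" for r
    using that by (auto simp: t3_def)
  moreover have "a3 (b + 6) = clause_word C" "a3 (b + 7) = clause_word (mirror C)"
    by (simp_all add: t3_def a3(1) t2_def a2(1) t1_def a1(1) scan_pre_def C regs)
  moreover have "a3 (b + 8) = [] \<longleftrightarrow> (\<forall>i<3. \<not> mark (s (b + 9)) i)"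
    by (simp add: t3_def a3(1) t2_def a2(1) t1_def a1(1) scan_pre_def regs marks less3)
  ultimately show ?thesis
    using that[of a3 t3] rest eq by blast
qed

lemma scan_clauses:
  assumes b: "b \<ge> 10" and s: "s 4 = concat (map lit_syms (concat (map (\<lambda>C. rev (lits C)) cs)))" "s 5 = us"
    and K: "mods K \<inter> {b + 2..<b + 11} = {}"
    and J0: "J 0 s"
    and J: "\<And>m s s'. J m s \<Longrightarrow> (\<And>r. r \<notin> {b + 2..<b + 11} \<Longrightarrow> s' r = s r) \<Longrightarrow> J m s'"
    and step: "\<And>m s out. m < length cs \<Longrightarrow> J m s \<Longrightarrow> s (b + 6) = clause_word (cs ! m) \<Longrightarrow>
      s (b + 7) = clause_word (mirror (cs ! m)) \<Longrightarrow>
      (s (b + 8) = [] \<longleftrightarrow> (\<forall>i<3. \<not> mark us (3 * m + i))) \<Longrightarrow> J (Suc m) (fst (sem K (s, out)))"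
  shows "J (length cs) (fst (sem (scan b (clause_step b K)) (s, out)))"
proof -
  let ?K = "clause_step b K" and ?X = "\<lambda>m. concat (map lit_syms (concat (map (\<lambda>C. rev (lits C)) (drop m cs))))"
  have loop: "J (length cs) (fst (scan_loop b ?K (?X m) (s, out)))"
    if "m \<le> length cs" "J m s" "\<And>r. r \<in> {b + 3..<b + 9} \<union> {b + 10} \<Longrightarrow> s r = []"
      "s (b + 9) = drop (3 * m) us" for m s out
    using that
  proof (induction "length cs - m" arbitrary: m s out)
    case 0
    then show ?case
      by (auto elim!: J)
  next
    case (Suc n)
    then have m: "m < length cs" by simp
    then have drop: "?X m = concat (map lit_syms (rev (lits (cs ! m)))) @ ?X (Suc m)"
      by (simp flip: Cons_nth_drop_Suc)
    obtain s1 s2 where s1: "\<And>r. r \<notin> {b + 2..<b + 11} \<Longrightarrow> s1 r = s r"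
      "s1 (b + 6) = clause_word (cs ! m)" "s1 (b + 7) = clause_word (mirror (cs ! m))"
      "s1 (b + 8) = [] \<longleftrightarrow> (\<forall>i<3. \<not> mark (s (b + 9)) i)"
      "\<And>r. r \<in> {b + 3..<b + 9} \<union> {b + 10} \<Longrightarrow> s2 r = []" "s2 (b + 9) = drop 3 (s (b + 9))"
      "\<And>r. r \<notin> {b + 2..<b + 11} \<Longrightarrow> s2 r = fst (sem K (s1, out)) r"
      "scan_loop b ?K (concat (map lit_syms (rev (lits (cs ! m)))) @ ?X (Suc m)) (s, out) =
       scan_loop b ?K (?X (Suc m)) (s2, snd (sem K (s1, out)))"
      using scan_clause[of b s K "cs ! m" out "?X (Suc m)", OF Suc.prems(3) K] by blast
    have "J m s1"
      using Suc.prems(2) by (rule J) (rule s1(1))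
    moreover have "s1 (b + 8) = [] \<longleftrightarrow> (\<forall>i<3. \<not> mark us (3 * m + i))"
      unfolding s1(4) Suc.prems(4) by (simp add: mark_def add.commute)
    ultimately have "J (Suc m) (fst (sem K (s1, out)))"
      using step[OF m] s1(2,3) by blast
    then have "J (Suc m) s2"
      by (rule J) (rule s1(7))
    then show ?case
      unfolding drop s1(8) using Suc.hyps(2) m s1(5,6) Suc.prems(4)
      by (intro Suc.hyps(1)) (auto simp: add.commute)
  qed
  obtain s0 where s0: "\<And>r. r \<in> {b + 3..<b + 9} \<union> {b + 10} \<Longrightarrow> s0 r = []" "s0 (b + 9) = s 5"
    "\<And>r. r \<notin> {b + 2..<b + 11} \<Longrightarrow> s0 r = s r"
    "sem (scan b ?K) (s, out) = scan_loop b ?K (s 4) (s0, out)"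
    using sem_scan[OF b] by blast
  have "J 0 s0"
    using J0 by (rule J) (rule s0(3))
  then show ?thesis
    using loop[of 0 s0 out] s s0 by simp
qed

section \<open>Consistency, mirror counts and certificates\<close>

text \<open>The variable of an occurrence with the value it receives; \<open>b = False\<close> flips
  the value, so that a conflict becomes an equality of words.\<close>

definition value_word :: "bool \<Rightarrow> sym list \<Rightarrow> literal list \<Rightarrow> nat \<Rightarrow> sym list" where
  "value_word b us ls m = Sgn ((sg (ls ! m) = mark us m) = b) # index_syms (ls ! m)"

lemma sem_inner_consistent:
  assumes s: "s 4 = concat (map lit_syms ls)" "s 5 = us"
  shows "fst (sem (scan 30 (IfEq 24 35 fail Nop)) (s, out)) 6 = [] \<longleftrightarrow>
    s 6 = [] \<and> (\<forall>m<length ls. s 24 \<noteq> value_word False us ls m)"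
proof -
  define J :: "nat \<Rightarrow> store \<Rightarrow> bool" where "J = (\<lambda>m t. t 24 = s 24 \<and>
    (t 6 = [] \<longleftrightarrow> s 6 = [] \<and> (\<forall>i<m. s 24 \<noteq> value_word False us ls i)))"
  have "J (length ls) (fst (sem (scan 30 (IfEq 24 35 fail Nop)) (s, out)))"
  proof (rule scan_literals[OF _ s])
    show "J (Suc m) (fst (sem (IfEq 24 35 fail Nop) (t, out)))"
      if "J m t" "t (30 + 5) = Sgn (sg (ls ! m) \<noteq> mark us m) # index_syms (ls ! m)" for m t out
      using that by (auto simp: J_def fail_def value_word_def less_Suc_eq)
  qed (auto simp: J_def fail_def)
  then show ?thesis
    by (simp add: J_def)
qed

lemma sem_consistent:
  assumes s: "s 4 = concat (map lit_syms ls)" "s 5 = us"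
  shows "fst (sem consistent_cmd (s, out)) 6 = [] \<longleftrightarrow> s 6 = [] \<and>
    (\<forall>i<length ls. \<forall>m<length ls. value_word True us ls i \<noteq> value_word False us ls m)"
proof -
  let ?K = "scan 30 (IfEq 24 35 fail Nop)"
  define J :: "nat \<Rightarrow> store \<Rightarrow> bool" where "J = (\<lambda>m t. t 4 = s 4 \<and> t 5 = s 5 \<and> (t 6 = [] \<longleftrightarrow> s 6 = [] \<and>
    (\<forall>i<m. \<forall>k<length ls. value_word True us ls i \<noteq> value_word False us ls k)))"
  have mods: "mods ?K = {6, 32, 33, 34, 35, 36, 37, 38, 39, 40}"
    by (auto simp: cmd_defs)
  have "J (length ls) (fst (sem (scan 20 ?K) (s, out)))"
  proof (rule scan_literals[OF _ s])
    fix m t out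
    assume "J m t" and t: "t (20 + 4) = Sgn (sg (ls ! m) = mark us m) # index_syms (ls ! m)"
    then have "t 4 = concat (map lit_syms ls)" "t 5 = us" "t 24 = value_word True us ls m"
      using s by (auto simp: J_def value_word_def)
    then show "J (Suc m) (fst (sem ?K (t, out)))"
      using \<open>J m t\<close> s sem_frame[of 4 ?K "(t, out)"] sem_frame[of 5 ?K "(t, out)"]
        sem_inner_consistent[of t ls us out]
      by (auto simp: J_def mods less_Suc_eq)
  qed (auto simp: J_def mods)
  then show ?thesis
    by (simp add: J_def consistent_cmd_def)
qed

fun sym_bits :: "sym \<Rightarrow> bool list" where
  "sym_bits (Bit b) = [False, b]"
| "sym_bits (Sgn b) = [True, b]"

text \<open>Replacing each symbol by its two-bit character gives the encoding of the clause, which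
  is injective.\<close>

lemma clause_word_inject [simp]: "clause_word C = clause_word D \<longleftrightarrow> C = D"
proof
  have "concat (map sym_bits (lit_word l)) = encode_literal l" for l
    by (simp add: lit_word_def encode_literal_eq digits_def comp_def)
  then have "concat (map sym_bits (clause_word C)) = encode [C]" for C
    by (cases C) (simp add: encode_def)
  moreover assume "clause_word C = clause_word D"
  ultimately have "encode [C] = encode [D]"
    by metis
  then show "C = D"
    using encode_inj by (auto dest: injD)
qed simp

lemma sem_inner_count:
  assumes s: "s 4 = concat (map lit_syms (concat (map (\<lambda>C. rev (lits C)) cs)))" "s 5 = us"
    and C: "s 26 = clause_word C" "s 11 = []" "s 12 = []"
  shows "fst (sem (scan 30 (clause_step 30 count_body)) (s, out)) 11 =
      replicate (count_list cs C) (Bit True)" (is ?A)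
    and "fst (sem (scan 30 (clause_step 30 count_body)) (s, out)) 12 =
      replicate (count_list cs (mirror C)) (Bit True)" (is ?B)
proof -
  define J :: "nat \<Rightarrow> store \<Rightarrow> bool" where "J = (\<lambda>m t. t 26 = s 26 \<and>
    t 11 = replicate (count_list (take m cs) C) (Bit True) \<and>
    t 12 = replicate (count_list (take m cs) (mirror C)) (Bit True))"
  have "J (length cs) (fst (sem (scan 30 (clause_step 30 count_body)) (s, out)))"
  proof (rule scan_clauses[OF _ s])
    fix m t out
    assume m: "m < length cs" and "J m t" and t: "t (30 + 6) = clause_word (cs ! m)"
      "t (30 + 7) = clause_word (mirror (cs ! m))"
    have "C = mirror (cs ! m) \<longleftrightarrow> cs ! m = mirror C"
      by auto
    moreover have "count_list (take (Suc m) cs) D = count_list (take m cs) D + (if cs ! m = D then 1 else 0)"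
      for D
      using m by (simp add: take_Suc_conv_app_nth)
    ultimately show "J (Suc m) (fst (sem count_body (t, out)))"
      using \<open>J m t\<close> t C by (auto simp: J_def count_body_def push_bit_def simp del: mirror.simps)
  qed (use C in \<open>auto simp: J_def count_body_def push_bit_def\<close>)
  then show ?A ?B
    by (simp_all add: J_def)
qed

lemma sem_clauses:
  assumes s: "s 4 = concat (map lit_syms (concat (map (\<lambda>C. rev (lits C)) cs)))" "s 5 = us"
  shows "fst (sem clauses_cmd (s, out)) 6 = [] \<longleftrightarrow> s 6 = [] \<and>
    (\<forall>m<length cs. (\<exists>i<3. mark us (3 * m + i)) \<and>
       count_list cs (cs ! m) = count_list cs (mirror (cs ! m)))"
proof -
  let ?I = "scan 30 (clause_step 30 count_body)"
  let ?K = "If (\<lambda>a _. a = None) 28 28 fail Nop ;; Clear 11 ;; Clear 12 ;; ?I ;; IfEq 11 12 Nop fail"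
  define J :: "nat \<Rightarrow> store \<Rightarrow> bool" where "J = (\<lambda>m t. t 4 = s 4 \<and> t 5 = s 5 \<and> (t 6 = [] \<longleftrightarrow> s 6 = [] \<and>
    (\<forall>k<m. (\<exists>i<3. mark us (3 * k + i)) \<and>
       count_list cs (cs ! k) = count_list cs (mirror (cs ! k)))))"
  have mods: "mods ?I = {11, 12, 32, 33, 34, 35, 36, 37, 38, 39, 40}"
    by (auto simp: cmd_defs)
  have "J (length cs) (fst (sem (scan 20 (clause_step 20 ?K)) (s, out)))"
  proof (rule scan_clauses[OF _ s])
    fix m t out
    assume J: "J m t" and t: "t (20 + 6) = clause_word (cs ! m)"
      "t (20 + 8) = [] \<longleftrightarrow> (\<forall>i<3. \<not> mark us (3 * m + i))"
    define t1 where "t1 = t(6 := if t 28 = [] then Bit True # t 6 else t 6, 11 := [], 12 := [])"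
    have K: "sem ?K (t, out) = sem (IfEq 11 12 Nop fail) (sem ?I (t1, out))"
      by (simp add: fail_def t1_def fun_upd_idem)
    obtain t2 out2 where t2: "sem ?I (t1, out) = (t2, out2)"
      by fastforce
    have "t2 11 = replicate (count_list cs (cs ! m)) (Bit True)"
      "t2 12 = replicate (count_list cs (mirror (cs ! m))) (Bit True)"
      using sem_inner_count[of t1 cs us "cs ! m" out] J s t t2 by (simp_all add: J_def t1_def)
    then have eq: "t2 11 = t2 12 \<longleftrightarrow> count_list cs (cs ! m) = count_list cs (mirror (cs ! m))"
      by (metis length_replicate)
    have keep: "t2 4 = s 4" "t2 5 = s 5" "t2 6 = t1 6"
      using sem_frame[of 4 ?I "(t1, out)"] sem_frame[of 5 ?I "(t1, out)"]
        sem_frame[of 6 ?I "(t1, out)"] J t2 by (simp_all add: mods J_def t1_def)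
    have "t1 6 = [] \<longleftrightarrow> t 6 = [] \<and> (\<exists>i<3. mark us (3 * m + i))"
      using t by (auto simp: t1_def)
    then show "J (Suc m) (fst (sem ?K (t, out)))"
      unfolding K t2 using J eq keep by (simp add: J_def fail_def All_less_Suc) blast
  qed (auto simp: J_def mods fail_def)
  then show ?thesis
    by (simp add: J_def clauses_cmd_def)
qed

text \<open>Clauses and literals are listed backwards, as the scan meets them, so clause
  \<open>m\<close> of \<open>cs\<close> owns the marks \<open>3 * m\<close> to
  \<open>3 * m + 2\<close>.\<close>

definition certifies :: "formula \<Rightarrow> sym list \<Rightarrow> bool" where
  "certifies \<phi> us \<longleftrightarrow>
     (let ls = concat (map (\<lambda>C. rev (lits C)) (rev \<phi>)); cs = rev \<phi> in
       (\<forall>i<length ls. \<forall>m<length ls. value_word True us ls i \<noteq> value_word False us ls m) \<and>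
       (\<forall>m<length cs. (\<exists>i<3. mark us (3 * m + i)) \<and>
         count_list cs (cs ! m) = count_list cs (mirror (cs ! m))))"

lemma rev_concat_lits: "rev (concat (map lits \<phi>)) = concat (map (\<lambda>C. rev (lits C)) (rev \<phi>))"
  by (induction \<phi>) auto

text \<open>If the word encodes no formula, nothing is known about what the later checks compute,
  but they cannot lower the flag raised by the first.\<close>

lemma sem_check:
  assumes s: "s 4 = rev (map Bit x)" "s 5 = us" "s 6 = []" "s 8 = []" "s 9 = []" "s 10 = []"
  shows "fst (sem check_cmd (s, out)) 6 = [] \<longleftrightarrow> (\<exists>\<phi>. x = encode \<phi> \<and> certifies \<phi> us)"
proof -
  obtain s1 out1 where 1: "sem valid_cmd (s, out) = (s1, out1)"
    by fastforce
  obtain s2 out2 where 2: "sem consistent_cmd (s1, out1) = (s2, out2)"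
    by fastforce
  have check: "sem check_cmd (s, out) = sem clauses_cmd (s2, out2)"
    by (simp add: check_cmd_def 1 2)
  have valid: "s1 6 = [] \<longleftrightarrow> (\<exists>\<phi>. x = encode \<phi>)"
    using sem_valid[of s x out] s 1 by simp
  have fail: "fst (sem clauses_cmd (s2, out2)) 6 \<noteq> []" if "s1 6 \<noteq> []"
    using grows_sem[OF grows_check(2), of "(s1, out1)"] grows_sem[OF grows_check(3), of "(s2, out2)"]
      that 2 by simp
  have keep: "s1 4 = s 4" "s1 5 = s 5"
    using sem_frame[of 4 valid_cmd "(s, out)"] sem_frame[of 5 valid_cmd "(s, out)"] 1
    by (simp_all add: cmd_defs)
  have "mods consistent_cmd = {6, 22, 23, 24, 25, 26, 27, 28, 29, 30, 32, 33, 34, 35, 36, 37, 38, 39, 40}"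
    by (auto simp: cmd_defs)
  then have keep2: "s2 4 = s 4" "s2 5 = s 5"
    using sem_frame[of 4 consistent_cmd "(s1, out1)"] sem_frame[of 5 consistent_cmd "(s1, out1)"] 2 keep
    by simp_all
  have main: "fst (sem clauses_cmd (s2, out2)) 6 = [] \<longleftrightarrow> certifies \<phi> us" if "x = encode \<phi>" for \<phi>
  proof -
    have X: "s 4 = concat (map lit_syms (concat (map (\<lambda>C. rev (lits C)) (rev \<phi>))))"
      using s that by (simp only: rev_encode rev_concat_lits)
    have "s1 6 = []"
      using valid that by blast
    then show ?thesis
      using sem_consistent[of s1 _ us out1, unfolded keep, OF X s(2)]
        sem_clauses[of s2 "rev \<phi>" us out2, unfolded keep2, OF X s(2)] 2
      unfolding certifies_def Let_def by simp
  qed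
  show ?thesis
    unfolding check using valid fail main encode_inj by (metis injD)
qed

lemma nth_clause_lits:
  "m < length cs \<Longrightarrow> i < 3 \<Longrightarrow> concat (map (\<lambda>C. rev (lits C)) cs) ! (3 * m + i) = rev (lits (cs ! m)) ! i"
proof (induction cs arbitrary: m)
  case (Cons C cs)
  obtain a b c where "C = (a, b, c)" by (cases C)
  moreover have "i = 0 \<or> i = 1 \<or> i = 2"
    using Cons.prems by auto
  ultimately show ?case
    using Cons by (cases m) auto
qed simp

lemma length_clause_lits: "length (concat (map (\<lambda>C. rev (lits C)) cs)) = 3 * length cs"
  by (induction cs) auto

lemma lit_sat_sg: "lit_sat v l \<longleftrightarrow> v (vr l) = sg l"
  by (cases l) auto

lemma clause_sat_lits: "clause_sat v C \<longleftrightarrow> (\<exists>i<3. lit_sat v (rev (lits C) ! i))"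
proof -
  have "(\<exists>i<3. P i) \<longleftrightarrow> P 0 \<or> P (Suc 0) \<or> P (Suc (Suc 0))" for P
    by (auto simp: numeral_3_eq_3 less_Suc_eq)
  then show ?thesis
    by (cases C) auto
qed

lemma symmetric_iff:
  "symmetric \<phi> \<longleftrightarrow> (\<forall>m<length (rev \<phi>). count_list (rev \<phi>) (rev \<phi> ! m) =
     count_list (rev \<phi>) (mirror (rev \<phi> ! m)))"
proof -
  have "symmetric \<phi> \<longleftrightarrow> (\<forall>C\<in>set \<phi>. count_list \<phi> C = count_list \<phi> (mirror C))"
    unfolding symmetric_def by (metis count_list_0_iff)
  also have "\<dots> \<longleftrightarrow> (\<forall>C\<in>set (rev \<phi>). count_list (rev \<phi>) C = count_list (rev \<phi>) (mirror C))"
    by simp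
  finally show ?thesis
    by (simp add: all_set_conv_all_nth del: set_rev count_list_rev)
qed

lemma certificate_exists:
  assumes "symmetric \<phi>" "satisfiable \<phi>"
  shows "\<exists>u. length u \<le> length (encode \<phi>) \<and> certifies \<phi> (rev (map Bit u))"
proof -
  obtain v where v: "\<And>C. C \<in> set \<phi> \<Longrightarrow> clause_sat v C"
    using assms unfolding satisfiable_def by blast
  define ls where "ls = concat (map (\<lambda>C. rev (lits C)) (rev \<phi>))"
  define us where "us = map (\<lambda>l. Bit (lit_sat v l)) ls"
  \<comment> \<open>Reversed, because \<open>split_cmd\<close> delivers the certificate
    reversed.\<close>
  define u where "u = rev (map (lit_sat v) ls)"
  have mark: "mark us m = lit_sat v (ls ! m)" if "m < length ls" for m
  proof -
    have "drop m us = Bit (lit_sat v (ls ! m)) # drop (Suc m) us"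
      using that Cons_nth_drop_Suc[of m us] by (simp add: us_def)
    then show ?thesis
      by (simp add: mark_def)
  qed
  have "value_word True us ls i \<noteq> value_word False us ls m" if "i < length ls" "m < length ls" for i m
  proof
    assume "value_word True us ls i = value_word False us ls m"
    then have "map Bit (binary (vr (ls ! i))) = map Bit (binary (vr (ls ! m)))"
      "(sg (ls ! i) = lit_sat v (ls ! i)) \<noteq> (sg (ls ! m) = lit_sat v (ls ! m))"
      using that by (auto simp: value_word_def mark)
    moreover from this(1) have "vr (ls ! i) = vr (ls ! m)"
      by (intro binary_inj) (simp add: inj_map_eq_map inj_def)
    ultimately show False
      by (auto simp: lit_sat_sg)
  qed
  moreover have "\<exists>i<3. mark us (3 * m + i)" if "m < length (rev \<phi>)" for m
  proof -
    have "clause_sat v (rev \<phi> ! m)"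
      using v that by (metis nth_mem set_rev)
    then obtain i where i: "i < 3" "lit_sat v (rev (lits (rev \<phi> ! m)) ! i)"
      unfolding clause_sat_lits by blast
    then have "mark us (3 * m + i)"
      using mark[of "3 * m + i"] nth_clause_lits[OF that i(1)] that
      by (simp add: ls_def length_clause_lits)
    then show ?thesis
      using i by blast
  qed
  moreover have "rev (map Bit u) = us"
    by (simp add: u_def us_def rev_map)
  \<comment> \<open>Each literal occupies at least the two bits of its sign, so the input length
    itself bounds the certificate.\<close>
  moreover have "length (concat (map encode_literal ms)) \<ge> length ms" for ms
    by (induction ms) (auto simp: encode_literal_eq)
  then have "length u \<le> length (encode \<phi>)"
    by (simp add: u_def ls_def encode_lits flip: rev_concat_lits)
  ultimately show ?thesis
    using assms(1) unfolding certifies_def Let_def symmetric_iff ls_def by blast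
qed

lemma certificate_sound:
  assumes "certifies \<phi> us"
  shows "symmetric \<phi>" "satisfiable \<phi>"
proof -
  define ls where "ls = concat (map (\<lambda>C. rev (lits C)) (rev \<phi>))"
  have cons: "\<And>i m. i < length ls \<Longrightarrow> m < length ls \<Longrightarrow> value_word True us ls i \<noteq> value_word False us ls m"
    and cl: "\<And>m. m < length (rev \<phi>) \<Longrightarrow> (\<exists>i<3. mark us (3 * m + i)) \<and>
       count_list (rev \<phi>) (rev \<phi> ! m) = count_list (rev \<phi>) (mirror (rev \<phi> ! m))"
    using assms unfolding certifies_def Let_def ls_def by blast+
  show "symmetric \<phi>"
    unfolding symmetric_iff using cl by simp
  \<comment> \<open>A variable is true if some occurrence claims so; consistency makes all its
    occurrences agree.\<close>
  define v where "v j \<longleftrightarrow> (\<exists>i<length ls. vr (ls ! i) = j \<and> sg (ls ! i) = mark us i)" for j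
  have v: "v (vr (ls ! m)) = (sg (ls ! m) = mark us m)" if "m < length ls" for m
  proof -
    have "(sg (ls ! i) = mark us i) = (sg (ls ! m) = mark us m)"
      if "i < length ls" "vr (ls ! i) = vr (ls ! m)" for i
      using cons[OF that(1) \<open>m < length ls\<close>] that(2) by (auto simp: value_word_def)
    then have "v (vr (ls ! m)) \<Longrightarrow> sg (ls ! m) = mark us m"
      unfolding v_def by metis
    moreover have "sg (ls ! m) = mark us m \<Longrightarrow> v (vr (ls ! m))"
      unfolding v_def using that by blast
    ultimately show ?thesis
      by blast
  qed
  have "clause_sat v C" if "C \<in> set \<phi>" for C
  proof -
    have "C \<in> set (rev \<phi>)"
      using that by simp
    then obtain m where m: "m < length (rev \<phi>)" "C = rev \<phi> ! m"
      unfolding in_set_conv_nth by metis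
    obtain i where i: "i < 3" "mark us (3 * m + i)"
      using cl[OF m(1)] by blast
    have "3 * m + i < length ls"
      using m i by (simp add: ls_def length_clause_lits)
    then have "lit_sat v (ls ! (3 * m + i))"
      using i(2) by (simp add: lit_sat_sg v)
    moreover have "ls ! (3 * m + i) = rev (lits C) ! i"
      unfolding ls_def m(2) by (rule nth_clause_lits[OF m(1) i(1)])
    ultimately show ?thesis
      unfolding clause_sat_lits using i(1) by metis
  qed
  then show "satisfiable \<phi>"
    unfolding satisfiable_def by blast
qed

theorem in_NP_symmetric_3SAT: "in_NP symmetric_3SAT"
proof -
  define out where "out w = snd (sem verify_cmd (input_store w, []))" for w
  define V where "V = {w. out w = [True]}"
  have out_iff: "out w = [fst (sem (split_cmd ;; check_cmd) (input_store w, [])) 6 = []]" for w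
    using silent_sem[OF silent_check, of "(input_store w, [])"]
    by (simp add: out_def verify_cmd_def del: sem.simps(8)) (simp add: verify_cmd_def)
  then have out: "out w = [w \<in> V]" for w
    by (simp add: V_def)
  have "\<exists>q. timed 45 (split_cmd ;; (check_cmd ;; If (\<lambda>a _. a = None) 6 6 (Emit [True]) (Emit [False]))) q"
    by (intro timed_seq_exists timed_of_safe[OF safe_split] timed_of_safe[OF safe_check]) auto
  then obtain q where "timed 45 (split_cmd ;; (check_cmd ;;
      If (\<lambda>a _. a = None) 6 6 (Emit [True]) (Emit [False]))) q" ..
  then have "polytime out"
    by (rule polytime_cmd) (simp_all add: out_def verify_cmd_def)
  then have P: "in_P V"
    unfolding in_P_def out[symmetric] by simp
  have V: "pair x u \<in> V \<longleftrightarrow> (\<exists>\<phi>. x = encode \<phi> \<and> certifies \<phi> (rev (map Bit u)))" for x u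
  proof -
    define s :: store where "s = (\<lambda>_. [])(0 := map Bit (pair x u), 2 := [Bit False], 3 := [Bit True],
      4 := rev (map Bit x), 5 := rev (map Bit u))"
    have "pair x u \<in> V \<longleftrightarrow> fst (sem check_cmd (s, [])) 6 = []"
      using out_iff[of "pair x u"] sem_split[of x u] by (simp add: V_def s_def)
    also have "\<dots> \<longleftrightarrow> (\<exists>\<phi>. x = encode \<phi> \<and> certifies \<phi> (rev (map Bit u)))"
      by (rule sem_check) (auto simp: s_def)
    finally show ?thesis .
  qed
  have "x \<in> symmetric_3SAT \<longleftrightarrow> (\<exists>u. length u \<le> poly [:0, 1:] (length x) \<and> pair x u \<in> V)" for x
    unfolding V symmetric_3SAT_def using certificate_exists certificate_sound by simp blast
  then show ?thesis
    unfolding in_NP_def using P by blast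
qed

theorem mainTheorem4:
  shows "NP_hard symmetric_3SAT \<and> NP_complete symmetric_3SAT"
  using NP_hard_symmetric_3SAT in_NP_symmetric_3SAT by (simp add: NP_complete_def)

end
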